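(* Let $n\ge 3$ and let $k$ be an integer with $1\le k\le n$. Let $u\in C^2(\mathbb{R}^n)$ be a positive function satisfying $$\sigma_k(\lambda(A^u))=1\quad\text{and}\quad \lambda(A^u)\in\Gamma_k\qquad\text{on }\mathbb{R}^n.$$ Then there exist $a>0$ and $\bar x\in\mathbb{R}^n$ such that $$u(x)=c(n,k)\left(\frac{a}{1+a^2|x-\bar x|^2}\right)^{\frac{n-2}{2}}\qquad\text{for all }x\in\mathbb{R}^n,$$ where $c(n,k)=2^{(n-2)/4}\binom{n}{k}^{(n-2)/(4k)}$.
   Context: For $1\le k\le n$ and $\lambda=(\lambda_1,\dots,\lambda_n)\in\mathbb{R}^n$, $\sigma_k(\lambda)=\sum_{1\le i_1<\cdots<i_k\le n}\lambda_{i_1}\cdots\lambda_{i_k}$ is the $k$-th elementary symmetric function, and $\Gamma_k$ is the connected component of $\{\lambda\in\mathbb{R}^n \mid \sigma_k(\lambda)>0\}$ containing the positive cone $\{\lambda\in\mathbb{R}^n\mid \lambda_1,\dots,\lambda_n>0\}$. For a positive $C^2$ function $u$ on an open subset of $\mathbb{R}^n$, $n\ge 3$, $$A^u:=-\frac{2}{n-2}u^{-\frac{n+2}{n-2}}\nabla^2u+\frac{2n}{(n-2)^2}u^{-\frac{2n}{n-2}}\nabla u\otimes\nabla u-\frac{2}{(n-2)^2}u^{-\frac{2n}{n-2}}|\nabla u|^2 I,$$ where $\nabla u$ and $\nabla^2u$ are the Euclidean gradient and Hessian and $I$ is the $n\times n$ identity matrix; $\lambda(A^u)$ denotes the eigenvalues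 (with multiplicity) of the symmetric matrix $A^u$ at each point. The order of the eigenvalues is irrelevant since $\sigma_k$ and $\Gamma_k$ are symmetric. *)

theory Defs
  imports "HOL-Analysis.Analysis"
begin

subsection \<open>Elementary symmetric functions and the cones \<open>\<Gamma>\<^sub>k\<close>\<close>

text \<open>Strictly increasing index tuples of length \<open>k\<close> are represented by the
  \<open>k\<close>-element subsets of the index type.\<close>

definition elem_sym :: "nat \<Rightarrow> real^'n \<Rightarrow> real" where
  "elem_sym k l = (\<Sum>I\<in>{I. card I = k}. \<Prod>i\<in>I. l $ i)"

definition positive_cone :: "(real^'n) set" where
  "positive_cone = {l. \<forall>i. 0 < l $ i}"

definition garding_cone :: "nat \<Rightarrow> (real^'n) set" where
  "garding_cone k = (THE C. C \<in> components {l. 0 < elem_sym k l} \<and> positive_cone \<subseteq> C)"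

lemma elem_sym_pos:
  fixes l :: "real^'n"
  assumes "k \<le> CARD('n)" and "l \<in> positive_cone"
  shows "0 < elem_sym k l"
proof -
  obtain I :: "'n set" where "card I = k"
    using assms(1) obtain_subset_with_card_n by metis
  then have "{I :: 'n set. card I = k} \<noteq> {}" by auto
  then show ?thesis
    using assms(2) unfolding elem_sym_def
    by (intro sum_pos) (auto simp: positive_cone_def intro: prod_pos)
qed

lemma convex_positive_cone: "convex (positive_cone :: (real^'n) set)"
proof -
  have "convex {l :: real^'n. 0 < l $ i}" for i
    using convex_halfspace_gt[of 0 "axis i 1 :: real^'n"] by (simp add: inner_axis')
  then have "convex (\<Inter>i. {l :: real^'n. 0 < l $ i})" by (rule convex_INT)
  moreover have "(\<Inter>i. {l :: real^'n. 0 < l $ i}) = positive_cone"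
    by (auto simp: positive_cone_def)
  ultimately show ?thesis by simp
qed

lemma components_eq_component_set:
  assumes "C \<in> components S" and "x \<in> C"
  shows "C = connected_component_set S x"
proof -
  obtain y where "C = connected_component_set S y"
    using assms(1) unfolding components_def by blast
  then show ?thesis
    using assms(2) connected_component_eq[of x S y] by simp
qed

lemma garding_cone_ex1:
  assumes "k \<le> CARD('n)"
  shows "\<exists>!C :: (real^'n) set. C \<in> components {l. 0 < elem_sym k l} \<and> positive_cone \<subseteq> C"
proof -
  let ?S = "{l :: real^'n. 0 < elem_sym k l}"
  have one: "(\<chi> i. 1) \<in> (positive_cone :: (real^'n) set)"
    by (simp add: positive_cone_def)
  have sub: "positive_cone \<subseteq> ?S"
    using elem_sym_pos[OF assms] by auto
  show ?thesis
  proof (rule ex1I[where a = "connected_component_set ?S (\<chi> i. 1)"])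
    show "connected_component_set ?S (\<chi> i. 1) \<in> components ?S \<and>
        positive_cone \<subseteq> connected_component_set ?S (\<chi> i. 1)"
      using one sub convex_connected[OF convex_positive_cone]
      by (auto intro!: componentsI dest: connected_component_maximal)
  next
    fix C assume "C \<in> components ?S \<and> positive_cone \<subseteq> C"
    then show "C = connected_component_set ?S (\<chi> i. 1)"
      using one by (intro components_eq_component_set) auto
  qed
qed

lemma garding_cone_eq:
  assumes "k \<le> CARD('n)"
  shows "garding_cone k = connected_component_set {l :: real^'n. 0 < elem_sym k l} (\<chi> i. 1)"
proof -
  let ?C = "garding_cone k :: (real^'n) set"
  have "?C \<in> components {l. 0 < elem_sym k l} \<and> positive_cone \<subseteq> ?C"
    using theI'[OF garding_cone_ex1[OF assms]] unfolding garding_cone_def by assumption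
  moreover have "(\<chi> i. 1) \<in> (positive_cone :: (real^'n) set)"
    by (simp add: positive_cone_def)
  ultimately have C: "?C \<in> components {l. 0 < elem_sym k l}" "(\<chi> i. 1) \<in> ?C"
    by auto
  show ?thesis by (rule components_eq_component_set[OF C])
qed

subsection \<open>Eigenvalues of a symmetric matrix\<close>

definition is_eigenvalues :: "real^'n^'n \<Rightarrow> real^'n \<Rightarrow> bool" where
  "is_eigenvalues A l \<longleftrightarrow> (\<forall>t. det (mat t - A) = (\<Prod>i\<in>UNIV. t - l $ i))"

text \<open>The eigenvalues are listed in an arbitrary order; the choice is meaningful for symmetric
  matrices, by \<open>is_eigenvalues_eigenvalues\<close> below.\<close>

definition eigenvalues :: "real^'n^'n \<Rightarrow> real^'n" where
  "eigenvalues A = (SOME l. is_eigenvalues A l)"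

lemma symmetric_eigenvector_ex:
  fixes A :: "real^'n^'n"
  assumes sym: "transpose A = A" and S: "subspace S" and inv: "\<And>x. x \<in> S \<Longrightarrow> A *v x \<in> S"
    and ne: "S \<noteq> {0}"
  obtains v c where "v \<in> S" "norm v = 1" "A *v v = c *\<^sub>R v"
proof -
  have selfadj: "x \<bullet> (A *v y) = (A *v x) \<bullet> y" for x y
    by (metis dot_lmul_matrix sym transpose_matrix_vector)
  let ?K = "S \<inter> sphere 0 1"
  let ?q = "\<lambda>x. x \<bullet> (A *v x)"
  have "compact ?K"
    by (simp add: closed_subspace[OF S] closed_Int_compact)
  moreover obtain z where z: "z \<in> S" "z \<noteq> 0"
    using ne subspace_0[OF S] by blast
  then have "(1 / norm z) *\<^sub>R z \<in> ?K"
    using subspace_scale[OF S] by simp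
  then have "?K \<noteq> {}" by blast
  moreover have "continuous_on ?K ?q"
    by (intro continuous_intros)
  ultimately obtain v where v: "v \<in> ?K" and max: "\<And>y. y \<in> ?K \<Longrightarrow> ?q y \<le> ?q v"
    using continuous_attains_sup[of ?K ?q] by blast
  define M where "M = ?q v"
  have vS: "v \<in> S" and nv: "norm v = 1" using v by auto
  have vv: "v \<bullet> v = 1" using nv by (simp add: norm_eq_1)
  have bound: "?q y \<le> M * (y \<bullet> y)" if "y \<in> S" for y
  proof (cases "y = 0")
    case False
    have "(1 / norm y) *\<^sub>R y \<in> ?K"
      using that subspace_scale[OF S] False by simp
    from max[OF this] have "?q y / (norm y)\<^sup>2 \<le> M"
      by (simp add: M_def matrix_vector_mult_scaleR power2_eq_square)
    then show ?thesis
      using False by (simp add: power2_norm_eq_inner divide_simps)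
  qed simp
  have zero: "w \<bullet> (A *v v) = 0" if w: "w \<in> S" "w \<bullet> v = 0" for w
  proof -
    define b where "b = w \<bullet> (A *v v)"
    define d where "d = M * (w \<bullet> w) - ?q w"
    have vb: "v \<bullet> (A *v w) = b"
      by (simp add: b_def selfadj[of v w] inner_commute)
    have ineq: "2 * t * b \<le> t\<^sup>2 * d" for t
    proof -
      have "v + t *\<^sub>R w \<in> S"
        using vS w subspace_add[OF S] subspace_scale[OF S] by blast
      from bound[OF this] show ?thesis
        using w(2) vb unfolding b_def[symmetric]
        by (simp add: matrix_vector_right_distrib matrix_vector_mult_scaleR inner_add_left
            inner_add_right vv inner_commute[of v w] d_def power2_eq_square algebra_simps
            flip: M_def b_def)
    qed
    show ?thesis
    proof (rule ccontr)
      assume "w \<bullet> (A *v v) \<noteq> 0"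
      then have b0: "b \<noteq> 0" by (simp add: b_def)
      define e where "e = 1 / (\<bar>d\<bar> + 1)"
      have e: "0 < e" "e * \<bar>d\<bar> < 1" by (auto simp: e_def field_simps)
      have "2 * e * b\<^sup>2 \<le> e * b\<^sup>2 * (e * d)"
        using ineq[of "e * b"] by (simp add: power2_eq_square algebra_simps)
      then have "2 \<le> e * d"
        using e(1) b0 by (simp add: mult.commute[of 2] mult.assoc)
      moreover have "e * d \<le> e * \<bar>d\<bar>" using e(1) by simp
      ultimately show False using e(2) by linarith
    qed
  qed
  define w where "w = A *v v - M *\<^sub>R v"
  have wS: "w \<in> S"
    unfolding w_def using vS inv subspace_diff[OF S] subspace_scale[OF S] by blast
  have wv: "w \<bullet> v = 0"
    by (simp add: w_def inner_diff_left vv M_def inner_commute[of "A *v v" v])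
  have "w \<bullet> w = w \<bullet> (A *v v) - M * (w \<bullet> v)"
    by (simp add: w_def inner_diff_right)
  then have "w = 0" using zero[OF wS wv] wv by simp
  then show thesis using that[of v M] vS nv by (simp add: w_def)
qed

lemma symmetric_eigenbasis_subspace:
  fixes A :: "real^'n^'n"
  assumes "transpose A = A" and "subspace S" and "\<And>x. x \<in> S \<Longrightarrow> A *v x \<in> S"
  shows "\<exists>B \<subseteq> S. finite B \<and> card B = dim S \<and> pairwise orthogonal B \<and>
    (\<forall>b\<in>B. norm b = 1 \<and> (\<exists>c. A *v b = c *\<^sub>R b))"
  using assms(2,3)
proof (induction "dim S" arbitrary: S)
  case 0
  then show ?case by (intro exI[of _ "{}"]) (auto simp: pairwise_def)
next
  case (Suc m)
  have "S \<noteq> {0}" using Suc.hyps(2) by auto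
  then obtain v c where v: "v \<in> S" "norm v = 1" "A *v v = c *\<^sub>R v"
    using symmetric_eigenvector_ex[OF assms(1) Suc.prems] by blast
  define T where "T = {y \<in> S. orthogonal v y}"
  have T: "subspace T"
    unfolding T_def using Suc.prems(1) subspace_inter[OF _ subspace_orthogonal_to_vector[of v]]
    by (simp add: Int_def)
  have "span {v} \<subseteq> S"
    using v(1) Suc.prems(1) by (intro span_minimal) auto
  then have "dim {y \<in> S. \<forall>x\<in>span {v}. orthogonal x y} + dim (span {v}) = dim S"
    using Suc.prems(1) by (intro dim_subspace_orthogonal_to_vectors) auto
  moreover have "{y \<in> S. \<forall>x\<in>span {v}. orthogonal x y} = T"
    by (auto simp: T_def span_singleton orthogonal_def dest: spec[of _ 1])
  moreover have "dim (span {v}) = 1" using v(2) by (auto simp: dim_singleton)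
  ultimately have dT: "m = dim T" using Suc.hyps(2) by simp
  have "A *v x \<in> T" if "x \<in> T" for x
  proof -
    have "v \<bullet> (A *v x) = (A *v v) \<bullet> x"
      by (metis dot_lmul_matrix assms(1) transpose_matrix_vector)
    then show ?thesis using that Suc.prems(2) v(3) by (auto simp: T_def orthogonal_def)
  qed
  from Suc.hyps(1)[OF dT T this] obtain B where B: "B \<subseteq> T" "finite B" "card B = dim T"
    "pairwise orthogonal B" "\<forall>b\<in>B. norm b = 1 \<and> (\<exists>c. A *v b = c *\<^sub>R b)" by blast
  have "v \<notin> B" using B(1) v(2) by (auto simp: T_def orthogonal_def)
  then have "card (insert v B) = dim S" using B dT Suc.hyps(2) by simp
  moreover have "pairwise orthogonal (insert v B)"
    using B(1,4) by (auto simp: pairwise_insert T_def orthogonal_commute)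
  moreover have "insert v B \<subseteq> S" using B(1) v(1) by (auto simp: T_def)
  ultimately show ?case using B v by (intro exI[of _ "insert v B"]) auto
qed

lemma is_eigenvalues_eigenvalues:
  fixes A :: "real^'n^'n"
  assumes "transpose A = A"
  shows "is_eigenvalues A (eigenvalues A)"
proof -
  obtain B where B: "finite B" "card B = CARD('n)" "pairwise orthogonal B"
    "\<forall>b\<in>B. norm b = 1 \<and> (\<exists>c. A *v b = c *\<^sub>R b)"
    using symmetric_eigenbasis_subspace[OF assms subspace_UNIV] by (auto simp: dim_UNIV)
  obtain e :: "'n \<Rightarrow> real^'n" where e: "bij_betw e UNIV B"
    using B(1,2) finite_same_card_bij[of "UNIV :: 'n set" B] by auto
  have eB: "e i \<in> B" for i using e by (auto simp: bij_betw_def)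
  have "\<forall>i. \<exists>c. A *v e i = c *\<^sub>R e i" using B(4) eB by blast
  then obtain l where l: "\<And>i. A *v e i = l i *\<^sub>R e i" unfolding choice_iff by blast
  define P :: "real^'n^'n" where "P = (\<chi> i j. e j $ i)"
  have col: "column j P = e j" for j by (simp add: P_def column_def vec_eq_iff)
  have "orthogonal_matrix P"
    unfolding orthogonal_matrix_orthonormal_columns col
    using B(3,4) eB bij_betw_imp_inj_on[OF e] by (metis injD pairwiseD)
  then have detP: "det P \<noteq> 0" using det_orthogonal_matrix by fastforce
  have "det (mat t - A) = (\<Prod>i\<in>UNIV. t - l i)" for t
  proof -
    let ?D = "(\<chi> i j. if i = j then t - l i else 0) :: real^'n^'n"
    have "((mat t - A) ** P) $ i $ j = (P ** ?D) $ i $ j" for i j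
    proof -
      have "((mat t - A) ** P) $ i $ j = ((mat t - A) *v e j) $ i"
        by (simp add: matrix_matrix_mult_def matrix_vector_mult_def P_def)
      also have "mat t *v e j = t *\<^sub>R e j"
        by (simp add: vec_eq_iff matrix_vector_mult_def mat_def if_distrib if_distribR cong: if_cong)
      then have "((mat t - A) *v e j) $ i = (t - l j) * e j $ i"
        by (simp add: matrix_vector_mult_diff_rdistrib l algebra_simps)
      also have "\<dots> = (P ** ?D) $ i $ j"
        by (simp add: matrix_matrix_mult_def P_def if_distrib cong: if_cong)
      finally show ?thesis .
    qed
    then have "(mat t - A) ** P = P ** ?D" by (simp add: vec_eq_iff)
    then have "det (mat t - A) * det P = det P * det ?D"
      by (simp flip: det_mul)
    moreover have "det ?D = (\<Prod>i\<in>UNIV. t - l i)"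
      by (subst det_diagonal) auto
    ultimately show ?thesis using detP by simp
  qed
  then have "is_eigenvalues A (\<chi> i. l i)" by (simp add: is_eigenvalues_def)
  then show ?thesis unfolding eigenvalues_def by (rule someI)
qed

subsection \<open>The conformal Hessian\<close>

definition grad :: "(real^'n \<Rightarrow> real) \<Rightarrow> real^'n \<Rightarrow> real^'n" where
  "grad u x = (\<chi> i. frechet_derivative u (at x) (axis i 1))"

definition hess :: "(real^'n \<Rightarrow> real) \<Rightarrow> real^'n \<Rightarrow> real^'n^'n" where
  "hess u x = jacobian (grad u) (at x)"

definition C2_on :: "(real^'n) set \<Rightarrow> (real^'n \<Rightarrow> real) \<Rightarrow> bool" where
  "C2_on S u \<longleftrightarrow> open S \<and> (\<forall>x\<in>S. u differentiable at x) \<and>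
     (\<forall>x\<in>S. grad u differentiable at x) \<and> continuous_on S (hess u)"

definition conf_hess :: "(real^'n \<Rightarrow> real) \<Rightarrow> real^'n \<Rightarrow> real^'n^'n" where
  "conf_hess u x = (let n = real CARD('n) in
      (- 2 / (n - 2) * u x powr (- (n + 2) / (n - 2))) *\<^sub>R hess u x
    + (2 * n / (n - 2)\<^sup>2 * u x powr (- (2 * n) / (n - 2))) *\<^sub>R (\<chi> i j. grad u x $ i * grad u x $ j)
    - (2 / (n - 2)\<^sup>2 * u x powr (- (2 * n) / (n - 2)) * (norm (grad u x))\<^sup>2) *\<^sub>R mat 1)"

end

(* The method of moving spheres, applied to w = u powr (-2/(n-2)), for which the conformal Hessian
   becomes w D^2 w - |D w|^2 I / 2 and no powers occur. The Kelvin transform of w in the sphere of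
   centre x and radius L has a matrix orthogonally conjugate to that of w. Small spheres satisfy:
   w is at most its Kelvin transform outside the sphere. The radius can be increased until
   alpha L^2 = w(x), where alpha is the upper limit of w(y)/|y|^2 at infinity: before that, contact is
   excluded by the strong maximum principle in the exterior, by the Hopf lemma on the sphere, and by
   the strict inequality at infinity. Seen from infinity, the critical Kelvin transforms for all x
   touch the inverted w at the origin, and superharmonicity of the inverted u forces their gradients
   D w(x) - 2 alpha x there to coincide. Hence w(x) = alpha |x - xbar|^2 + d.
   Ellipticity of sigma_k on Gamma_k rests on Newton's inequalities for real-rooted polynomials. *)
theory Submission
  imports Defs "HOL-Computational_Algebra.Fundamental_Theorem_Algebra"
begin

section \<open>Newton inequalities and the cone\<close>

text \<open>Nothing is assumed at infinity: the inverted \<open>w\<close> is only known to be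
  bounded above near the origin, and what survives of a limit there is the upper limit alpha. Hence
  the comparison at the singularity is made from above. It uses only sigma_1 > 0, which makes
  \<open>u\<close> and its inversion superharmonic. Two solutions of the fully nonlinear equation
  are compared through their matrices: where the difference, corrected by a barrier, has a negative
  minimum, one matrix dominates the other. Sigma_k is monotone because it is affine along rank-one
  symmetric perturbations, with slopes built from elementary symmetric functions of n - 1
  eigenvalues, which Newton's inequalities make positive on the cone. That alpha is positive is part
  of the proof: with alpha = 0 no sphere could be critical, so all spheres about all points would
  satisfy the comparison, which forces D w = 0 against sigma_k = 1. The value of c(n,k) comes from
  the vertex of the paraboloid, where the matrix is 2 alpha d times the identity.\<close>

inductive real_rooted :: "real poly \<Rightarrow> bool" where
  const: "real_rooted [:c:]"
| linear: "real_rooted p \<Longrightarrow> real_rooted ([:a, b:] * p)"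

lemma real_rooted_prod:
  assumes "finite J"
  shows "real_rooted (\<Prod>i\<in>J. [:a i, b i:])"
  using assms
proof (induction rule: finite_induct)
  case empty
  show ?case using real_rooted.const[of 1] by (simp add: one_pCons)
next
  case (insert i J)
  then show ?case by (simp add: real_rooted.linear del: mult_pCons_left)
qed

lemma map_poly_of_real_linear_mult:
  "map_poly complex_of_real ([:a, b:] * p) = [:of_real a, of_real b:] * map_poly of_real p"
  by (rule poly_eqI) (auto simp: coeff_map_poly coeff_pCons split: nat.splits)

lemma map_poly_of_real_pderiv:
  "map_poly complex_of_real (pderiv p) = pderiv (map_poly of_real p)"
  by (rule poly_eqI) (simp add: coeff_map_poly coeff_pderiv)

text \<open>The logarithmic derivative is a sum of terms b / (a + b z). The imaginary part of each
  has the sign opposite to that of Im z, strictly unless b = 0, and a nonzero derivative forces some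
  factor with nonzero b.\<close>

lemma real_rooted_log_derivative_Im:
  assumes "real_rooted p" and "p \<noteq> 0" and z: "Im z \<noteq> 0"
  defines "P \<equiv> \<lambda>p. map_poly complex_of_real p"
  shows "poly (P p) z \<noteq> 0 \<and> Im (poly (pderiv (P p)) z / poly (P p) z) * Im z \<le> 0 \<and>
    (pderiv p \<noteq> 0 \<longrightarrow> Im (poly (pderiv (P p)) z / poly (P p) z) * Im z < 0)"
  using assms(1,2)
proof (induction rule: real_rooted.induct)
  case (const c)
  then show ?case by (simp add: P_def pderiv_pCons map_poly_pCons)
next
  case (linear p a b)
  then have p: "p \<noteq> 0" and ab: "a \<noteq> 0 \<or> b \<noteq> 0" by auto
  note IH = linear.IH[OF p]
  let ?P = "poly (P p) z" and ?Q = "poly (pderiv (P p)) z"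
  let ?f = "of_real a + of_real b * z"
  have f0: "?f \<noteq> 0"
  proof
    assume "?f = 0"
    then have "Im ?f = 0" "Re ?f = 0" by simp_all
    then show False using ab z by auto
  qed
  have e1: "poly (P ([:a, b:] * p)) z = ?f * ?P"
    unfolding P_def map_poly_of_real_linear_mult by (simp add: algebra_simps)
  have e2: "poly (pderiv (P ([:a, b:] * p))) z = of_real b * ?P + ?f * ?Q"
    unfolding P_def map_poly_of_real_linear_mult pderiv_mult
    by (simp add: algebra_simps pderiv_pCons)
  have e3: "(of_real b * ?P + ?f * ?Q) / (?f * ?P) = of_real b / ?f + ?Q / ?P"
    using f0 IH by (simp add: field_simps)
  have e4: "Im (of_real b / ?f) * Im z = - (b * Im z)\<^sup>2 / (cmod ?f)\<^sup>2"
    by (simp add: Im_divide cmod_def power2_eq_square)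
  have e5: "Im (of_real b / ?f) * Im z \<le> 0" "b \<noteq> 0 \<Longrightarrow> Im (of_real b / ?f) * Im z < 0"
    using z f0 unfolding e4 by (auto intro!: divide_nonpos_pos divide_neg_pos mult_pos_pos)
  have "pderiv ([:a,b:] * p) \<noteq> 0 \<Longrightarrow> b = 0 \<Longrightarrow> pderiv p \<noteq> 0"
    by (auto simp: pderiv_smult)
  then have "Im (of_real b / ?f + ?Q / ?P) * Im z \<le> 0 \<and>
      (pderiv ([:a, b:] * p) \<noteq> 0 \<longrightarrow> Im (of_real b / ?f + ?Q / ?P) * Im z < 0)"
    using IH e5 by (cases "b = 0") (auto simp only: plus_complex.simps distrib_right
      intro: add_neg_nonpos add_nonpos_neg add_nonpos_nonpos)
  then show ?case unfolding e1 e2 e3 using f0 IH by (simp del: mult_pCons_left)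
qed

text \<open>Roots are split off one at a time: the fundamental theorem of algebra supplies one, the
  hypothesis makes it real, and the quotient inherits the hypothesis.\<close>

lemma real_rootedI:
  assumes "\<And>z. poly (map_poly complex_of_real q) z = 0 \<Longrightarrow> Im z = 0"
  shows "real_rooted q"
  using assms
proof (induction "degree q" arbitrary: q)
  case 0
  then show ?case by (metis degree_0_id degree_eq_zeroE real_rooted.const)
next
  case (Suc d)
  have "degree (map_poly complex_of_real q) = Suc d"
    using Suc.hyps(2) by (simp add: degree_map_poly)
  then have "\<not> constant (poly (map_poly complex_of_real q))"
    by (simp add: Fundamental_Theorem_Algebra.constant_degree)
  from fundamental_theorem_of_algebra[OF this] obtain z where z: "poly (map_poly complex_of_real q) z = 0"
    by blast
  with Suc.prems have zr: "z = of_real (Re z)" by (simp add: complex_eq_iff)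
  have "of_real (poly q (Re z)) = poly (map_poly complex_of_real q) (of_real (Re z))"
    by (induction q) (auto simp: map_poly_pCons)
  then have "poly q (Re z) = 0" using z zr by (metis of_real_eq_0_iff)
  then obtain q' where q': "q = [:- Re z, 1:] * q'" by (metis dvdE poly_eq_0_iff_dvd)
  have "q' \<noteq> 0" using q' Suc.hyps(2) by auto
  then have "d = degree q'" using Suc.hyps(2) unfolding q' by (simp add: degree_mult_eq del: mult_pCons_left)
  moreover have "Im y = 0" if "poly (map_poly complex_of_real q') y = 0" for y
    using Suc.prems[of y] that unfolding q' map_poly_of_real_linear_mult by simp
  ultimately have "real_rooted q'" using Suc.hyps(1) by blast
  then show ?case unfolding q' by (rule real_rooted.linear)
qed

text \<open>The Gauss--Lucas argument: the logarithmic derivative has no zero off the real axis.\<close>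
lemma real_rooted_pderiv:
  assumes "real_rooted p"
  shows "real_rooted (pderiv p)"
proof (cases "pderiv p = 0")
  case True
  then show ?thesis using real_rooted.const[of 0] by simp
next
  case False
  show ?thesis
  proof (rule real_rootedI, rule ccontr)
    fix z assume "poly (map_poly complex_of_real (pderiv p)) z = 0" and z: "Im z \<noteq> 0"
    then have "poly (pderiv (map_poly complex_of_real p)) z = 0"
      by (simp add: map_poly_of_real_pderiv)
    moreover have "p \<noteq> 0" using False by auto
    ultimately show False
      using real_rooted_log_derivative_Im[OF assms _ z] False by simp
  qed
qed

text \<open>This is concavity of log |p|, written without division so that it also holds at the
  roots. A factor f = a + b x turns the defect p'^2 - p p'' into (b p)^2 plus f^2 times the old
  defect.\<close>

lemma real_rooted_laguerre:
  assumes "real_rooted p"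
  shows "poly p x * poly (pderiv (pderiv p)) x \<le> (poly (pderiv p) x)\<^sup>2"
  using assms
proof (induction rule: real_rooted.induct)
  case (const c)
  then show ?case by (simp add: pderiv_pCons)
next
  case (linear p a b)
  let ?f = "a + b * x" and ?p = "poly p x" and ?q = "poly (pderiv p) x" and ?r = "poly (pderiv (pderiv p)) x"
  have "poly ([:a, b:] * p) x = ?f * ?p" by (simp add: algebra_simps)
  moreover have "poly (pderiv ([:a, b:] * p)) x = b * ?p + ?f * ?q"
    unfolding pderiv_mult by (simp add: pderiv_pCons algebra_simps)
  moreover have "poly (pderiv (pderiv ([:a, b:] * p))) x = 2 * b * ?q + ?f * ?r"
    unfolding pderiv_mult pderiv_add by (simp add: pderiv_pCons algebra_simps)
  moreover have "(b * ?p + ?f * ?q)\<^sup>2 - (?f * ?p) * (2 * b * ?q + ?f * ?r)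
      = (b * ?p)\<^sup>2 + ?f\<^sup>2 * (?q\<^sup>2 - ?p * ?r)"
    by (simp add: power2_eq_square algebra_simps)
  moreover have "0 \<le> (b * ?p)\<^sup>2 + ?f\<^sup>2 * (?q\<^sup>2 - ?p * ?r)"
    using linear.IH by (intro add_nonneg_nonneg mult_nonneg_nonneg) auto
  ultimately show ?case by simp
qed

text \<open>Laguerre's inequality at 0 for the j-th derivative, whose Taylor coefficients there are
  factorials times coefficients of \<open>p\<close>. It gives the sharper factor (j + 1) / (j + 2)
  on the right, which is then weakened to 1.\<close>

lemma real_rooted_newton:
  assumes "real_rooted p"
  shows "coeff p j * coeff p (j + 2) \<le> (coeff p (j + 1))\<^sup>2"
proof -
  define q where "q = (pderiv ^^ j) p"
  have q: "real_rooted q"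
    unfolding q_def using assms by (induction j) (auto intro: real_rooted_pderiv)
  have c: "poly ((pderiv ^^ m) p) 0 = fact m * coeff p m" for m
    by (simp add: poly_0_coeff_0 coeff_higher_pderiv pochhammer_fact)
  have "poly q 0 * poly (pderiv (pderiv q)) 0 \<le> (poly (pderiv q) 0)\<^sup>2"
    using q by (rule real_rooted_laguerre)
  moreover have "pderiv (pderiv q) = (pderiv ^^ (j + 2)) p" "pderiv q = (pderiv ^^ (j + 1)) p"
    by (simp_all add: q_def)
  ultimately have "(fact j * coeff p j) * (fact (j + 2) * coeff p (j + 2)) \<le> (fact (j + 1) * coeff p (j + 1))\<^sup>2"
    using c[of j] c[of "j+1"] c[of "j+2"] by (simp add: q_def)
  then have "(fact j * fact (j + 1)) * (real (j + 2) * (coeff p j * coeff p (j + 2)))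
     \<le> (fact j * fact (j + 1)) * (real (j + 1) * (coeff p (j + 1))\<^sup>2)"
    by (simp add: power2_eq_square algebra_simps)
  then have *: "real (j + 2) * (coeff p j * coeff p (j + 2)) \<le> real (j + 1) * (coeff p (j + 1))\<^sup>2"
    by simp
  show ?thesis
  proof (rule ccontr)
    assume "\<not> ?thesis"
    then have n: "(coeff p (j + 1))\<^sup>2 < coeff p j * coeff p (j + 2)" by simp
    then have "real (j + 1) * (coeff p (j + 1))\<^sup>2 < real (j + 1) * (coeff p j * coeff p (j + 2))"
      by simp
    moreover have "0 \<le> coeff p j * coeff p (j + 2)"
      using n zero_le_power2[of "coeff p (j + 1)"] by linarith
    then have "real (j + 1) * (coeff p j * coeff p (j + 2)) \<le> real (j + 2) * (coeff p j * coeff p (j + 2))"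
      by (intro mult_right_mono) auto
    ultimately show False using * by linarith
  qed
qed

text \<open>Read off from the generating product, so that Newton's inequalities apply directly; the
  explicit index set allows a variable to be removed.\<close>

definition esym :: "'a set \<Rightarrow> ('a \<Rightarrow> real) \<Rightarrow> nat \<Rightarrow> real" where
  "esym J l j = coeff (\<Prod>i\<in>J. [:1, l i:]) j"

lemma esym_newton:
  assumes "finite J"
  shows "esym J l j * esym J l (j + 2) \<le> (esym J l (j + 1))\<^sup>2"
  unfolding esym_def by (rule real_rooted_newton[OF real_rooted_prod[OF assms]])

lemma esym_0:
  assumes "finite J"
  shows "esym J l 0 = 1"
  using assms unfolding esym_def
  by (induction rule: finite_induct) (auto simp: coeff_pCons)

lemma esym_remove:
  assumes "finite J" and "i \<in> J"
  shows "esym J l (Suc j) = esym (J - {i}) l (Suc j) + l i * esym (J - {i}) l j"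
proof -
  have "(\<Prod>i\<in>J. [:1, l i:]) = [:1, l i:] * (\<Prod>i\<in>J - {i}. [:1, l i:])"
    using assms by (rule prod.remove)
  then show ?thesis by (simp add: esym_def)
qed

text \<open>\<open>esym (J - {i}) l j\<close> is the derivative of \<open>esym J l (Suc j)\<close>
  with respect to \<open>l i\<close>, so this positivity is the source of ellipticity. It climbs
  through the degrees by induction.\<close>

lemma esym_cone_remove:
  assumes "finite J" and "i \<in> J" and "\<And>j. 1 \<le> j \<Longrightarrow> j \<le> k \<Longrightarrow> 0 < esym J l j"
    and "j < k"
  shows "0 < esym (J - {i}) l j"
  using assms(3,4)
proof (induction j)
  case 0
  then show ?case using assms by (simp add: esym_0)
next
  case (Suc j)
  let ?e = "esym (J - {i}) l"
  have IH: "0 < ?e j" using Suc by auto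
  have a: "0 < ?e (Suc j) + l i * ?e j" "0 < ?e (j + 2) + l i * ?e (Suc j)"
    using Suc.prems(1)[of "Suc j"] Suc.prems(1)[of "j + 2"] Suc.prems(2) esym_remove[OF assms(1,2)]
    by auto
  have b: "?e j * ?e (j + 2) \<le> (?e (Suc j))\<^sup>2"
    using esym_newton[of "J - {i}" l j] assms(1) by simp
  show ?case
  proof (rule ccontr)
    assume "\<not> 0 < ?e (Suc j)"
    then have n: "?e (Suc j) \<le> 0" by simp
    \<comment> \<open>With e_(j+1) <= 0, multiplying the second inequality of \<open>a\<close> by
      e_j and the first by e_(j+1) gives e_j e_(j+2) > e_(j+1)^2, against Newton.\<close>
    have "0 < ?e j * (?e (j + 2) + l i * ?e (Suc j))" using IH a(2) by simp
    moreover have "?e j * l i * ?e (Suc j) \<le> - ?e (Suc j) * ?e (Suc j)"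
      using a(1) n by (intro mult_right_mono_neg) (auto simp: mult.commute)
    ultimately show False using b by (simp add: algebra_simps power2_eq_square)
  qed
qed

lemma elem_sym_eq_esym: "elem_sym k l = esym UNIV (\<lambda>i. l $ i) k"
proof -
  have "(\<Prod>i\<in>UNIV. [:1, l $ i:]) = (\<Prod>i\<in>UNIV. [:0, l $ i:] + 1)"
    by (intro prod.cong) (auto simp: one_pCons)
  also have "\<dots> = (\<Sum>I\<in>Pow UNIV. (\<Prod>i\<in>I. [:0, l $ i:]) * (\<Prod>i\<in>UNIV - I. 1))"
    by (rule prod_add) simp
  also have "\<dots> = (\<Sum>I\<in>UNIV. monom (\<Prod>i\<in>I. l $ i) (card I))"
  proof (intro sum.cong)
    fix I :: "'a set"
    have "finite I" by simp
    then have "(\<Prod>i\<in>I. [:0, l $ i:]) = monom (\<Prod>i\<in>I. l $ i) (card I)"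
      by (induction rule: finite_induct) (auto simp: monom_Suc monom_0 one_pCons smult_monom)
    then show "(\<Prod>i\<in>I. [:0, l $ i:]) * (\<Prod>i\<in>UNIV - I. 1) = monom (\<Prod>i\<in>I. l $ i) (card I)" by simp
  qed auto
  finally have "esym UNIV (\<lambda>i. l $ i) k = (\<Sum>I\<in>UNIV. if card I = k then \<Prod>i\<in>I. l $ i else 0)"
    by (simp add: esym_def coeff_sum)
  also have "\<dots> = elem_sym k l"
    unfolding elem_sym_def by (subst sum.inter_filter[symmetric]) auto
  finally show ?thesis by simp
qed

section \<open>From the connected component to inequalities\<close>

lemma continuous_on_elem_sym [continuous_intros]: "continuous_on S (elem_sym k)"
  unfolding elem_sym_def by (intro continuous_intros)

text \<open>By Newton the ratios e_(j+1) / e_j do not increase, and the first of them is e_1. In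
  this weak form the inequality passes to limits, where it keeps e_k > 0 from coexisting with a
  vanishing lower e_j.\<close>

lemma esym_le_mult:
  assumes "finite J" and pos: "\<And>j. 1 \<le> j \<Longrightarrow> j \<le> k \<Longrightarrow> 0 < esym J l j" and "j < k"
  shows "esym J l (Suc j) \<le> esym J l j * esym J l 1"
  using assms(3)
proof (induction j)
  case 0
  then show ?case by (simp add: esym_0[OF assms(1)])
next
  case (Suc j)
  let ?e = "esym J l"
  have p: "0 < ?e j" using Suc.prems esym_0[OF assms(1), of l] pos by (cases j) auto
  have "?e j * ?e (Suc (Suc j)) \<le> ?e (Suc j) * ?e (Suc j)"
    using esym_newton[OF assms(1), of l j] by (simp add: power2_eq_square)
  also have "\<dots> \<le> ?e (Suc j) * (?e j * ?e 1)"
    using Suc pos[of "Suc j"] by (intro mult_left_mono) auto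
  finally show ?case using p by (simp add: mult.left_commute)
qed

text \<open>The positivity set \<open>G\<close> is relatively open and closed in {e_k > 0}: it is
  open, lies in the closed set \<open>H\<close>, and coincides with \<open>H\<close> wherever e_k >
  0. A connected component containing a point of \<open>G\<close> therefore stays inside.\<close>

lemma garding_cone_imp_elem_sym_pos:
  fixes l :: "real^'n"
  assumes "k \<le> CARD('n)" and l: "l \<in> garding_cone k" and j: "1 \<le> j" "j \<le> k"
  shows "0 < elem_sym j l"
proof -
  let ?S = "{l :: real^'n. 0 < elem_sym k l}"
  let ?C = "connected_component_set ?S (\<chi> i. 1)"
  define G where "G = {l :: real^'n. \<forall>j\<in>{1..k}. 0 < elem_sym j l}"
  have one: "(\<chi> i. 1) \<in> G"
    using assms(1) by (auto simp: G_def positive_cone_def intro!: elem_sym_pos)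
  have oG: "open G"
  proof -
    have "G = (\<Inter>j\<in>{1..k}. {l. 0 < elem_sym j l})" by (auto simp: G_def)
    moreover have "open {l :: real^'n. 0 < elem_sym j l}" for j
      by (intro open_Collect_less continuous_intros)
    ultimately show ?thesis by auto
  qed
  define H where "H = {l :: real^'n. (\<forall>j\<in>{1..k}. 0 \<le> elem_sym j l) \<and>
    (\<forall>j<k. elem_sym (Suc j) l \<le> elem_sym j l * elem_sym 1 l)}"
  have cH: "closed H"
  proof -
    have "H = (\<Inter>j\<in>{1..k}. {l. 0 \<le> elem_sym j l}) \<inter>
      (\<Inter>j\<in>{..<k}. {l. elem_sym (Suc j) l \<le> elem_sym j l * elem_sym 1 l})" by (auto simp: H_def)
    moreover have "closed {l :: real^'n. 0 \<le> elem_sym j l}"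
      "closed {l :: real^'n. elem_sym (Suc j) l \<le> elem_sym j l * elem_sym 1 l}" for j
      by (intro closed_Collect_le continuous_intros)+
    ultimately show ?thesis by auto
  qed
  have GH: "G \<subseteq> H"
  proof
    fix l assume "l \<in> G"
    then have "0 < esym UNIV (($) l) j" if "1 \<le> j" "j \<le> k" for j
      using that by (auto simp: G_def elem_sym_eq_esym)
    then show "l \<in> H" using \<open>l \<in> G\<close> esym_le_mult[of UNIV k "($) l"]
      by (auto simp: H_def G_def elem_sym_eq_esym less_imp_le)
  qed
  have HG: "l \<in> G" if "l \<in> H" "0 < elem_sym k l" for l
  proof -
    \<comment> \<open>Positivity descends from degree k: if 0 < e_(j+1) <= e_j e_1 and e_j >= 0,
      then e_j cannot vanish.\<close>
    have "0 < elem_sym (k - d) l" if "d < k" for d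
      using that
    proof (induction d)
      case (Suc d)
      then have "0 < elem_sym (Suc (k - Suc d)) l" by (simp add: Suc_diff_Suc)
      also have "\<dots> \<le> elem_sym (k - Suc d) l * elem_sym 1 l"
        using \<open>l \<in> H\<close> Suc.prems by (auto simp: H_def)
      finally have "elem_sym (k - Suc d) l \<noteq> 0" by auto
      moreover have "k - Suc d \<in> {1..k}" using Suc.prems by auto
      then have "0 \<le> elem_sym (k - Suc d) l" using \<open>l \<in> H\<close> by (auto simp: H_def)
      ultimately show ?case by simp
    qed (use \<open>0 < elem_sym k l\<close> in simp)
    then have "0 < elem_sym j l" if "j \<in> {1..k}" for j
      using that by (metis One_nat_def Suc_le_eq atLeastAtMost_iff diff_diff_cancel diff_less less_le_trans)
    then show ?thesis by (simp add: G_def)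
  qed
  have "?C \<subseteq> G"
  proof (rule ccontr)
    assume "\<not> ?C \<subseteq> G"
    have sub: "?C \<subseteq> ?S" by (rule connected_component_subset)
    have "?C \<subseteq> G \<union> - H" using HG sub by blast
    moreover have "G \<inter> - H \<inter> ?C = {}" using GH by auto
    moreover have "(\<chi> i. 1) \<in> ?S" using assms(1)
      by (auto simp: positive_cone_def intro!: elem_sym_pos)
    then have "(\<chi> i. 1) \<in> ?C" by simp
    then have "G \<inter> ?C \<noteq> {}" using one by blast
    moreover have "- H \<inter> ?C \<noteq> {}" using \<open>\<not> ?C \<subseteq> G\<close> HG sub by blast
    ultimately show False
      using connectedD[OF connected_connected_component[of ?S "\<chi> i. 1"] oG open_Compl[OF cH]] by blast
  qed
  then show ?thesis using l j unfolding garding_cone_eq[OF assms(1)] G_def by auto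
qed

section \<open>Elementary symmetric functions of a symmetric matrix\<close>

text \<open>A permutation fixing every index other than \<open>i\<close> also fixes
  \<open>i\<close>, so every nonidentity term of the Leibniz expansion meets a vanishing
  off-diagonal entry.\<close>

lemma det_eq_prod_diag_one_row:
  fixes M :: "real^'n^'n"
  assumes "\<And>j k. j \<noteq> i \<Longrightarrow> k \<noteq> j \<Longrightarrow> M $ j $ k = 0"
  shows "det M = (\<Prod>j\<in>UNIV. M $ j $ j)"
proof -
  have "(\<Prod>j\<in>UNIV. M $ j $ p j) = 0" if p: "p permutes UNIV" "p \<noteq> id" for p
  proof -
    have "\<exists>j. j \<noteq> i \<and> p j \<noteq> j"
    proof (rule ccontr)
      assume "\<not> ?thesis"
      then have *: "\<And>j. j \<noteq> i \<Longrightarrow> p j = j" by auto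
      moreover have "p i = i"
      proof (rule ccontr)
        assume "p i \<noteq> i"
        then have "p (p i) = p i" using * by blast
        then show False using \<open>p i \<noteq> i\<close> permutes_inj[OF p(1)] by (auto dest: injD)
      qed
      ultimately show False using p(2) by (metis eq_id_iff)
    qed
    then obtain j where "M $ j $ p j = 0" using assms by blast
    then show ?thesis by (intro prod_zero) auto
  qed
  then have "det M = (\<Sum>p\<in>{id}. of_int (sign p) * (\<Prod>j\<in>UNIV. M $ j $ p j))"
    unfolding det_def by (intro sum.mono_neutral_right) (auto simp: finite_permutations permutes_id)
  then show ?thesis by (simp add: sign_id)
qed

lemma continuous_on_det [continuous_intros]:
  fixes f :: "'b::topological_space \<Rightarrow> real^'n^'n"
  assumes "continuous_on S f"
  shows "continuous_on S (\<lambda>x. det (f x))"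
  unfolding det_def by (intro continuous_intros assms)

text \<open>By multilinearity in the rows, \<open>det (A + B)\<close> is the sum of the determinants
  of these mixtures over all \<open>I\<close>.\<close>

definition rows_mix :: "'n set \<Rightarrow> real^'n^'n \<Rightarrow> real^'n^'n \<Rightarrow> real^'n^'n" where
  "rows_mix I A B = (\<chi> i. if i \<in> I then A $ i else B $ i)"

lemma continuous_on_rows_mix [continuous_intros]:
  fixes f :: "'b::topological_space \<Rightarrow> real^'n^'n"
  assumes "continuous_on S f" "continuous_on S g"
  shows "continuous_on S (\<lambda>x. rows_mix I (f x) (g x))"
  unfolding rows_mix_def
proof (rule continuous_on_vec_lambda)
  fix i show "continuous_on S (\<lambda>x. if i \<in> I then f x $ i else g x $ i)"
    by (cases "i \<in> I") (auto intro!: continuous_intros assms)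
qed

lemma det_add_rows_mix:
  fixes A B :: "real^'n^'n"
  shows "det (A + B) = (\<Sum>I\<in>UNIV. det (rows_mix I A B))"
proof -
  have "(\<Prod>i\<in>UNIV. (A + B) $ i $ p i) = (\<Sum>I\<in>UNIV. \<Prod>i\<in>UNIV. rows_mix I A B $ i $ p i)"
    for p :: "'n \<Rightarrow> 'n"
  proof -
    have "(\<Prod>i\<in>UNIV. rows_mix I A B $ i $ p i) = (\<Prod>i\<in>UNIV. if i \<in> I then A $ i $ p i else B $ i $ p i)" for I
      by (intro prod.cong) (auto simp: rows_mix_def)
    then show ?thesis
      by (simp add: prod_add prod.If_cases Compl_eq_Diff_UNIV)
  qed
  then show ?thesis
    unfolding det_def by (simp add: sum_distrib_left) (rule sum.swap)
qed

lemma rows_mix_UNIV [simp]: "rows_mix UNIV A B = A" and rows_mix_empty [simp]: "rows_mix {} A B = B"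
  by (auto simp: rows_mix_def vec_eq_iff)

lemma det_rows_mix_scaleR: "det (rows_mix I (s *\<^sub>R A) B) = s ^ card I * det (rows_mix I A B)"
proof -
  have "rows_mix I (s *\<^sub>R A) B = (\<chi> i. (if i \<in> I then s else 1) *s (rows_mix I A B $ i))"
    by (auto simp: rows_mix_def vec_eq_iff)
  then have "det (rows_mix I (s *\<^sub>R A) B) = (\<Prod>i\<in>UNIV. if i \<in> I then s else 1) * det (\<chi> i. rows_mix I A B $ i)"
    by (simp only: det_rows_mul)
  then show ?thesis by (simp add: prod.If_cases)
qed

text \<open>The sum of the principal minors of order \<open>j\<close>: replacing the rows outside \<open>I\<close> by those of the
  identity leaves the minor indexed by \<open>I\<close>.\<close>
definition sigma_mat :: "nat \<Rightarrow> real^'n^'n \<Rightarrow> real" where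
  "sigma_mat j A = (\<Sum>I\<in>{I. card I = j}. det (rows_mix I A (mat 1)))"

lemma continuous_on_sigma_mat [continuous_intros]:
  fixes f :: "'b::topological_space \<Rightarrow> real^'n^'n"
  assumes "continuous_on S f"
  shows "continuous_on S (\<lambda>x. sigma_mat j (f x))"
  unfolding sigma_mat_def by (intro continuous_intros assms)

lemma det_one_plus: "det (mat 1 + s *\<^sub>R A) = (\<Sum>j\<le>CARD('n). sigma_mat j A * s ^ j)"
  for A :: "real^'n^'n"
proof -
  have "det (mat 1 + s *\<^sub>R A) = (\<Sum>I\<in>UNIV. s ^ card I * det (rows_mix I A (mat 1)))"
    by (subst add.commute) (simp add: det_add_rows_mix det_rows_mix_scaleR)
  also have "\<dots> = (\<Sum>j\<le>CARD('n). \<Sum>I\<in>{I \<in> UNIV. card I = j}. s ^ card I * det (rows_mix I A (mat 1)))"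
    by (rule sum.group[symmetric]) (auto intro: card_mono)
  also have "\<dots> = (\<Sum>j\<le>CARD('n). sigma_mat j A * s ^ j)"
    unfolding sigma_mat_def sum_distrib_right by (intro sum.cong) auto
  finally show ?thesis .
qed

definition sigma_poly :: "real^'n^'n \<Rightarrow> real poly" where
  "sigma_poly A = (\<Sum>j\<le>CARD('n). monom (sigma_mat j A) j)"

lemma coeff_sigma_poly: "coeff (sigma_poly A) j = sigma_mat j A"
  for A :: "real^'n^'n"
proof -
  have "{I :: 'n set. card I = j} = {}" if "CARD('n) < j"
    using that card_mono[of "UNIV :: 'n set"] by (auto simp: not_less[symmetric])
  then show ?thesis by (auto simp: sigma_poly_def coeff_sum sigma_mat_def)
qed

lemma poly_sigma_poly: "poly (sigma_poly A) s = det (mat 1 + s *\<^sub>R A)"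
  by (simp add: sigma_poly_def det_one_plus poly_sum poly_monom)

text \<open>Polynomials in \<open>s\<close> that agree everywhere have the same coefficients. The
  eigenvalue formula, orthogonal invariance and the rank-one formulas are all read off from det (1 +
  s A) in this way.\<close>

lemma sigma_mat_eqI:
  assumes "\<And>s. det (mat 1 + s *\<^sub>R A) = poly p s"
  shows "sigma_mat j A = coeff p j"
proof -
  have "sigma_poly A = p"
    using assms by (simp add: fun_eq_iff poly_sigma_poly flip: poly_eq_poly_eq_iff)
  then show ?thesis using coeff_sigma_poly by metis
qed

lemma sigma_mat_eq_esym:
  assumes "is_eigenvalues A l"
  shows "sigma_mat j A = elem_sym j l"
proof -
  have "det (mat 1 + s *\<^sub>R A) = poly (\<Prod>i\<in>UNIV. [:1, l $ i:]) s" for s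
  proof (cases "s = 0")
    case False
    \<comment> \<open>The characteristic polynomial has to be evaluated at -1/s;
      \<open>rows_mix UNIV\<close> puts the scalar -s where \<open>det_rows_mix_scaleR\<close> can
      extract it.\<close>
    have "mat 1 + s *\<^sub>R A = rows_mix UNIV ((- s) *\<^sub>R (mat (- 1 / s) - A)) (mat 1)"
      using False by (auto simp: vec_eq_iff mat_def field_simps)
    then have "det (mat 1 + s *\<^sub>R A) = (- s) ^ CARD('a) * det (mat (- 1 / s) - A)"
      by (simp only: det_rows_mix_scaleR) simp
    also have "det (mat (- 1 / s) - A) = (\<Prod>i\<in>UNIV. - 1 / s - l $ i)"
      using assms by (simp add: is_eigenvalues_def)
    also have "(- s) ^ CARD('a) * (\<Prod>i\<in>UNIV. - 1 / s - l $ i) = (\<Prod>i\<in>UNIV. (- s) * (- 1 / s - l $ i))"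
      by (simp only: prod.distrib prod_constant)
    also have "\<dots> = (\<Prod>i\<in>UNIV. poly [:1, l $ i:] s)"
      using False by (intro prod.cong) (auto simp: field_simps)
    finally show ?thesis by (simp add: poly_prod)
  qed (simp add: poly_prod)
  then show ?thesis by (simp add: sigma_mat_eqI elem_sym_eq_esym esym_def)
qed

section \<open>Rank-one perturbations\<close>

definition outer :: "real^'n \<Rightarrow> real^'n^'n" where
  "outer v = (\<chi> i j. v $ i * v $ j)"

lemma outer_mult_vec: "outer v *v x = (v \<bullet> x) *\<^sub>R v"
  by (simp add: outer_def vec_eq_iff matrix_vector_mult_def inner_vec_def sum_distrib_right
    sum_distrib_left algebra_simps)

lemma transpose_outer [simp]: "transpose (outer v) = outer v"
  by (simp add: outer_def transpose_def vec_eq_iff)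

lemma continuous_on_outer [continuous_intros]:
  "continuous_on S f \<Longrightarrow> continuous_on S (\<lambda>x. outer (f x))"
  unfolding outer_def by (intro continuous_intros)

text \<open>All rows of \<open>outer v\<close> are multiples of \<open>v\<close>, so two of them are
  linearly dependent. Hence determinants are affine along rank-one lines.\<close>

lemma det_rows_mix_outer:
  assumes "2 \<le> card I"
  shows "det (rows_mix I (outer v) B) = 0"
proof -
  obtain a b where ab: "a \<in> I" "b \<in> I" "a \<noteq> b"
    using assms by (metis card_2_iff' card_le_Suc0_iff_eq finite not_less_eq_eq numeral_2_eq_2)
  have "rows_mix I (outer v) B = (\<chi> i. (if i \<in> I then v $ i else 1) *s (if i \<in> I then v else B $ i))"
    by (auto simp: rows_mix_def outer_def vec_eq_iff)
  then have "det (rows_mix I (outer v) B)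
      = (\<Prod>i\<in>UNIV. if i \<in> I then v $ i else 1) * det (\<chi> i. if i \<in> I then v else B $ i)"
    by (simp only: det_rows_mul)
  also have "det (\<chi> i. if i \<in> I then v else B $ i) = 0"
    using ab by (intro det_identical_rows[of a b]) (auto simp: row_def)
  finally show ?thesis by simp
qed

lemma det_add_outer:
  fixes B :: "real^'n^'n"
  shows "det (B + t *\<^sub>R outer v) = det B + t * (\<Sum>i\<in>UNIV. det (rows_mix {i} (outer v) B))"
proof -
  have sing: "{I :: 'n set. card I = 1} = (\<lambda>i. {i}) ` UNIV"
    by (auto simp: card_1_singleton_iff)
  have "det (t *\<^sub>R outer v + B) = (\<Sum>I\<in>UNIV. t ^ card I * det (rows_mix I (outer v) B))"
    by (simp add: det_add_rows_mix det_rows_mix_scaleR)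
  also have "\<dots> = (\<Sum>I\<in>insert {} {I. card I = 1}. t ^ card I * det (rows_mix I (outer v) B))"
  proof (rule sum.mono_neutral_right)
    show "\<forall>I\<in>UNIV - insert {} {I. card I = 1}. t ^ card I * det (rows_mix I (outer v) B) = 0"
    proof
      fix I :: "'n set" assume I: "I \<in> UNIV - insert {} {I. card I = 1}"
      then have "card I \<noteq> 0" "card I \<noteq> 1" by auto
      then have "2 \<le> card I" by linarith
      then show "t ^ card I * det (rows_mix I (outer v) B) = 0" by (simp add: det_rows_mix_outer)
    qed
  qed auto
  also have "\<dots> = det (rows_mix {} (outer v) B) + (\<Sum>I\<in>{I. card I = 1}. t * det (rows_mix I (outer v) B))"
    by (subst sum.insert) auto
  also have "rows_mix {} (outer v) B = B" by simp
  also have "(\<Sum>I\<in>{I. card I = 1}. t * det (rows_mix I (outer v) B))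
      = t * (\<Sum>i\<in>UNIV. det (rows_mix {i} (outer v) B))"
    unfolding sing sum_distrib_left by (subst sum.reindex) auto
  finally show ?thesis by (simp add: add.commute)
qed

text \<open>Affine dependence makes the increment at t = 1 determine that for every \<open>t\<close>
  of either sign; it takes the place of a derivative of sigma_k.\<close>

lemma sigma_mat_add_outer:
  "sigma_mat j (A + t *\<^sub>R outer v) = sigma_mat j A + t * (sigma_mat j (A + outer v) - sigma_mat j A)"
proof -
  have "det (mat 1 + s *\<^sub>R (A + t *\<^sub>R outer v))
     = poly (sigma_poly A + smult t (sigma_poly (A + outer v) - sigma_poly A)) s" for s
  proof -
    let ?X = "\<Sum>i\<in>UNIV. det (rows_mix {i} (outer v) (mat 1 + s *\<^sub>R A))"
    have "det (mat 1 + s *\<^sub>R (A + t *\<^sub>R outer v)) = det ((mat 1 + s *\<^sub>R A) + (s * t) *\<^sub>R outer v)" for t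
      by (simp add: scaleR_add_right add.assoc)
    then have *: "det (mat 1 + s *\<^sub>R (A + t *\<^sub>R outer v)) = det (mat 1 + s *\<^sub>R A) + s * t * ?X" for t
      by (simp only: det_add_outer)
    \<comment> \<open>The slope \<open>?X\<close> is eliminated by comparing the instances t and
      1.\<close>
    show ?thesis using *[of t] *[of 1] by (simp add: poly_sigma_poly)
  qed
  then have "sigma_mat j (A + t *\<^sub>R outer v)
      = coeff (sigma_poly A + smult t (sigma_poly (A + outer v) - sigma_poly A)) j"
    by (rule sigma_mat_eqI)
  then show ?thesis by (simp add: coeff_sigma_poly)
qed

definition diag_mat :: "('n \<Rightarrow> real) \<Rightarrow> real^'n^'n" where
  "diag_mat l = (\<chi> i j. if i = j then l i else 0)"

text \<open>The weight of v_i^2 is the derivative of the elementary symmetric function with respect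
  to l_i: off-diagonal entries of \<open>outer v\<close> do not contribute because the other rows
  are diagonal.\<close>

lemma sigma_mat_diag_add_outer:
  fixes v :: "real^'n"
  shows "sigma_mat (Suc j) (diag_mat l + outer v) = esym UNIV l (Suc j)
    + (\<Sum>i\<in>UNIV. (v $ i)\<^sup>2 * esym (UNIV - {i}) l j)"
proof -
  \<comment> \<open>\<open>pCons 0\<close> is the factor s of the first-order term, which shifts the
    coefficient index from j to \<open>Suc j\<close>.\<close>
  let ?p = "(\<Prod>i\<in>UNIV. [:1, l i:]) + pCons 0 (\<Sum>i\<in>UNIV. smult ((v $ i)\<^sup>2) (\<Prod>m\<in>UNIV - {i}. [:1, l m:]))"
  have "det (mat 1 + s *\<^sub>R (diag_mat l + outer v)) = poly ?p s" for s
  proof -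
    have D: "mat 1 + s *\<^sub>R diag_mat l = diag_mat (\<lambda>i. 1 + s * l i)"
      by (auto simp: diag_mat_def vec_eq_iff mat_def)
    have "det (diag_mat (\<lambda>i. 1 + s * l i)) = (\<Prod>i\<in>UNIV. 1 + s * l i)"
      by (subst det_diagonal) (auto simp: diag_mat_def)
    moreover have "det (rows_mix {i} (outer v) (diag_mat (\<lambda>i. 1 + s * l i)))
        = (v $ i)\<^sup>2 * (\<Prod>m\<in>UNIV - {i}. 1 + s * l m)" for i
    proof -
      let ?M = "rows_mix {i} (outer v) (diag_mat (\<lambda>i. 1 + s * l i))"
      have "det ?M = (\<Prod>j\<in>UNIV. ?M $ j $ j)"
        by (rule det_eq_prod_diag_one_row[of i]) (auto simp: rows_mix_def diag_mat_def)
      also have "\<dots> = ?M $ i $ i * (\<Prod>j\<in>UNIV - {i}. ?M $ j $ j)"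
        by (rule prod.remove) auto
      also have "(\<Prod>j\<in>UNIV - {i}. ?M $ j $ j) = (\<Prod>m\<in>UNIV - {i}. 1 + s * l m)"
        by (intro prod.cong) (auto simp: rows_mix_def diag_mat_def)
      finally show ?thesis by (simp add: rows_mix_def outer_def power2_eq_square)
    qed
    moreover have "mat 1 + s *\<^sub>R (diag_mat l + outer v) = diag_mat (\<lambda>i. 1 + s * l i) + s *\<^sub>R outer v"
      by (simp add: scaleR_add_right D[symmetric])
    ultimately show ?thesis
      by (simp add: det_add_outer poly_sum poly_prod)
  qed
  from sigma_mat_eqI[OF this, of "Suc j"] show ?thesis
    by (simp add: esym_def coeff_sum)
qed

lemma sigma_mat_orthogonal:
  fixes P A :: "real^'n^'n"
  assumes "orthogonal_matrix P"
  shows "sigma_mat j (P ** A ** transpose P) = sigma_mat j A"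
proof -
  have P: "P ** transpose P = mat 1" using assms by (simp add: orthogonal_matrix_def)
  have d: "det P * det P = 1"
    using arg_cong[OF P, of det] by (simp add: det_mul)
  have "det (mat 1 + s *\<^sub>R (P ** A ** transpose P)) = poly (sigma_poly A) s" for s
  proof -
    have "P *v (transpose P *v x) = x" for x
      by (simp add: matrix_vector_mul_assoc P del: transpose_matrix_vector)
    then have "mat 1 + s *\<^sub>R (P ** A ** transpose P) = P ** (mat 1 + s *\<^sub>R A) ** transpose P"
      by (simp add: matrix_eq algebra_simps scaleR_matrix_vector_assoc[symmetric]
          matrix_vector_mul_assoc[symmetric] del: transpose_matrix_vector)
    then show ?thesis using d
      by (simp add: det_mul poly_sigma_poly)
  qed
  then have "sigma_mat j (P ** A ** transpose P) = coeff (sigma_poly A) j" by (rule sigma_mat_eqI)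
  then show ?thesis by (simp add: coeff_sigma_poly)
qed

section \<open>Diagonalisation and ellipticity on the matrix cone\<close>

lemma symmetric_diagonalization:
  fixes A :: "real^'n^'n"
  assumes "transpose A = A"
  obtains P l where "orthogonal_matrix P" "A = P ** diag_mat l ** transpose P"
proof -
  obtain B where B: "finite B" "card B = CARD('n)" "pairwise orthogonal B"
    "\<forall>b\<in>B. norm b = 1 \<and> (\<exists>c. A *v b = c *\<^sub>R b)"
    using symmetric_eigenbasis_subspace[OF assms subspace_UNIV] by (auto simp: dim_UNIV)
  obtain e :: "'n \<Rightarrow> real^'n" where e: "bij_betw e UNIV B"
    using B(1,2) finite_same_card_bij[of "UNIV :: 'n set" B] by auto
  have eB: "e i \<in> B" for i using e by (auto simp: bij_betw_def)
  have "\<forall>i. \<exists>c. A *v e i = c *\<^sub>R e i" using B(4) eB by blast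
  then obtain l where l: "\<And>i. A *v e i = l i *\<^sub>R e i" unfolding choice_iff by blast
  define P :: "real^'n^'n" where "P = (\<chi> i j. e j $ i)"
  have col: "column j P = e j" for j by (simp add: P_def column_def vec_eq_iff)
  have P: "orthogonal_matrix P"
    unfolding orthogonal_matrix_orthonormal_columns col
    using B(3,4) eB bij_betw_imp_inj_on[OF e] by (metis injD pairwiseD)
  have "(A ** P) $ i $ j = (P ** diag_mat l) $ i $ j" for i j
  proof -
    have "(A ** P) $ i $ j = (A *v e j) $ i"
      by (simp add: matrix_matrix_mult_def matrix_vector_mult_def P_def)
    also have "\<dots> = (P ** diag_mat l) $ i $ j"
      by (simp add: matrix_matrix_mult_def P_def diag_mat_def l if_distrib cong: if_cong)
    finally show ?thesis .
  qed
  then have "A ** P = P ** diag_mat l" by (simp add: vec_eq_iff)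
  then have "A ** (P ** transpose P) = P ** diag_mat l ** transpose P"
    by (simp add: matrix_mul_assoc)
  then have "A = P ** diag_mat l ** transpose P"
    using P by (simp add: orthogonal_matrix_def)
  with P show ?thesis by (rule that)
qed

text \<open>The cone condition on the eigenvalues in the form of inequalities. Listing all degrees
  up to \<open>k\<close> is what permits the removal of a variable in
  \<open>esym_cone_remove\<close>.\<close>

definition mat_cone :: "nat \<Rightarrow> (real^'n^'n) set" where
  "mat_cone k = {A. transpose A = A \<and> (\<forall>j\<in>{1..k}. 0 < sigma_mat j A)}"

lemma transpose_add: "transpose (A + B) = transpose A + transpose (B :: real^'n^'m)"
  by (simp add: transpose_def vec_eq_iff)

lemma transpose_scaleR: "transpose (c *\<^sub>R A) = c *\<^sub>R transpose (A :: real^'n^'m)"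
  by (simp add: transpose_def vec_eq_iff)

lemma conj_outer: "P ** outer w ** transpose P = outer (P *v w)"
  for P :: "real^'n^'n"
proof -
  have "w \<bullet> (transpose P *v x) = (P *v w) \<bullet> x" for x
    by (metis dot_lmul_matrix inner_commute transpose_matrix_vector)
  then show ?thesis
    by (simp add: matrix_eq outer_mult_vec matrix_vector_mul_assoc[symmetric] matrix_vector_mult_scaleR
        del: transpose_matrix_vector)
qed

text \<open>In an eigenbasis of \<open>A\<close> the vector \<open>w\<close> becomes its rotated
  copy \<open>v\<close>, and the weights are the positive symmetric functions of the remaining
  eigenvalues. They do not depend on \<open>w\<close>; the existential form hides the
  diagonalisation from later arguments.\<close>

lemma mat_cone_outer_increment:
  fixes A :: "real^'n^'n"
  assumes A: "A \<in> mat_cone k"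
  shows "\<exists>c :: 'n \<Rightarrow> nat \<Rightarrow> real. (\<forall>i. \<forall>j<k. 0 < c i j) \<and> (\<forall>j<k. \<forall>w. \<exists>v :: real^'n. norm v = norm w \<and>
      sigma_mat (Suc j) (A + outer w) = sigma_mat (Suc j) A + (\<Sum>i\<in>UNIV. (v $ i)\<^sup>2 * c i j))"
proof -
  obtain P l where P: "orthogonal_matrix P" and Al: "A = P ** diag_mat l ** transpose P"
    using A symmetric_diagonalization[of A] unfolding mat_cone_def by blast
  have sA: "sigma_mat j A = esym UNIV l j" for j
  proof -
    have "is_eigenvalues (diag_mat l) (\<chi> i. l i)"
      unfolding is_eigenvalues_def
    proof
      fix t
      have "det (mat t - diag_mat l) = (\<Prod>i\<in>UNIV. (mat t - diag_mat l) $ i $ i)"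
        by (rule det_diagonal) (auto simp: mat_def diag_mat_def)
      then show "det (mat t - diag_mat l) = (\<Prod>i\<in>UNIV. t - (\<chi> i. l i) $ i)"
        by (simp add: mat_def diag_mat_def)
    qed
    then show ?thesis
      unfolding Al sigma_mat_orthogonal[OF P] by (simp add: sigma_mat_eq_esym elem_sym_eq_esym)
  qed
  show ?thesis
  proof (intro exI[of _ "\<lambda>i. esym (UNIV - {i}) l"] conjI allI impI)
    show "0 < esym (UNIV - {i}) l j" if "j < k" for i j
      using A that sA by (intro esym_cone_remove[where k = k]) (auto simp: mat_cone_def)
    show "\<exists>v :: real^'n. norm v = norm w \<and> sigma_mat (Suc j) (A + outer w)
        = sigma_mat (Suc j) A + (\<Sum>i\<in>UNIV. (v $ i)\<^sup>2 * esym (UNIV - {i}) l j)" for j w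
    proof (intro exI conjI)
      let ?v = "transpose P *v w"
      have PT: "P ** transpose P = mat 1" using P by (simp add: orthogonal_matrix_def)
      have "orthogonal_transformation ((*v) (transpose P))"
        using P by (simp add: orthogonal_matrix_transpose orthogonal_transformation_matrix)
      then show "norm ?v = norm w" by (rule orthogonal_transformation_norm)
      have "P *v ?v = w" using PT by (simp only: matrix_vector_mul_assoc) simp
      then have "A + outer w = P ** diag_mat l ** transpose P + P ** outer ?v ** transpose P"
        by (simp only: Al conj_outer)
      also have "\<dots> = P ** (diag_mat l + outer ?v) ** transpose P"
        by (simp add: matrix_eq algebra_simps matrix_vector_mul_assoc[symmetric] del: transpose_matrix_vector)
      finally show "sigma_mat (Suc j) (A + outer w)
        = sigma_mat (Suc j) A + (\<Sum>i\<in>UNIV. (?v $ i)\<^sup>2 * esym (UNIV - {i}) l j)"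
        by (simp add: sigma_mat_orthogonal[OF P] sigma_mat_diag_add_outer sA)
    qed
  qed
qed

lemma sigma_mat_outer_strict_mono:
  fixes A :: "real^'n^'n"
  assumes "A \<in> mat_cone k" and "w \<noteq> 0" and "1 \<le> k"
  shows "sigma_mat k A < sigma_mat k (A + outer w)"
proof -
  obtain c :: "'n \<Rightarrow> nat \<Rightarrow> real" where c: "\<forall>i. \<forall>j<k. 0 < c i j"
    "\<forall>j<k. \<forall>w. \<exists>v :: real^'n. norm v = norm w \<and>
      sigma_mat (Suc j) (A + outer w) = sigma_mat (Suc j) A + (\<Sum>i\<in>UNIV. (v $ i)\<^sup>2 * c i j)"
    using mat_cone_outer_increment[OF assms(1)] by blast
  have k: "k - 1 < k" "Suc (k - 1) = k" using assms(3) by auto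
  obtain v where v: "norm v = norm w"
    "sigma_mat k (A + outer w) = sigma_mat k A + (\<Sum>i\<in>UNIV. (v $ i)\<^sup>2 * c i (k - 1))"
    using c(2)[rule_format, OF k(1), of w] unfolding k(2) by blast
  have "v \<noteq> 0" using v(1) assms(2) by auto
  then obtain i where "v $ i \<noteq> 0" by (auto simp: vec_eq_iff)
  then have "0 < (\<Sum>i\<in>UNIV. (v $ i)\<^sup>2 * c i (k - 1))"
    using c(1)[rule_format, OF k(1)] by (intro sum_pos2[where i = i]) (auto simp: less_imp_le)
  then show ?thesis using v(2) by simp
qed

lemma mat_cone_add_outer:
  fixes A :: "real^'n^'n"
  assumes A: "A \<in> mat_cone k" and t: "0 \<le> t"
  shows "A + t *\<^sub>R outer w \<in> mat_cone k \<and> (\<forall>j\<in>{1..k}. sigma_mat j A \<le> sigma_mat j (A + t *\<^sub>R outer w))"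
proof -
  obtain c :: "'n \<Rightarrow> nat \<Rightarrow> real" where c: "\<forall>i. \<forall>j<k. 0 < c i j"
    "\<forall>j<k. \<forall>w. \<exists>v :: real^'n. norm v = norm w \<and>
      sigma_mat (Suc j) (A + outer w) = sigma_mat (Suc j) A + (\<Sum>i\<in>UNIV. (v $ i)\<^sup>2 * c i j)"
    using mat_cone_outer_increment[OF assms(1)] by blast
  have mono: "sigma_mat j A \<le> sigma_mat j (A + t *\<^sub>R outer w)" if "j \<in> {1..k}" for j
  proof -
    have j: "j - 1 < k" "Suc (j - 1) = j" using that by auto
    obtain v where "sigma_mat j (A + outer w) = sigma_mat j A + (\<Sum>i\<in>UNIV. (v $ i)\<^sup>2 * c i (j - 1))"
      using c(2)[rule_format, OF j(1), of w] unfolding j(2) by blast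
    moreover have "0 \<le> (\<Sum>i\<in>UNIV. (v $ i)\<^sup>2 * c i (j - 1))"
      using c(1)[rule_format, OF j(1)] by (intro sum_nonneg mult_nonneg_nonneg) (auto simp: less_imp_le)
    ultimately show ?thesis using t by (simp add: sigma_mat_add_outer[of j A t])
  qed
  with A show ?thesis
    by (force simp: mat_cone_def transpose_add transpose_scaleR)
qed

lemma psd_decomposition:
  fixes N :: "real^'n^'n"
  assumes "transpose N = N" and psd: "\<And>x. 0 \<le> x \<bullet> (N *v x)"
  obtains d :: "'n \<Rightarrow> real" and q where "\<And>i. 0 \<le> d i" "N = (\<Sum>i\<in>UNIV. d i *\<^sub>R outer (q i))"
proof -
  obtain P d where P: "orthogonal_matrix P" and N: "N = P ** diag_mat d ** transpose P"
    using symmetric_diagonalization[OF assms(1)] by blast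
  define q where "q i = P *v axis i 1" for i
  have qa: "q i $ a = P $ a $ i" for i a by (simp add: q_def matrix_vector_mult_basis column_def)
  show ?thesis
  proof (rule that[of d q])
    show "0 \<le> d i" for i
    proof -
      have TP: "transpose P ** P = mat 1" using P by (simp add: orthogonal_matrix_def)
      have "N *v q i = P *v (diag_mat d *v ((transpose P ** P) *v axis i 1))"
        by (simp only: N q_def matrix_vector_mul_assoc matrix_mul_assoc)
      also have "\<dots> = P *v (diag_mat d *v axis i 1)" by (simp add: TP)
      also have "diag_mat d *v axis i 1 = d i *\<^sub>R axis i 1"
        by (simp add: matrix_vector_mult_basis) (simp add: column_def diag_mat_def axis_def vec_eq_iff)
      finally have "N *v q i = d i *\<^sub>R q i" by (simp add: q_def matrix_vector_mult_scaleR)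
      moreover have "norm (q i) = 1"
        using P unfolding q_def matrix_vector_mult_basis orthogonal_matrix_orthonormal_columns by simp
      ultimately have "q i \<bullet> (N *v q i) = d i" by (simp add: norm_eq_1)
      then show ?thesis using psd[of "q i"] by simp
    qed
    have "N $ a $ b = (\<Sum>i\<in>UNIV. d i *\<^sub>R outer (q i)) $ a $ b" for a b
      by (simp add: N outer_def qa matrix_matrix_mult_def diag_mat_def transpose_def if_distrib
          algebra_simps cong: if_cong)
    then show "N = (\<Sum>i\<in>UNIV. d i *\<^sub>R outer (q i))" by (simp add: vec_eq_iff)
  qed
qed

text \<open>The matrix \<open>N\<close> is added one eigendirection at a time. Each rank-one step
  keeps the matrix in the cone, which licenses the next step.\<close>

lemma mat_cone_add_psd:
  fixes A N :: "real^'n^'n"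
  assumes A: "A \<in> mat_cone k" and N: "transpose N = N" "\<And>x. 0 \<le> x \<bullet> (N *v x)"
  shows "A + N \<in> mat_cone k" and "1 \<le> k \<Longrightarrow> sigma_mat k A \<le> sigma_mat k (A + N)"
proof -
  obtain d :: "'n \<Rightarrow> real" and q where d: "\<And>i. 0 \<le> d i" and Ns: "N = (\<Sum>i\<in>UNIV. d i *\<^sub>R outer (q i))"
    using psd_decomposition[OF N] by blast
  have "A + (\<Sum>i\<in>J. d i *\<^sub>R outer (q i)) \<in> mat_cone k \<and>
      (\<forall>j\<in>{1..k}. sigma_mat j A \<le> sigma_mat j (A + (\<Sum>i\<in>J. d i *\<^sub>R outer (q i))))"
    if "finite J" for J
    using that
  proof (induction rule: finite_induct)
    case (insert i J)
    let ?B = "A + (\<Sum>i\<in>J. d i *\<^sub>R outer (q i))"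
    have e: "A + (\<Sum>i\<in>insert i J. d i *\<^sub>R outer (q i)) = ?B + d i *\<^sub>R outer (q i)"
      using insert by (simp add: add_ac)
    moreover have "?B + d i *\<^sub>R outer (q i) \<in> mat_cone k"
        "\<forall>j\<in>{1..k}. sigma_mat j ?B \<le> sigma_mat j (?B + d i *\<^sub>R outer (q i))"
      using mat_cone_add_outer[of ?B k "d i" "q i"] insert.IH d by blast+
    ultimately show ?case unfolding e using insert.IH by (blast intro: order_trans)
  qed (use A in simp)
  from this[of UNIV] show "A + N \<in> mat_cone k" "1 \<le> k \<Longrightarrow> sigma_mat k A \<le> sigma_mat k (A + N)"
    by (auto simp: Ns)
qed

text \<open>The determinant of each minor expands into powers a^|J|, and for 0 <= a <= 1 every
  nonempty \<open>J\<close> contributes at most \<open>a\<close> times an absolute value. Continuity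
  of \<open>g\<close> in the base matrix makes the bound uniform on compact sets.\<close>

lemma sigma_mat_add_scaleR_bound:
  obtains g :: "real^'n^'n \<Rightarrow> real^'n^'n \<Rightarrow> real" where
    "\<And>B E a. 0 \<le> a \<Longrightarrow> a \<le> 1 \<Longrightarrow> sigma_mat k (B + a *\<^sub>R E) \<le> sigma_mat k B + a * g B E"
    "\<And>E. continuous_on UNIV (\<lambda>B. g B E)" "\<And>B E. 0 \<le> g B E"
proof
  \<comment> \<open>\<open>h I J B E\<close> is the coefficient of a^|J| in the minor
    \<open>I\<close>: rows in \<open>J\<close> come from \<open>E\<close>, cut off outside
    \<open>I\<close>, the others from \<open>B\<close> and the identity.\<close>
  define h where "h I J B E = det (rows_mix J (rows_mix I E 0) (rows_mix I B (mat 1)))"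
    for I J :: "'n set" and B E :: "real^'n^'n"
  define g where "g B E = (\<Sum>I\<in>{I. card I = k}. \<Sum>J\<in>UNIV - {{}}. \<bar>h I J B E\<bar>)"
    for B E :: "real^'n^'n"
  show "continuous_on UNIV (\<lambda>B. g B E)" for E
    unfolding g_def h_def by (intro continuous_intros)
  show "0 \<le> g B E" for B E unfolding g_def by (intro sum_nonneg) auto
  show "sigma_mat k (B + a *\<^sub>R E) \<le> sigma_mat k B + a * g B E" if a: "0 \<le> a" "a \<le> 1" for B E a
  proof -
    have "det (rows_mix I (B + a *\<^sub>R E) (mat 1)) \<le> det (rows_mix I B (mat 1)) + a * (\<Sum>J\<in>UNIV - {{}}. \<bar>h I J B E\<bar>)"
      for I
    proof -
      have "rows_mix I (B + a *\<^sub>R E) (mat 1) = a *\<^sub>R rows_mix I E 0 + rows_mix I B (mat 1)"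
        by (auto simp: rows_mix_def vec_eq_iff)
      then have "det (rows_mix I (B + a *\<^sub>R E) (mat 1)) = (\<Sum>J\<in>UNIV. a ^ card J * h I J B E)"
        by (simp add: det_add_rows_mix det_rows_mix_scaleR h_def)
      also have "\<dots> = a ^ card ({} :: 'n set) * h I {} B E + (\<Sum>J\<in>UNIV - {{}}. a ^ card J * h I J B E)"
        by (rule sum.remove) auto
      also have "(\<Sum>J\<in>UNIV - {{}}. a ^ card J * h I J B E) \<le> (\<Sum>J\<in>UNIV - {{}}. a * \<bar>h I J B E\<bar>)"
      proof (rule sum_mono)
        fix J :: "'n set" assume "J \<in> UNIV - {{}}"
        then have "0 < card J" by (simp add: card_gt_0_iff)
        then have "a ^ card J \<le> a" using a by (metis One_nat_def Suc_leI power_decreasing power_one_right)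
        then have "a ^ card J * \<bar>h I J B E\<bar> \<le> a * \<bar>h I J B E\<bar>" by (intro mult_right_mono) auto
        moreover have "a ^ card J * h I J B E \<le> a ^ card J * \<bar>h I J B E\<bar>"
          using a by (intro mult_left_mono) auto
        ultimately show "a ^ card J * h I J B E \<le> a * \<bar>h I J B E\<bar>" by linarith
      qed
      finally show ?thesis by (simp add: h_def sum_distrib_left)
    qed
    then have "sigma_mat k (B + a *\<^sub>R E) \<le> (\<Sum>I\<in>{I. card I = k}. det (rows_mix I B (mat 1)) + a * (\<Sum>J\<in>UNIV - {{}}. \<bar>h I J B E\<bar>))"
      unfolding sigma_mat_def by (intro sum_mono)
    then show ?thesis by (simp add: sigma_mat_def g_def sum.distrib sum_distrib_left)
  qed
qed

text \<open>Uniform ellipticity on compact sets, in the one-sided form in which the barrier argument of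
  the Hopf lemma uses it.\<close>
lemma sigma_mat_compact_ellipticity:
  fixes K :: "(real^'n^'n) set"
  assumes K: "compact K" "K \<subseteq> mat_cone k" and k: "1 \<le> k"
  obtains l C where "0 < l" "0 \<le> C"
    "\<And>A (v :: real^'n) a b. A \<in> K \<Longrightarrow> norm v = 1 \<Longrightarrow> 0 \<le> a \<Longrightarrow> a \<le> 1 \<Longrightarrow> 0 \<le> b \<Longrightarrow> b \<le> 1 \<Longrightarrow>
      sigma_mat k (A - b *\<^sub>R outer v + a *\<^sub>R mat 1) \<le> sigma_mat k A - b * l + a * C"
proof (cases "K = {}")
  case True
  show ?thesis by (rule that[of 1 0]) (auto simp: True)
next
  case False
  obtain g :: "real^'n^'n \<Rightarrow> real^'n^'n \<Rightarrow> real" where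
    g: "\<And>B E a. 0 \<le> a \<Longrightarrow> a \<le> 1 \<Longrightarrow> sigma_mat k (B + a *\<^sub>R E) \<le> sigma_mat k B + a * g B E"
    "\<And>E. continuous_on UNIV (\<lambda>B. g B E)" "\<And>B E. 0 \<le> g B E"
    using sigma_mat_add_scaleR_bound by blast
  let ?S = "sphere (0 :: real^'n) 1"
  \<comment> \<open>The minimum of this increment over matrices in \<open>K\<close> and unit vectors
    is the ellipticity constant.\<close>
  define f where "f = (\<lambda>(A :: real^'n^'n, v). sigma_mat k (A + outer v) - sigma_mat k A)"
  have "compact (K \<times> ?S)" using K(1) by (intro compact_Times) auto
  moreover have "K \<times> ?S \<noteq> {}" using False by simp
  moreover have "continuous_on (K \<times> ?S) f"
    unfolding f_def case_prod_beta by (intro continuous_intros)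
  ultimately obtain x where x: "x \<in> K \<times> ?S" "\<And>y. y \<in> K \<times> ?S \<Longrightarrow> f x \<le> f y"
    using continuous_attains_inf[of "K \<times> ?S" f] by blast
  have l: "0 < f x"
  proof -
    obtain A v where Av: "x = (A, v)" "A \<in> mat_cone k" "norm v = 1"
      using x(1) K(2) by (cases x) auto
    then have "v \<noteq> 0" by auto
    from sigma_mat_outer_strict_mono[OF Av(2) this k] show ?thesis by (simp add: f_def Av)
  qed
  define H where "H = (\<lambda>(A :: real^'n^'n, v, b). g (A - b *\<^sub>R outer v) (mat 1))"
  have "compact (K \<times> ?S \<times> {0..1::real})" using K(1) by (intro compact_Times) auto
  moreover have "K \<times> ?S \<times> {0..1::real} \<noteq> {}" using False by simp
  moreover have "continuous_on (K \<times> ?S \<times> {0..1}) H"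
    unfolding H_def case_prod_beta
    by (intro continuous_on_compose2[OF g(2)[of "mat 1"]] continuous_intros) auto
  ultimately obtain y where y: "\<And>z. z \<in> K \<times> ?S \<times> {0..1} \<Longrightarrow> H z \<le> H y"
    using continuous_attains_sup[of "K \<times> ?S \<times> {0..1}" H] by blast
  show ?thesis
  proof (rule that[OF l])
    show "0 \<le> H y" using g(3) by (simp add: H_def case_prod_beta)
    fix A and v :: "real^'n" and a b assume a: "A \<in> K" "norm v = 1" "0 \<le> a" "a \<le> (1::real)" "0 \<le> b" "b \<le> (1::real)"
    have "sigma_mat k (A - b *\<^sub>R outer v + a *\<^sub>R mat 1) \<le> sigma_mat k (A - b *\<^sub>R outer v) + a * g (A - b *\<^sub>R outer v) (mat 1)"
      using a by (intro g(1))
    also have "g (A - b *\<^sub>R outer v) (mat 1) \<le> H y"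
      using y[of "(A, v, b)"] a by (simp add: H_def)
    \<comment> \<open>The affine formula is used with t = -b, where the matrix itself may have left
      the cone.\<close>
    also have "sigma_mat k (A - b *\<^sub>R outer v) = sigma_mat k A - b * f (A, v)"
      using sigma_mat_add_outer[of k A "- b" v] by (simp add: f_def)
    also have "\<dots> \<le> sigma_mat k A - b * f x"
      using x(2)[of "(A, v)"] a by (simp add: mult_left_mono)
    finally show "sigma_mat k (A - b *\<^sub>R outer v + a *\<^sub>R mat 1) \<le> sigma_mat k A - b * f x + a * H y"
      using a by (simp add: mult_left_mono)
  qed
qed

lemma sigma_mat_1: "sigma_mat 1 A = trace A"
  for A :: "real^'n^'n"
proof -
  have sing: "{I :: 'n set. card I = 1} = (\<lambda>i. {i}) ` UNIV"
    by (auto simp: card_1_singleton_iff)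
  have "det (rows_mix {i} A (mat 1)) = A $ i $ i" for i
  proof -
    let ?M = "rows_mix {i} A (mat 1)"
    have "det ?M = (\<Prod>j\<in>UNIV. ?M $ j $ j)"
      by (rule det_eq_prod_diag_one_row[of i]) (auto simp: rows_mix_def mat_def)
    also have "\<dots> = ?M $ i $ i * (\<Prod>j\<in>UNIV - {i}. ?M $ j $ j)"
      by (rule prod.remove) auto
    also have "(\<Prod>j\<in>UNIV - {i}. ?M $ j $ j) = 1"
      by (intro prod.neutral) (auto simp: rows_mix_def mat_def)
    finally show ?thesis by (simp add: rows_mix_def)
  qed
  then show ?thesis
    unfolding sigma_mat_def sing by (subst sum.reindex) (auto simp: trace_def)
qed

lemma sigma_mat_scaleR_one: "sigma_mat k (c *\<^sub>R mat 1 :: real^'n^'n) = real (CARD('n) choose k) * c ^ k"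
proof -
  have "sigma_mat k (c *\<^sub>R mat 1 :: real^'n^'n) = (\<Sum>I\<in>{I :: 'n set. card I = k}. c ^ k)"
    unfolding sigma_mat_def
  proof (rule sum.cong)
    fix I :: "'n set" assume "I \<in> {I. card I = k}"
    moreover have "rows_mix I (mat 1) (mat 1) = (mat 1 :: real^'n^'n)"
      by (simp add: rows_mix_def vec_eq_iff)
    ultimately show "det (rows_mix I (c *\<^sub>R mat 1) (mat 1)) = c ^ k"
      by (simp add: det_rows_mix_scaleR)
  qed simp
  also have "\<dots> = real (card {I. I \<subseteq> (UNIV :: 'n set) \<and> card I = k}) * c ^ k" by simp
  also have "card {I. I \<subseteq> (UNIV :: 'n set) \<and> card I = k} = CARD('n) choose k"
    by (rule n_subsets) simp
  finally show ?thesis .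
qed

lemma mat_cone_of_garding:
  fixes A :: "real^'n^'n"
  assumes "transpose A = A" and "k \<le> CARD('n)" and "eigenvalues A \<in> garding_cone k"
  shows "A \<in> mat_cone k" and "sigma_mat k A = elem_sym k (eigenvalues A)"
  using sigma_mat_eq_esym[OF is_eigenvalues_eigenvalues[OF assms(1)]]
    garding_cone_imp_elem_sym_pos[OF assms(2,3)] assms(1)
  by (auto simp: mat_cone_def)

section \<open>Second-order jets\<close>

text \<open>Gradient and Hessian are carried as explicit functions, so that those of Kelvin
  transforms and barriers can be given by formulas. \<open>jet_onI\<close> derives the symmetry
  clause from the others.\<close>

definition jet_on :: "(real^'n) set \<Rightarrow> (real^'n \<Rightarrow> real) \<Rightarrow> (real^'n \<Rightarrow> real^'n) \<Rightarrow> (real^'n \<Rightarrow> real^'n^'n) \<Rightarrow> bool" where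
  "jet_on S f p X \<longleftrightarrow> open S \<and> (\<forall>y\<in>S. (f has_derivative (\<lambda>h. p y \<bullet> h)) (at y)) \<and>
     (\<forall>y\<in>S. (p has_derivative (\<lambda>h. X y *v h)) (at y)) \<and> continuous_on S X \<and>
     (\<forall>y\<in>S. transpose (X y) = X y)"

lemma jet_onD:
  assumes "jet_on S f p X"
  shows "open S" "y \<in> S \<Longrightarrow> (f has_derivative (\<lambda>h. p y \<bullet> h)) (at y)"
    "y \<in> S \<Longrightarrow> (p has_derivative (\<lambda>h. X y *v h)) (at y)"
    "continuous_on S X" "y \<in> S \<Longrightarrow> transpose (X y) = X y"
    "continuous_on S f" "continuous_on S p"
  using assms unfolding jet_on_def
  by (auto simp: continuous_on_eq_continuous_at intro!: has_derivative_continuous)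

lemma continuous_on_matrix_vector_mult_left [continuous_intros]:
  fixes A :: "'b::topological_space \<Rightarrow> real^'n^'m"
  assumes "continuous_on S A" "continuous_on S v"
  shows "continuous_on S (\<lambda>x. A x *v v x)"
  unfolding matrix_vector_mult_def by (intro continuous_intros assms)

section \<open>Restriction to lines and symmetry of the Hessian\<close>

lemma has_derivative_line:
  assumes "(f has_derivative f') (at (x + t *\<^sub>R v))"
  shows "((\<lambda>t. f (x + t *\<^sub>R v)) has_derivative (\<lambda>h. f' (h *\<^sub>R v))) (at t)"
proof -
  have "((\<lambda>t. x + t *\<^sub>R v) has_derivative (\<lambda>h. h *\<^sub>R v)) (at t)"
    by (auto intro!: derivative_eq_intros)
  from has_derivative_compose[OF this assms] show ?thesis .
qed

lemma DERIV_line: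
  assumes "(f has_derivative (\<lambda>h. p \<bullet> h)) (at (x + t *\<^sub>R v))"
  shows "((\<lambda>t. f (x + t *\<^sub>R v)) has_real_derivative p \<bullet> v) (at t)"
  using has_derivative_line[OF assms] by (simp add: has_field_derivative_def mult_commute_abs)

lemma DERIV_line_inner:
  fixes p :: "real^'n \<Rightarrow> real^'n"
  assumes "(p has_derivative (\<lambda>h. X *v h)) (at (x + t *\<^sub>R v))"
  shows "((\<lambda>t. p (x + t *\<^sub>R v) \<bullet> a) has_real_derivative (X *v v) \<bullet> a) (at t)"
  using has_derivative_inner_left[OF has_derivative_line[OF assms], of a]
  by (simp add: has_field_derivative_def matrix_vector_mult_scaleR mult_commute_abs)

text \<open>The mean value theorem is applied to the second difference, first along \<open>a\<close>
  and then along \<open>b\<close>. The left side is symmetric in \<open>a\<close> and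
  \<open>b\<close>; exchanging them on the right and letting t tend to 0 yields the symmetry of the
  Hessian.\<close>

lemma symmetric_hessian_aux:
  fixes f :: "real^'n \<Rightarrow> real"
  assumes f: "\<And>y. y \<in> ball x r \<Longrightarrow> (f has_derivative (\<lambda>h. p y \<bullet> h)) (at y)"
    and p: "\<And>y. y \<in> ball x r \<Longrightarrow> (p has_derivative (\<lambda>h. X y *v h)) (at y)"
    and t: "0 < t" "t * (norm a + norm b) < r"
  obtains y where "dist x y \<le> t * (norm a + norm b)"
    "f (x + t *\<^sub>R a + t *\<^sub>R b) - f (x + t *\<^sub>R a) - f (x + t *\<^sub>R b) + f x = t\<^sup>2 * ((X y *v b) \<bullet> a)"
proof -
  have in_ball: "dist x (x + s *\<^sub>R a + s' *\<^sub>R b) \<le> t * (norm a + norm b)"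
    if "0 \<le> s" "s \<le> t" "0 \<le> s'" "s' \<le> t" for s s'
  proof -
    have "x - (x + s *\<^sub>R a + s' *\<^sub>R b) = - (s *\<^sub>R a + s' *\<^sub>R b)" by simp
    then have "dist x (x + s *\<^sub>R a + s' *\<^sub>R b) = norm (s *\<^sub>R a + s' *\<^sub>R b)"
      by (metis dist_norm norm_minus_cancel)
    also have "\<dots> \<le> s * norm a + s' * norm b"
      using that norm_triangle_ineq[of "s *\<^sub>R a" "s' *\<^sub>R b"] by simp
    also have "\<dots> \<le> t * norm a + t * norm b"
      using that by (intro add_mono mult_right_mono) auto
    finally show ?thesis by (simp add: algebra_simps)
  qed
  define g where "g s = f (x + s *\<^sub>R a + t *\<^sub>R b) - f (x + s *\<^sub>R a)" for s
  have "\<exists>z>0. z < t \<and> g t - g 0 = (t - 0) * (p (x + z *\<^sub>R a + t *\<^sub>R b) \<bullet> a - p (x + z *\<^sub>R a) \<bullet> a)"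
  proof (rule MVT2[OF t(1)])
    fix s assume s: "0 \<le> s" "s \<le> t"
    have "x + t *\<^sub>R b + s *\<^sub>R a \<in> ball x r" "x + s *\<^sub>R a \<in> ball x r"
      using in_ball[of s t] in_ball[of s 0] s t by (auto simp: add_ac)
    then have "((\<lambda>s. f ((x + t *\<^sub>R b) + s *\<^sub>R a)) has_real_derivative p ((x + t *\<^sub>R b) + s *\<^sub>R a) \<bullet> a) (at s)"
      "((\<lambda>s. f (x + s *\<^sub>R a)) has_real_derivative p (x + s *\<^sub>R a) \<bullet> a) (at s)"
      using f by (auto intro: DERIV_line)
    from DERIV_diff[OF this] show "(g has_real_derivative (p (x + s *\<^sub>R a + t *\<^sub>R b) \<bullet> a - p (x + s *\<^sub>R a) \<bullet> a)) (at s)"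
      unfolding g_def by (simp add: add_ac)
  qed
  then obtain s where s: "0 < s" "s < t" "g t - g 0 = t * (p (x + s *\<^sub>R a + t *\<^sub>R b) \<bullet> a - p (x + s *\<^sub>R a) \<bullet> a)"
    by auto
  have "\<exists>z>0. z < t \<and> p (x + s *\<^sub>R a + t *\<^sub>R b) \<bullet> a - p (x + s *\<^sub>R a + 0 *\<^sub>R b) \<bullet> a
      = (t - 0) * ((X (x + s *\<^sub>R a + z *\<^sub>R b) *v b) \<bullet> a)"
  proof (rule MVT2[OF t(1)])
    fix s' assume s': "0 \<le> s'" "s' \<le> t"
    have "x + s *\<^sub>R a + s' *\<^sub>R b \<in> ball x r"
      using in_ball[of s s'] s s' t by auto
    then show "((\<lambda>s'. p (x + s *\<^sub>R a + s' *\<^sub>R b) \<bullet> a) has_real_derivative (X (x + s *\<^sub>R a + s' *\<^sub>R b) *v b) \<bullet> a) (at s')"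
      using p by (intro DERIV_line_inner) auto
  qed
  then obtain s' where s': "0 < s'" "s' < t"
    "p (x + s *\<^sub>R a + t *\<^sub>R b) \<bullet> a - p (x + s *\<^sub>R a) \<bullet> a = t * ((X (x + s *\<^sub>R a + s' *\<^sub>R b) *v b) \<bullet> a)"
    by auto
  show ?thesis
  proof (rule that)
    show "dist x (x + s *\<^sub>R a + s' *\<^sub>R b) \<le> t * (norm a + norm b)"
      using s s' by (intro in_ball) auto
    show "f (x + t *\<^sub>R a + t *\<^sub>R b) - f (x + t *\<^sub>R a) - f (x + t *\<^sub>R b) + f x
        = t\<^sup>2 * ((X (x + s *\<^sub>R a + s' *\<^sub>R b) *v b) \<bullet> a)"
      using s(3) s'(3) by (simp add: g_def power2_eq_square)
  qed
qed

lemma symmetric_hessian: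
  fixes f :: "real^'n \<Rightarrow> real"
  assumes S: "open S" "x \<in> S"
    and f: "\<And>y. y \<in> S \<Longrightarrow> (f has_derivative (\<lambda>h. p y \<bullet> h)) (at y)"
    and p: "\<And>y. y \<in> S \<Longrightarrow> (p has_derivative (\<lambda>h. X y *v h)) (at y)"
    and X: "continuous_on S X"
  shows "transpose (X x) = X x"
proof -
  have "(X x *v b) \<bullet> a = (X x *v a) \<bullet> b" for a b
  proof -
    have "\<bar>(X x *v b) \<bullet> a - (X x *v a) \<bullet> b\<bar> \<le> 2 * e" if e: "0 < e" for e
    proof -
      define G where "G a b y = (X y *v b) \<bullet> a" for a b y
      have "continuous_on S (G a b)" for a b
        unfolding G_def using X by (intro continuous_intros)
      then have G: "continuous (at x) (G a b)" for a b
        using S by (simp add: continuous_on_eq_continuous_at)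
      obtain d1 where d1: "0 < d1" "\<And>y. dist y x < d1 \<Longrightarrow> dist (G a b y) (G a b x) < e"
        using G[of a b] e unfolding continuous_at_eps_delta by blast
      obtain d2 where d2: "0 < d2" "\<And>y. dist y x < d2 \<Longrightarrow> dist (G b a y) (G b a x) < e"
        using G[of b a] e unfolding continuous_at_eps_delta by blast
      obtain r where r: "0 < r" "ball x r \<subseteq> S" using S open_contains_ball by blast
      define m where "m = min r (min d1 d2)"
      define t where "t = m / (norm a + norm b + 1)"
      have m: "0 < m" using r d1 d2 by (simp add: m_def)
      then have t: "0 < t" unfolding t_def by (intro divide_pos_pos) (auto intro: add_nonneg_pos)
      have tm: "t * (norm a + norm b) < m"
      proof -
        have "t * (norm a + norm b) < t * (norm a + norm b + 1)" using t by simp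
        also have "\<dots> = m" unfolding t_def
          using add_nonneg_pos[of "norm a + norm b" 1] by simp
        finally show ?thesis .
      qed
      have "t * (norm a + norm b) < r" "t * (norm b + norm a) < r" using tm by (auto simp: m_def add.commute)
      obtain y where y: "dist x y \<le> t * (norm a + norm b)"
        "f (x + t *\<^sub>R a + t *\<^sub>R b) - f (x + t *\<^sub>R a) - f (x + t *\<^sub>R b) + f x = t\<^sup>2 * ((X y *v b) \<bullet> a)"
        using symmetric_hessian_aux[of x r f p X t a b] f p r t \<open>t * (norm a + norm b) < r\<close> by blast
      obtain y' where y': "dist x y' \<le> t * (norm b + norm a)"
        "f (x + t *\<^sub>R b + t *\<^sub>R a) - f (x + t *\<^sub>R b) - f (x + t *\<^sub>R a) + f x = t\<^sup>2 * ((X y' *v a) \<bullet> b)"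
        using symmetric_hessian_aux[of x r f p X t b a] f p r t \<open>t * (norm b + norm a) < r\<close> by blast
      have "f (x + t *\<^sub>R b + t *\<^sub>R a) = f (x + t *\<^sub>R a + t *\<^sub>R b)" by (simp add: add_ac)
      then have "t\<^sup>2 * ((X y *v b) \<bullet> a) = t\<^sup>2 * ((X y' *v a) \<bullet> b)"
        using y(2) y'(2) by linarith
      then have "(X y *v b) \<bullet> a = (X y' *v a) \<bullet> b" using t by simp
      moreover have "dist (G a b y) (G a b x) < e" using y(1) tm by (intro d1) (auto simp: m_def dist_commute)
      moreover have "dist (G b a y') (G b a x) < e"
        using y'(1) tm by (intro d2) (auto simp: m_def dist_commute add.commute)
      ultimately show ?thesis by (simp add: G_def dist_real_def)
    qed
    note small = this
    have "\<bar>(X x *v b) \<bullet> a - (X x *v a) \<bullet> b\<bar> \<le> 0"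
    proof (rule field_le_epsilon)
      fix e :: real assume "0 < e"
      then show "\<bar>(X x *v b) \<bullet> a - (X x *v a) \<bullet> b\<bar> \<le> 0 + e" using small[of "e / 2"] by simp
    qed
    then show ?thesis by simp
  qed
  note this[of "axis _ 1" "axis _ 1"]
  then have "X x $ i $ j = X x $ j $ i" for i j
    by (simp add: matrix_vector_mult_basis column_def inner_axis)
  then show ?thesis by (simp add: transpose_def vec_eq_iff)
qed

lemma jet_onI:
  assumes "open S" "\<And>y. y \<in> S \<Longrightarrow> (f has_derivative (\<lambda>h. p y \<bullet> h)) (at y)"
    "\<And>y. y \<in> S \<Longrightarrow> (p has_derivative (\<lambda>h. X y *v h)) (at y)" "continuous_on S X"
  shows "jet_on S f p X"
  using assms symmetric_hessian[OF assms(1) _ assms(2-4)] by (auto simp: jet_on_def)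

lemma jet_on_C2:
  assumes "C2_on S u"
  shows "jet_on S u (grad u) (hess u)"
proof (rule jet_onI)
  show "open S" "continuous_on S (hess u)" using assms by (auto simp: C2_on_def)
  fix y assume y: "y \<in> S"
  have d: "(u has_derivative frechet_derivative u (at y)) (at y)"
    using assms y by (simp add: C2_on_def frechet_derivative_works)
  then have lin: "linear (frechet_derivative u (at y))" by (rule has_derivative_linear)
  have "frechet_derivative u (at y) h = grad u y \<bullet> h" for h
  proof -
    have "frechet_derivative u (at y) h = frechet_derivative u (at y) (\<Sum>i\<in>UNIV. (h $ i) *\<^sub>R axis i 1)"
      using basis_expansion[of h] by (simp add: scalar_mult_eq_scaleR)
    also have "\<dots> = grad u y \<bullet> h"
      by (simp add: linear_sum[OF lin] linear_cmul[OF lin] grad_def inner_vec_def mult.commute)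
    finally show ?thesis .
  qed
  then show "(u has_derivative (\<lambda>h. grad u y \<bullet> h)) (at y)" using d by presburger
  show "(grad u has_derivative (\<lambda>h. hess u y *v h)) (at y)"
    using assms y unfolding C2_on_def hess_def by (simp add: jacobian_works)
qed

lemma jet_on_subset: "jet_on S f p X \<Longrightarrow> open T \<Longrightarrow> T \<subseteq> S \<Longrightarrow> jet_on T f p X"
  unfolding jet_on_def using continuous_on_subset by blast

section \<open>Calculus of jets\<close>

lemma jet_on_add:
  assumes "jet_on S f p X" "jet_on S g q Y"
  shows "jet_on S (\<lambda>y. f y + g y) (\<lambda>y. p y + q y) (\<lambda>y. X y + Y y)"
  using assms unfolding jet_on_def
  by (auto intro!: continuous_intros has_derivative_eq_rhs[OF has_derivative_add]
    simp: algebra_simps transpose_add fun_eq_iff)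

lemma jet_on_scale:
  assumes "jet_on S f p X"
  shows "jet_on S (\<lambda>y. c * f y) (\<lambda>y. c *\<^sub>R p y) (\<lambda>y. c *\<^sub>R X y)"
  using assms unfolding jet_on_def
  by (auto intro!: continuous_intros has_derivative_eq_rhs[OF has_derivative_mult_right]
    has_derivative_eq_rhs[OF has_derivative_scaleR_right]
    simp: transpose_scaleR scaleR_matrix_vector_assoc[symmetric])

lemma jet_on_diff:
  assumes "jet_on S f p X" "jet_on S g q Y"
  shows "jet_on S (\<lambda>y. f y - g y) (\<lambda>y. p y - q y) (\<lambda>y. X y - Y y)"
  using jet_on_add[OF assms(1) jet_on_scale[OF assms(2), of "-1"]] by simp

lemma jet_on_compose:
  assumes f: "jet_on S f p X"
    and a: "\<And>y. y \<in> S \<Longrightarrow> (a has_real_derivative b (f y)) (at (f y))"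
    and b: "\<And>y. y \<in> S \<Longrightarrow> (b has_real_derivative c (f y)) (at (f y))"
    and c: "continuous_on (f ` S) c"
  shows "jet_on S (\<lambda>y. a (f y)) (\<lambda>y. b (f y) *\<^sub>R p y) (\<lambda>y. b (f y) *\<^sub>R X y + c (f y) *\<^sub>R outer (p y))"
proof (rule jet_onI)
  note j = jet_onD[OF f]
  show "open S" by (rule j)
  show "((\<lambda>y. a (f y)) has_derivative (\<lambda>h. (b (f y) *\<^sub>R p y) \<bullet> h)) (at y)" if "y \<in> S" for y
    using has_derivative_compose[OF j(2)[OF that] a[OF that, unfolded has_field_derivative_def]] by simp
  have bd: "((\<lambda>y. b (f y)) has_derivative (\<lambda>h. c (f y) * (p y \<bullet> h))) (at y)" if "y \<in> S" for y
    using has_derivative_compose[OF j(2)[OF that] b[OF that, unfolded has_field_derivative_def]] by simp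
  show "((\<lambda>y. b (f y) *\<^sub>R p y) has_derivative (\<lambda>h. (b (f y) *\<^sub>R X y + c (f y) *\<^sub>R outer (p y)) *v h)) (at y)"
    if "y \<in> S" for y
    by (rule has_derivative_eq_rhs[OF has_derivative_scaleR[OF bd[OF that] j(3)[OF that]]])
      (simp add: fun_eq_iff algebra_simps scaleR_matrix_vector_assoc[symmetric] outer_mult_vec)
  have "continuous_on S (\<lambda>y. b (f y))"
    using bd j(1) by (meson continuous_at_imp_continuous_on has_derivative_continuous)
  then show "continuous_on S (\<lambda>y. b (f y) *\<^sub>R X y + c (f y) *\<^sub>R outer (p y))"
    by (intro continuous_intros j continuous_on_compose2[OF c]) auto
qed

lemma jet_on_powr:
  assumes f: "jet_on S f p X" and pos: "\<And>y. y \<in> S \<Longrightarrow> 0 < f y"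
  shows "jet_on S (\<lambda>y. f y powr r) (\<lambda>y. (r * f y powr (r - 1)) *\<^sub>R p y)
    (\<lambda>y. (r * f y powr (r - 1)) *\<^sub>R X y + (r * ((r - 1) * f y powr (r - 2))) *\<^sub>R outer (p y))"
proof (rule jet_on_compose[OF f, of "\<lambda>t. t powr r" "\<lambda>t. r * t powr (r - 1)" "\<lambda>t. r * ((r - 1) * t powr (r - 2))"])
  fix y assume y: "y \<in> S"
  show "((\<lambda>t. t powr r) has_real_derivative r * f y powr (r - 1)) (at (f y))"
    using pos[OF y] by (rule has_real_derivative_powr)
  have "((\<lambda>t. t powr (r - 1)) has_real_derivative (r - 1) * f y powr ((r - 1) - 1)) (at (f y))"
    using pos[OF y] by (rule has_real_derivative_powr)
  from DERIV_cmult[OF this, of r]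
  show "((\<lambda>t. r * t powr (r - 1)) has_real_derivative r * ((r - 1) * f y powr (r - 2))) (at (f y))"
    by simp
next
  show "continuous_on (f ` S) (\<lambda>t. r * ((r - 1) * t powr (r - 2)))"
    using pos by (intro continuous_intros) fastforce
qed

lemma jet_on_inner_square:
  "jet_on UNIV (\<lambda>y. (y - c) \<bullet> (y - c)) (\<lambda>y. 2 *\<^sub>R (y - c)) (\<lambda>y. 2 *\<^sub>R mat 1)"
  by (rule jet_onI) (auto intro!: derivative_eq_intros
    simp: scaleR_matrix_vector_assoc[symmetric] inner_commute)

lemma jet_on_linear: "jet_on UNIV (\<lambda>y. e \<bullet> y) (\<lambda>y. e) (\<lambda>y. 0)"
  by (rule jet_onI) (auto intro!: derivative_eq_intros)

lemma jet_on_const: "jet_on UNIV (\<lambda>y. c) (\<lambda>y. 0) (\<lambda>y. 0)"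
  by (rule jet_onI) (auto intro!: derivative_eq_intros)

lemma jet_on_linear_square: "jet_on UNIV (\<lambda>y. (e \<bullet> y)\<^sup>2) (\<lambda>y. (2 * (e \<bullet> y)) *\<^sub>R e) (\<lambda>y. 2 *\<^sub>R outer e)"
proof -
  have "jet_on UNIV (\<lambda>y. (e \<bullet> y)\<^sup>2) (\<lambda>y. (2 * (e \<bullet> y)) *\<^sub>R e) (\<lambda>y. (2 * (e \<bullet> y)) *\<^sub>R 0 + 2 *\<^sub>R outer e)"
    by (rule jet_on_compose[OF jet_on_linear, where a = "\<lambda>t. t\<^sup>2" and b = "\<lambda>t. 2 * t" and c = "\<lambda>_. 2"])
      (auto intro!: derivative_eq_intros)
  then show ?thesis by simp
qed

lemma jet_on_local_min:
  fixes f :: "real^'n \<Rightarrow> real"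
  assumes f: "jet_on S f p X" and y: "y \<in> S" and min: "\<forall>\<^sub>F z in nhds y. f y \<le> f z"
  shows "p y = 0" and "0 \<le> v \<bullet> (X y *v v)"
proof -
  note j = jet_onD[OF f]
  obtain r where r: "0 < r" "ball y r \<subseteq> S" using j(1) y open_contains_ball by blast
  obtain d where d: "0 < d" "\<And>z. dist z y < d \<Longrightarrow> f y \<le> f z"
    using min unfolding eventually_nhds_metric by blast
  have p0: "p y \<bullet> v = 0" for v
  proof -
    define e where "e = d / (norm v + 1)"
    have e: "0 < e" using d by (simp add: e_def add_nonneg_pos)
    have "((\<lambda>t. f (y + t *\<^sub>R v)) has_real_derivative p y \<bullet> v) (at 0)"
      using DERIV_line[of f "p y" y 0 v] j(2)[OF y] by simp
    then show ?thesis
    proof (rule DERIV_local_min[OF _ e])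
      show "\<forall>t. \<bar>0 - t\<bar> < e \<longrightarrow> f (y + 0 *\<^sub>R v) \<le> f (y + t *\<^sub>R v)"
      proof (intro allI impI)
        fix t :: real assume "\<bar>0 - t\<bar> < e"
        then have "\<bar>t\<bar> * norm v \<le> e * norm v" by (intro mult_right_mono) auto
        also have "\<dots> < e * (norm v + 1)" using e by simp
        also have "\<dots> = d" unfolding e_def using add_nonneg_pos[of "norm v" 1] by simp
        finally show "f (y + 0 *\<^sub>R v) \<le> f (y + t *\<^sub>R v)" using d(2)[of "y + t *\<^sub>R v"] by (simp add: dist_norm)
      qed
    qed
  qed
  from p0[of "p y"] show "p y = 0" by simp
  show "0 \<le> v \<bullet> (X y *v v)"
  proof (rule ccontr)
    assume "\<not> ?thesis"
    then have neg: "(X y *v v) \<bullet> v < 0" by (simp add: inner_commute)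
    have "((\<lambda>t. p (y + t *\<^sub>R v) \<bullet> v) has_real_derivative (X y *v v) \<bullet> v) (at 0)"
      using DERIV_line_inner[of p "X y" y 0 v] j(3)[OF y] by simp
    from DERIV_neg_dec_right[OF this neg] obtain e where e: "0 < e"
      "\<And>h. 0 < h \<Longrightarrow> h < e \<Longrightarrow> p (y + h *\<^sub>R v) \<bullet> v < 0"
      using p0 by auto
    \<comment> \<open>Along \<open>v\<close> the derivative is negative just to the right of 0;
      \<open>t\<close> keeps the segment within that range, the domain and the neighbourhood of the
      minimum.\<close>
    define t where "t = min (e / 2) (min r d / (norm v + 1))"
    have nv: "0 < norm v + 1" by (simp add: add_nonneg_pos)
    have t: "0 < t" "t < e" using e d r nv by (auto simp: t_def)
    have small: "s * norm v < min r d" if "0 \<le> s" "s \<le> t" for s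
    proof -
      have "s * norm v \<le> t * norm v" using that by (intro mult_right_mono) auto
      also have "\<dots> < t * (norm v + 1)" using t by simp
      also have "\<dots> \<le> min r d / (norm v + 1) * (norm v + 1)" using nv by (intro mult_right_mono) (auto simp: t_def)
      finally show ?thesis using nv by simp
    qed
    have "\<exists>z>0. z < t \<and> f (y + t *\<^sub>R v) - f (y + 0 *\<^sub>R v) = (t - 0) * (p (y + z *\<^sub>R v) \<bullet> v)"
    proof (rule MVT2[OF t(1)])
      fix s assume "0 \<le> s" "s \<le> t"
      then have "y + s *\<^sub>R v \<in> ball y r" using small[of s] by (simp add: dist_norm)
      then show "((\<lambda>t. f (y + t *\<^sub>R v)) has_real_derivative p (y + s *\<^sub>R v) \<bullet> v) (at s)"
        using r(2) by (intro DERIV_line j) auto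
    qed
    then obtain z where "0 < z" "z < t" "f (y + t *\<^sub>R v) - f y = t * (p (y + z *\<^sub>R v) \<bullet> v)" by auto
    moreover from this have "p (y + z *\<^sub>R v) \<bullet> v < 0" using e(2) t by auto
    ultimately have "f (y + t *\<^sub>R v) < f y" using t(1) mult_pos_neg[of t "p (y + z *\<^sub>R v) \<bullet> v"] by simp
    moreover have "dist (y + t *\<^sub>R v) y < d" using small[of t] t(1) by (simp add: dist_norm)
    ultimately show False using d(2) by force
  qed
qed

section \<open>Kelvin transforms of solutions\<close>

lemma continuous_on_matrix_mult [continuous_intros]:
  fixes A :: "'b::topological_space \<Rightarrow> real^'n^'m" and B :: "'b \<Rightarrow> real^'l^'n"
  assumes "continuous_on S A" "continuous_on S B"
  shows "continuous_on S (\<lambda>x. A x ** B x)"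
  unfolding matrix_matrix_mult_def by (intro continuous_intros assms)

definition amat :: "real \<Rightarrow> real^'n \<Rightarrow> real^'n^'n \<Rightarrow> real^'n^'n" where
  "amat w p X = w *\<^sub>R X - ((p \<bullet> p) / 2) *\<^sub>R mat 1"

definition solution_on :: "nat \<Rightarrow> (real^'n) set \<Rightarrow> (real^'n \<Rightarrow> real) \<Rightarrow> (real^'n \<Rightarrow> real^'n) \<Rightarrow> (real^'n \<Rightarrow> real^'n^'n) \<Rightarrow> bool" where
  "solution_on k S w p X \<longleftrightarrow> jet_on S w p X \<and> (\<forall>y\<in>S. 0 < w y \<and> amat (w y) (p y) (X y) \<in> mat_cone k
     \<and> sigma_mat k (amat (w y) (p y) (X y)) = 1)"

definition inversion :: "real^'n \<Rightarrow> real \<Rightarrow> real^'n \<Rightarrow> real^'n" where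
  "inversion x L y = x + (L\<^sup>2 / ((y - x) \<bullet> (y - x))) *\<^sub>R (y - x)"

text \<open>The Householder reflection. Up to the factor L^2 / |z|^2 it is the differential of the
  inversion at x + z, which expresses that inversion is conformal.\<close>

definition reflection :: "real^'n \<Rightarrow> real^'n^'n" where
  "reflection z = mat 1 - (2 / (z \<bullet> z)) *\<^sub>R outer z"

lemma reflection_mult_vec: "reflection z *v h = h - (2 * (z \<bullet> h) / (z \<bullet> z)) *\<^sub>R z"
  by (simp add: reflection_def matrix_vector_mult_diff_rdistrib scaleR_matrix_vector_assoc[symmetric] outer_mult_vec)

lemma transpose_reflection [simp]: "transpose (reflection z) = reflection z"
  by (simp add: reflection_def transpose_def outer_def vec_eq_iff mat_def)

lemma orthogonal_reflection:
  assumes "z \<noteq> 0"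
  shows "orthogonal_matrix (reflection z)"
proof -
  have "z \<bullet> (reflection z *v h) = - (z \<bullet> h)" for h
    using assms by (simp add: reflection_mult_vec inner_diff_right)
  then have "reflection z *v (reflection z *v h) = h" for h
    by (simp add: reflection_mult_vec[of z "reflection z *v h"]) (simp add: reflection_mult_vec)
  then have "reflection z ** reflection z = mat 1"
    by (simp add: matrix_eq matrix_vector_mul_assoc[symmetric])
  then show ?thesis by (simp add: orthogonal_matrix_def)
qed

lemma has_derivative_inversion:
  assumes "y \<noteq> x"
  shows "(inversion x L has_derivative
    (\<lambda>h. (L\<^sup>2 / ((y - x) \<bullet> (y - x))) *\<^sub>R (reflection (y - x) *v h))) (at y)"
proof -
  define z where "z = y - x"
  have nz: "z \<bullet> z \<noteq> 0" using assms by (simp add: z_def)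
  have "((\<lambda>y. (y - x) \<bullet> (y - x)) has_derivative (\<lambda>h. 2 * ((y - x) \<bullet> h))) (at y)"
    by (auto intro!: derivative_eq_intros simp: inner_commute)
  then have "((\<lambda>y. L\<^sup>2 / ((y - x) \<bullet> (y - x))) has_derivative
      (\<lambda>h. - L\<^sup>2 * (2 * ((y - x) \<bullet> h)) / ((y - x) \<bullet> (y - x))\<^sup>2)) (at y)"
    by (rule has_derivative_eq_rhs[OF has_derivative_divide'[OF has_derivative_const]])
      (use assms in \<open>auto simp: power2_eq_square\<close>)
  from has_derivative_add[OF has_derivative_const has_derivative_scaleR[OF this has_derivative_diff[OF has_derivative_ident has_derivative_const]]]
  show ?thesis
    unfolding inversion_def
    by (rule has_derivative_eq_rhs, simp only: fun_eq_iff z_def[symmetric])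
      (use nz in \<open>auto simp: reflection_mult_vec algebra_simps power2_eq_square\<close>)
qed

context
  fixes w :: "real^'n \<Rightarrow> real" and p :: "real^'n \<Rightarrow> real^'n" and X :: "real^'n \<Rightarrow> real^'n^'n"
    and x :: "real^'n" and L :: real
begin

text \<open>The classical Kelvin transform of u = w^(-(n - 2) / 2), namely (L / |y - x|)^(n - 2)
  times u at the inverted point, raised to the power -2 / (n - 2).\<close>

definition kelvin :: "real^'n \<Rightarrow> real" where
  "kelvin y = ((y - x) \<bullet> (y - x)) / L\<^sup>2 * w (inversion x L y)"

definition kelvin_grad :: "real^'n \<Rightarrow> real^'n" where
  "kelvin_grad y = (2 / L\<^sup>2 * w (inversion x L y)) *\<^sub>R (y - x) + reflection (y - x) *v p (inversion x L y)"

definition kelvin_hess :: "real^'n \<Rightarrow> real^'n^'n" where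
  "kelvin_hess y = (2 * w (inversion x L y) / L\<^sup>2
      - 2 / ((y - x) \<bullet> (y - x)) * ((y - x) \<bullet> p (inversion x L y))) *\<^sub>R mat 1
    + (L\<^sup>2 / ((y - x) \<bullet> (y - x))) *\<^sub>R (reflection (y - x) ** X (inversion x L y) ** reflection (y - x))"

lemma jet_on_kelvin:
  assumes w: "jet_on UNIV w p X" and L: "L \<noteq> 0"
  shows "jet_on (- {x}) kelvin kelvin_grad kelvin_hess"
proof (rule jet_onI)
  note j = jet_onD[OF w]
  show "open (- {x})" by auto
  show "(kelvin has_derivative (\<lambda>h. kelvin_grad y \<bullet> h)) (at y)" if "y \<in> - {x}" for y
  proof -
    define z where "z = y - x"
    have nz: "z \<bullet> z \<noteq> 0" and yx: "y \<noteq> x" using that by (auto simp: z_def)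
    have d1: "((\<lambda>y. (y - x) \<bullet> (y - x) / L\<^sup>2) has_derivative (\<lambda>h. 2 * ((y - x) \<bullet> h) / L\<^sup>2)) (at y)"
      by (rule has_derivative_eq_rhs[OF has_derivative_divide[OF _ has_derivative_const]],
          rule has_derivative_inner[OF has_derivative_diff[OF has_derivative_ident has_derivative_const]
            has_derivative_diff[OF has_derivative_ident has_derivative_const]])
        (use L in \<open>auto simp: inner_commute fun_eq_iff divide_inverse\<close>)
    have d2: "((\<lambda>y. w (inversion x L y)) has_derivative
        (\<lambda>h. p (inversion x L y) \<bullet> ((L\<^sup>2 / ((y - x) \<bullet> (y - x))) *\<^sub>R (reflection (y - x) *v h)))) (at y)"
      using has_derivative_compose[OF has_derivative_inversion[OF yx] j(2)] by simp
    show ?thesis unfolding kelvin_def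
      by (rule has_derivative_eq_rhs[OF has_derivative_mult[OF d1 d2]],
          simp only: fun_eq_iff kelvin_grad_def z_def[symmetric])
        (use nz L in \<open>simp add: reflection_mult_vec inner_diff_left inner_diff_right
          inner_add_left inner_add_right inner_commute[of "p _"] field_simps power2_eq_square\<close>)
  qed
  show "(kelvin_grad has_derivative (\<lambda>h. kelvin_hess y *v h)) (at y)" if "y \<in> - {x}" for y
  proof -
    define z where "z = y - x"
    have nz: "z \<bullet> z \<noteq> 0" and yx: "y \<noteq> x" using that by (auto simp: z_def)
    let ?T = "inversion x L y"
    let ?T' = "\<lambda>h. (L\<^sup>2 / (z \<bullet> z)) *\<^sub>R (reflection z *v h)"
    have T: "(inversion x L has_derivative ?T') (at y)"
      using has_derivative_inversion[OF yx] by (simp add: z_def)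
    have dw: "((\<lambda>y. w (inversion x L y)) has_derivative (\<lambda>h. p ?T \<bullet> ?T' h)) (at y)"
      using has_derivative_compose[OF T j(2)] by simp
    have dp: "((\<lambda>y. p (inversion x L y)) has_derivative (\<lambda>h. X ?T *v ?T' h)) (at y)"
      using has_derivative_compose[OF T j(3)] by simp
    have dz: "((\<lambda>y. y - x) has_derivative (\<lambda>h. h)) (at y)"
      by (auto intro!: derivative_eq_intros)
    have dn: "((\<lambda>y. (y - x) \<bullet> (y - x)) has_derivative (\<lambda>h. 2 * (z \<bullet> h))) (at y)"
      by (auto intro!: derivative_eq_intros simp: inner_commute z_def)
    have di: "((\<lambda>y. (y - x) \<bullet> p (inversion x L y)) has_derivative
        (\<lambda>h. h \<bullet> p ?T + z \<bullet> (X ?T *v ?T' h))) (at y)"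
      by (rule has_derivative_eq_rhs[OF has_derivative_inner[OF dz dp]]) (simp add: z_def fun_eq_iff)
    have dq: "((\<lambda>y. 2 * ((y - x) \<bullet> p (inversion x L y)) / ((y - x) \<bullet> (y - x))) has_derivative
        (\<lambda>h. 2 * ((h \<bullet> p ?T + z \<bullet> (X ?T *v ?T' h)) / (z \<bullet> z) - (z \<bullet> p ?T) * (2 * (z \<bullet> h)) / (z \<bullet> z)\<^sup>2))) (at y)"
      by (rule has_derivative_eq_rhs[OF has_derivative_divide'[OF has_derivative_mult_right[OF di, of 2] dn]])
        (use nz in \<open>auto simp: fun_eq_iff z_def[symmetric] field_simps power2_eq_square\<close>)
    have dd: "((\<lambda>y. (2 / L\<^sup>2 * w (inversion x L y)) *\<^sub>R (y - x) + (p (inversion x L y)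
         - (2 * ((y - x) \<bullet> p (inversion x L y)) / ((y - x) \<bullet> (y - x))) *\<^sub>R (y - x)))
       has_derivative (\<lambda>h. ((2 / L\<^sup>2 * w ?T) *\<^sub>R h + (2 / L\<^sup>2 * (p ?T \<bullet> ?T' h)) *\<^sub>R z) + (X ?T *v ?T' h
         - ((2 * (z \<bullet> p ?T) / (z \<bullet> z)) *\<^sub>R h
           + (2 * ((h \<bullet> p ?T + z \<bullet> (X ?T *v ?T' h)) / (z \<bullet> z) - (z \<bullet> p ?T) * (2 * (z \<bullet> h)) / (z \<bullet> z)\<^sup>2)) *\<^sub>R z)))) (at y)"
      unfolding z_def
      by (intro has_derivative_add has_derivative_diff has_derivative_scaleR has_derivative_mult_right
          dw[unfolded z_def] dp[unfolded z_def] dz dq[unfolded z_def])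
    show ?thesis
      unfolding kelvin_grad_def reflection_mult_vec
    proof (rule has_derivative_eq_rhs[OF dd], rule ext)
      fix h
      define g where "g = X ?T *v ?T' h"
      have T'h: "?T' h = (L\<^sup>2 / (z \<bullet> z)) *\<^sub>R (h - (2 * (z \<bullet> h) / (z \<bullet> z)) *\<^sub>R z)"
        by (simp add: reflection_mult_vec)
      \<comment> \<open>These two terms along \<open>z\<close> cancel those from differentiating the
        quotient in the reflection; what is left along \<open>z\<close> completes the reflection of
        \<open>g\<close>.\<close>
      have pT: "2 / L\<^sup>2 * (p ?T \<bullet> ?T' h) = 2 * (p ?T \<bullet> h) / (z \<bullet> z) - 4 * (z \<bullet> h) * (z \<bullet> p ?T) / (z \<bullet> z)\<^sup>2"
        unfolding T'h using nz L by (simp add: inner_diff_right field_simps power2_eq_square inner_commute)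
      have "((L\<^sup>2 / (z \<bullet> z)) *\<^sub>R (reflection z ** X ?T ** reflection z)) *v h = reflection z *v g"
        by (simp add: g_def matrix_vector_mul_assoc[symmetric] scaleR_matrix_vector_assoc[symmetric]
            matrix_vector_mult_scaleR)
      then have "kelvin_hess y *v h = (2 * w ?T / L\<^sup>2 - 2 / (z \<bullet> z) * (z \<bullet> p ?T)) *\<^sub>R h
          + (g - (2 * (z \<bullet> g) / (z \<bullet> z)) *\<^sub>R z)"
        by (simp add: kelvin_hess_def z_def[symmetric] matrix_vector_mult_add_rdistrib
            scaleR_matrix_vector_assoc[symmetric] reflection_mult_vec)
      then show "((2 / L\<^sup>2 * w ?T) *\<^sub>R h + (2 / L\<^sup>2 * (p ?T \<bullet> ?T' h)) *\<^sub>R z) + (X ?T *v ?T' h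
         - ((2 * (z \<bullet> p ?T) / (z \<bullet> z)) *\<^sub>R h
           + (2 * ((h \<bullet> p ?T + z \<bullet> (X ?T *v ?T' h)) / (z \<bullet> z) - (z \<bullet> p ?T) * (2 * (z \<bullet> h)) / (z \<bullet> z)\<^sup>2)) *\<^sub>R z))
         = kelvin_hess y *v h"
        unfolding pT g_def[symmetric]
        by (simp add: algebra_simps inner_commute add_divide_distrib diff_divide_distrib)
    qed
  qed
  have ci: "continuous_on (- {x}) (inversion x L)"
    unfolding inversion_def by (intro continuous_intros) auto
  show "continuous_on (- {x}) kelvin_hess"
    unfolding kelvin_hess_def reflection_def
    by (intro continuous_intros continuous_on_compose2[OF j(4) ci] continuous_on_compose2[OF j(6) ci]
      continuous_on_compose2[OF j(7) ci]) (use L in auto)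
qed

lemma amat_kelvin:
  assumes L: "L \<noteq> 0" and y: "y \<noteq> x"
  shows "amat (kelvin y) (kelvin_grad y) (kelvin_hess y) =
    reflection (y - x) ** amat (w (inversion x L y)) (p (inversion x L y)) (X (inversion x L y))
      ** transpose (reflection (y - x))"
proof -
  define z where "z = y - x"
  have nz: "z \<bullet> z \<noteq> 0" and z0: "z \<noteq> 0" using y by (auto simp: z_def)
  let ?T = "inversion x L y" and ?R = "reflection z"
  have RR: "?R *v (?R *v h) = h" for h
    using orthogonal_reflection[OF z0] by (simp add: matrix_vector_mul_assoc orthogonal_matrix_def del: transpose_matrix_vector)
  \<comment> \<open>The reflection preserves norms and reverses \<open>z\<close>, which gives the
    last two terms.\<close>
  have gg: "kelvin_grad y \<bullet> kelvin_grad y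
      = 4 / L^4 * (w ?T)\<^sup>2 * (z \<bullet> z) + p ?T \<bullet> p ?T - 4 / L\<^sup>2 * w ?T * (z \<bullet> p ?T)"
    using nz L unfolding kelvin_grad_def z_def[symmetric] reflection_mult_vec
    by (simp add: inner_add_left inner_add_right inner_diff_left inner_diff_right inner_commute
        field_simps power2_eq_square power4_eq_xxxx)
  have "amat (kelvin y) (kelvin_grad y) (kelvin_hess y) *v h
     = (?R ** amat (w ?T) (p ?T) (X ?T) ** transpose ?R) *v h" for h
  proof -
    define g where "g = ?R *v (X ?T *v (?R *v h))"
    have l: "amat (kelvin y) (kelvin_grad y) (kelvin_hess y) *v h
      = ((z \<bullet> z) / L\<^sup>2 * w ?T) *\<^sub>R ((2 * w ?T / L\<^sup>2 - 2 / (z \<bullet> z) * (z \<bullet> p ?T)) *\<^sub>R h + (L\<^sup>2 / (z \<bullet> z)) *\<^sub>R g)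
        - ((kelvin_grad y \<bullet> kelvin_grad y) / 2) *\<^sub>R h"
      by (simp add: amat_def kelvin_def kelvin_hess_def z_def[symmetric] matrix_vector_mult_add_rdistrib
          matrix_vector_mult_diff_rdistrib scaleR_matrix_vector_assoc[symmetric] matrix_vector_mul_assoc[symmetric] g_def
          del: transpose_matrix_vector)
    have r: "(?R ** amat (w ?T) (p ?T) (X ?T) ** transpose ?R) *v h = w ?T *\<^sub>R g - ((p ?T \<bullet> p ?T) / 2) *\<^sub>R h"
      by (simp add: amat_def matrix_vector_mul_assoc[symmetric] matrix_vector_mult_diff_rdistrib
          scaleR_matrix_vector_assoc[symmetric] g_def matrix_vector_mult_diff_distrib matrix_vector_mult_scaleR RR
          del: transpose_matrix_vector)
    have c1: "(z \<bullet> z) / L\<^sup>2 * w ?T * (L\<^sup>2 / (z \<bullet> z)) = w ?T" using nz L by simp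
    \<comment> \<open>All multiples of the identity collect here: what the Kelvin factor adds to the
      Hessian term is compensated by half the squared gradient, up to |p|^2 / 2.\<close>
    have c2: "(z \<bullet> z) / L\<^sup>2 * w ?T * (2 * w ?T / L\<^sup>2 - 2 / (z \<bullet> z) * (z \<bullet> p ?T)) - (kelvin_grad y \<bullet> kelvin_grad y) / 2
        = - (p ?T \<bullet> p ?T) / 2"
      using nz L unfolding gg by (simp add: field_simps power2_eq_square power4_eq_xxxx)
    have "amat (kelvin y) (kelvin_grad y) (kelvin_hess y) *v h
      = ((z \<bullet> z) / L\<^sup>2 * w ?T * (2 * w ?T / L\<^sup>2 - 2 / (z \<bullet> z) * (z \<bullet> p ?T)) - (kelvin_grad y \<bullet> kelvin_grad y) / 2) *\<^sub>R h
       + ((z \<bullet> z) / L\<^sup>2 * w ?T * (L\<^sup>2 / (z \<bullet> z))) *\<^sub>R g"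
    proof -
      have "a *\<^sub>R (b *\<^sub>R h + c *\<^sub>R g) - d *\<^sub>R h = (a * b - d) *\<^sub>R h + (a * c) *\<^sub>R g"
        for a b c d :: real by (simp add: algebra_simps)
      then show ?thesis unfolding l .
    qed
    then show ?thesis unfolding c1 c2 r by simp
  qed
  then show ?thesis by (simp add: matrix_eq z_def)
qed

lemma solution_on_kelvin:
  assumes w: "solution_on k UNIV w p X" and L: "L \<noteq> 0"
  shows "solution_on k (- {x}) kelvin kelvin_grad kelvin_hess"
  unfolding solution_on_def
proof (intro conjI ballI)
  show "jet_on (- {x}) kelvin kelvin_grad kelvin_hess"
    using w L by (intro jet_on_kelvin) (auto simp: solution_on_def)
  fix y assume "y \<in> - {x}"
  then have y: "y \<noteq> x" and nz: "y - x \<noteq> 0" by auto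
  let ?T = "inversion x L y"
  have "0 < w ?T" using w by (simp add: solution_on_def)
  then show "0 < kelvin y" unfolding kelvin_def using y L
    by (intro mult_pos_pos divide_pos_pos) auto
  have A: "amat (w ?T) (p ?T) (X ?T) \<in> mat_cone k" "sigma_mat k (amat (w ?T) (p ?T) (X ?T)) = 1"
    using w by (auto simp: solution_on_def)
  note R = orthogonal_reflection[OF nz]
  show "sigma_mat k (amat (kelvin y) (kelvin_grad y) (kelvin_hess y)) = 1"
    using A(2) unfolding amat_kelvin[OF L y] sigma_mat_orthogonal[OF R] .
  show "amat (kelvin y) (kelvin_grad y) (kelvin_hess y) \<in> mat_cone k"
    using A(1) unfolding amat_kelvin[OF L y] mat_cone_def mem_Collect_eq sigma_mat_orthogonal[OF R]
    by (simp add: matrix_transpose_mul matrix_mul_assoc)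
qed

end

section \<open>Hopf lemma and strong maximum principle\<close>

lemma compact_quadratic_form_bound:
  fixes Y :: "real^'n \<Rightarrow> real^'n^'n"
  assumes "compact A" "continuous_on A Y"
  obtains M where "0 \<le> M" "\<And>y v. y \<in> A \<Longrightarrow> \<bar>v \<bullet> (Y y *v v)\<bar> \<le> M * (v \<bullet> v)"
proof -
  let ?f = "\<lambda>(y, v). v \<bullet> (Y y *v v)"
  have "compact (A \<times> sphere (0 :: real^'n) 1)" using assms(1) by (intro compact_Times) auto
  moreover have "continuous_on (A \<times> sphere 0 1) ?f"
    unfolding case_prod_beta
    by (intro continuous_intros continuous_on_compose2[OF assms(2)]) auto
  ultimately have "bounded (?f ` (A \<times> sphere 0 1))"
    by (intro compact_imp_bounded compact_continuous_image)
  then obtain M where M: "0 < M" "\<And>x. x \<in> A \<times> sphere 0 1 \<Longrightarrow> \<bar>?f x\<bar> \<le> M"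
    unfolding bounded_pos by auto
  have "\<bar>v \<bullet> (Y y *v v)\<bar> \<le> M * (v \<bullet> v)" if "y \<in> A" for y v
  proof (cases "v = 0")
    case False
    define e where "e = (1 / norm v) *\<^sub>R v"
    have v: "v = norm v *\<^sub>R e" using False by (simp add: e_def)
    have "norm e = 1" using False by (simp add: e_def)
    then have "\<bar>e \<bullet> (Y y *v e)\<bar> \<le> M" using M(2)[of "(y, e)"] that by simp
    then have "(norm v)\<^sup>2 * \<bar>e \<bullet> (Y y *v e)\<bar> \<le> (norm v)\<^sup>2 * M" by (intro mult_left_mono) auto
    moreover have "v \<bullet> (Y y *v v) = (norm v)\<^sup>2 * (e \<bullet> (Y y *v e))"
      by (subst v, subst (2) v) (simp add: matrix_vector_mult_scaleR power2_eq_square)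
    ultimately show ?thesis by (simp add: abs_mult power2_norm_eq_inner mult.commute)
  qed simp
  then show thesis using that[of M] M(1) by auto
qed

lemma jet_on_gaussian:
  fixes c :: "real^'n"
  shows "jet_on UNIV (\<lambda>y. exp (- N * ((y - c) \<bullet> (y - c))))
    (\<lambda>y. (- N * exp (- N * ((y - c) \<bullet> (y - c)))) *\<^sub>R (2 *\<^sub>R (y - c)))
    (\<lambda>y. (- N * exp (- N * ((y - c) \<bullet> (y - c)))) *\<^sub>R (2 *\<^sub>R mat 1)
      + (N\<^sup>2 * exp (- N * ((y - c) \<bullet> (y - c)))) *\<^sub>R outer (2 *\<^sub>R (y - c)))"
  by (rule jet_on_compose[OF jet_on_inner_square, where a = "\<lambda>t. exp (- N * t)"
        and b = "\<lambda>t. - N * exp (- N * t)" and c = "\<lambda>t. N\<^sup>2 * exp (- N * t)"])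
    (auto intro!: derivative_eq_intros continuous_intros simp: power2_eq_square)

lemma inner_outer: "x \<bullet> (outer v *v x) = (v \<bullet> x)\<^sup>2"
  by (simp add: outer_mult_vec inner_commute power2_eq_square)

lemma transpose_diff: "transpose (A - B) = transpose A - transpose (B :: real^'n^'m)"
  by (simp add: transpose_def vec_eq_iff)

text \<open>The differential inequality behind the barrier: at a point where \<open>V - w - m h\<close> has a negative
  minimum, \<open>h\<close> being a Gaussian centred at \<open>c\<close> minus its value on the sphere, the matrix of \<open>w\<close> is
  dominated by that of \<open>V\<close> decreased in the radial direction.\<close>
lemma amat_barrier_psd:
  fixes p q v z x :: "real^'n" and X Y :: "real^'n^'n"
  assumes grad: "q - p = m *\<^sub>R ((- N * E) *\<^sub>R (2 *\<^sub>R z))"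
    and hess: "m * (x \<bullet> (((- N * E) *\<^sub>R (2 *\<^sub>R mat 1) + (N\<^sup>2 * E) *\<^sub>R outer (2 *\<^sub>R z)) *v x)) \<le> x \<bullet> (Y *v x) - x \<bullet> (X *v x)"
    and z: "R / 2 \<le> norm z" "norm z \<le> R" "z = norm z *\<^sub>R v"
    and pos: "0 < m" "0 < N" "0 < E" "0 < R" "0 < w0" "w0 \<le> w" "w \<le> w1"
    and f: "V - w \<le> m * E" "w \<le> V"
    and M1: "\<bar>x \<bullet> (Y *v x)\<bar> \<le> M1 * (x \<bullet> x)" and M2: "norm (p + q) \<le> M2"
  shows "x \<bullet> (amat w p X *v x) \<le> x \<bullet> ((amat V q Y - (m * E * (N\<^sup>2 * w0 * R\<^sup>2)) *\<^sub>R outer v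
      + (m * E * (2 * N * w1 + M1 + N * R * M2)) *\<^sub>R mat 1) *v x)"
proof -
  let ?xx = "x \<bullet> x" and ?v = "(v \<bullet> x)\<^sup>2"
  have zx: "z \<bullet> x = norm z * (v \<bullet> x)" by (subst z(3)) simp
  have h: "m * (N\<^sup>2 * E * (4 * (norm z)\<^sup>2 * ?v) - 2 * N * E * ?xx) \<le> x \<bullet> (Y *v x) - x \<bullet> (X *v x)"
    using hess by (simp add: matrix_vector_mult_add_rdistrib scaleR_matrix_vector_assoc[symmetric]
      inner_add_right inner_outer zx power_mult_distrib algebra_simps)
  have R4: "R\<^sup>2 \<le> 4 * (norm z)\<^sup>2"
    using power_mono[OF z(1), of 2] pos(4) by (simp add: power_divide)
  have "m * (N\<^sup>2 * E * (R\<^sup>2 * ?v) - 2 * N * E * ?xx) \<le> m * (N\<^sup>2 * E * (4 * (norm z)\<^sup>2 * ?v) - 2 * N * E * ?xx)"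
    using pos R4 by (intro mult_left_mono diff_right_mono mult_right_mono) auto
  from order_trans[OF this h] have "w * (m * (N\<^sup>2 * E * (R\<^sup>2 * ?v) - 2 * N * E * ?xx)) \<le> w * (x \<bullet> (Y *v x) - x \<bullet> (X *v x))"
    using pos by (intro mult_left_mono) auto
  moreover have "w * (m * (2 * N * E * ?xx)) \<le> w1 * (m * (2 * N * E * ?xx))"
    using pos by (intro mult_right_mono) auto
  moreover have "w0 * (m * (N\<^sup>2 * E * (R\<^sup>2 * ?v))) \<le> w * (m * (N\<^sup>2 * E * (R\<^sup>2 * ?v)))"
    using pos by (intro mult_right_mono) auto
  \<comment> \<open>Replacing the factor V of the Hessian of V by w costs V - w, which the negative
    minimum bounds by m E.\<close>
  moreover have "(w - V) * (x \<bullet> (Y *v x)) \<le> m * E * (M1 * ?xx)"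
  proof -
    have "(w - V) * (x \<bullet> (Y *v x)) \<le> \<bar>(w - V) * (x \<bullet> (Y *v x))\<bar>" by simp
    also have "\<dots> = (V - w) * \<bar>x \<bullet> (Y *v x)\<bar>" using f by (simp add: abs_mult)
    also have "\<dots> \<le> m * E * (M1 * ?xx)" using f M1 pos by (intro mult_mono) auto
    finally show ?thesis .
  qed
  moreover have "(q \<bullet> q - p \<bullet> p) / 2 * ?xx \<le> m * E * (N * R * M2) * ?xx"
  proof -
    \<comment> \<open>The gradients differ by a radial vector of size 2 m N E |z|, so this error is
      linear in N while the gain carries N^2.\<close>
    have "q \<bullet> q - p \<bullet> p = (q - p) \<bullet> (p + q)"
      by (simp add: inner_diff_left inner_add_right inner_commute[of q p])
    also have "\<dots> \<le> norm (q - p) * norm (p + q)" by (rule norm_cauchy_schwarz)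
    also have "norm (q - p) = 2 * m * N * E * norm z" using pos by (simp add: grad)
    also have "2 * m * N * E * norm z * norm (p + q) \<le> 2 * m * N * E * R * M2"
      using pos z M2 by (intro mult_mono mult_left_mono mult_nonneg_nonneg) auto
    finally have "(q \<bullet> q - p \<bullet> p) / 2 \<le> m * E * (N * R * M2)" by (simp add: algebra_simps)
    then show ?thesis by (intro mult_right_mono) auto
  qed
  moreover have "x \<bullet> (amat w p X *v x) = w * (x \<bullet> (X *v x)) - (p \<bullet> p) / 2 * ?xx"
    by (simp add: amat_def matrix_vector_mult_diff_rdistrib scaleR_matrix_vector_assoc[symmetric] inner_diff_right)
  moreover have "x \<bullet> ((amat V q Y - (m * E * (N\<^sup>2 * w0 * R\<^sup>2)) *\<^sub>R outer v
      + (m * E * (2 * N * w1 + M1 + N * R * M2)) *\<^sub>R mat 1) *v x)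
    = V * (x \<bullet> (Y *v x)) - (q \<bullet> q) / 2 * ?xx - (m * E * (N\<^sup>2 * w0 * R\<^sup>2)) * ?v + (m * E * (2 * N * w1 + M1 + N * R * M2)) * ?xx"
    by (simp add: amat_def matrix_vector_mult_diff_rdistrib matrix_vector_mult_add_rdistrib
      scaleR_matrix_vector_assoc[symmetric] inner_diff_right inner_add_right inner_outer)
  ultimately show ?thesis by (simp add: algebra_simps)
qed

text \<open>A Gaussian barrier m (E - e) is compared with V - w on the annulus R/2 <= |y - c| <= R.
  At a negative interior minimum of the difference \<open>G\<close> the radial gain b1, of order
  N^2, beats the error a1, of order N, and ellipticity contradicts sigma_k = 1. Hence G >= 0, and at
  \<open>y0\<close>, where G = 0, the derivative of V - w towards \<open>c\<close> is at least that
  of the barrier, which is positive.\<close>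

lemma hopf_boundary_derivative:
  fixes w V :: "real^'n \<Rightarrow> real"
  assumes k: "1 \<le> k" and W: "solution_on k S w p X" and V: "solution_on k S V q Y"
    and R: "0 < R" "cball c R \<subseteq> S"
    and le: "\<And>y. y \<in> cball c R \<Longrightarrow> w y \<le> V y" and less: "\<And>y. y \<in> ball c R \<Longrightarrow> w y < V y"
    and y0: "dist c y0 = R" "w y0 = V y0"
  shows "0 < (q y0 - p y0) \<bullet> (c - y0)"
proof -
  have jw: "jet_on S w p X" and jv: "jet_on S V q Y" using W V by (auto simp: solution_on_def)
  note cw = jet_onD[OF jw] and cv = jet_onD[OF jv]
  define A where "A = cball c R - ball c (R / 2)"
  have A: "compact A" "A \<subseteq> S" using R by (auto simp: A_def compact_diff)
  have y0A: "y0 \<in> A" using y0 R by (auto simp: A_def)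
  note cA = continuous_on_subset[OF _ A(2)]
  define K where "K = (\<lambda>y. amat (V y) (q y) (Y y)) ` A"
  have "continuous_on A (\<lambda>y. amat (V y) (q y) (Y y))"
    unfolding amat_def by (intro continuous_intros cA cv) auto
  then have "compact K" unfolding K_def using A(1) by (intro compact_continuous_image)
  moreover have "K \<subseteq> mat_cone k" using V A(2) by (auto simp: K_def solution_on_def)
  ultimately obtain l C where l: "0 < l" "0 \<le> C"
    "\<And>B (v :: real^'n) a b. B \<in> K \<Longrightarrow> norm v = 1 \<Longrightarrow> 0 \<le> a \<Longrightarrow> a \<le> 1 \<Longrightarrow> 0 \<le> b \<Longrightarrow> b \<le> 1 \<Longrightarrow>
      sigma_mat k (B - b *\<^sub>R outer v + a *\<^sub>R mat 1) \<le> sigma_mat k B - b * l + a * C"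
    using sigma_mat_compact_ellipticity[of K k, OF _ _ k] by metis
  obtain M1 where M1: "0 \<le> M1" "\<And>y v. y \<in> A \<Longrightarrow> \<bar>v \<bullet> (Y y *v v)\<bar> \<le> M1 * (v \<bullet> v)"
    using compact_quadratic_form_bound[OF A(1) cA[OF cv(4)]] by metis
  obtain ym where ym: "ym \<in> A" "\<And>y. y \<in> A \<Longrightarrow> w ym \<le> w y"
    using continuous_attains_inf[OF A(1) _ cA[OF cw(6)]] y0A by blast
  obtain yM where yM: "yM \<in> A" "\<And>y. y \<in> A \<Longrightarrow> w y \<le> w yM"
    using continuous_attains_sup[OF A(1) _ cA[OF cw(6)]] y0A by blast
  have "continuous_on A (\<lambda>y. norm (p y + q y))" by (intro continuous_intros cA cw cv)
  then obtain yq where yq: "yq \<in> A" "\<And>y. y \<in> A \<Longrightarrow> norm (p y + q y) \<le> norm (p yq + q yq)"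
    using continuous_attains_sup[OF A(1)] y0A by blast
  define w0 where "w0 = w ym"
  define w1 where "w1 = w yM"
  define M2 where "M2 = norm (p yq + q yq)"
  have w0: "0 < w0" using W ym A(2) by (auto simp: w0_def solution_on_def)
  have w1: "0 < w1" using W yM A(2) by (auto simp: w1_def solution_on_def)
  have M2: "0 \<le> M2" by (simp add: M2_def)
  \<comment> \<open>Solves (N - 1) w0 R^2 l = C (2 w1 + M1 + R M2), so that N^2 w0 R^2 l exceeds a1
    C, which is at most linear in N once M1 is replaced by N M1.\<close>
  define N where "N = 1 + C * (2 * w1 + M1 + R * M2) / (w0 * R\<^sup>2 * l)"
  define a1 where "a1 = 2 * N * w1 + M1 + N * R * M2"
  define b1 where "b1 = N\<^sup>2 * w0 * R\<^sup>2"
  have N: "1 \<le> N" using l w0 w1 M1 M2 R by (auto simp: N_def intro!: divide_nonneg_pos mult_nonneg_nonneg add_nonneg_nonneg)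
  have a1: "0 \<le> a1" using N w1 M1 M2 R by (auto simp: a1_def intro!: add_nonneg_nonneg mult_nonneg_nonneg)
  have b1: "0 < b1" using N w0 R by (auto simp: b1_def intro!: mult_pos_pos)
  have key: "a1 * C < b1 * l"
  proof -
    have "M1 * 1 \<le> M1 * N" using N M1 by (intro mult_left_mono) auto
    then have "a1 \<le> N * (2 * w1 + M1 + R * M2)"
      unfolding a1_def by (simp add: algebra_simps)
    then have "a1 * C \<le> N * (2 * w1 + M1 + R * M2) * C" using l by (intro mult_right_mono) auto
    also have "\<dots> = N * (C * (2 * w1 + M1 + R * M2))" by simp
    also have "C * (2 * w1 + M1 + R * M2) = (N - 1) * (w0 * R\<^sup>2 * l)"
      using l w0 R by (simp add: N_def)
    also have "N * ((N - 1) * (w0 * R\<^sup>2 * l)) < N * (N * (w0 * R\<^sup>2 * l))"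
      using N l w0 R by (intro mult_strict_left_mono mult_strict_right_mono mult_pos_pos) auto
    finally show ?thesis by (simp add: b1_def power2_eq_square algebra_simps)
  qed
  have "continuous_on (sphere c (R / 2)) (\<lambda>y. V y - w y)"
    using R by (intro continuous_intros continuous_on_subset[OF cv(6)] continuous_on_subset[OF cw(6)]) auto
  moreover have "sphere c (R / 2) \<noteq> {}" using R by simp
  ultimately obtain ye where ye: "ye \<in> sphere c (R / 2)"
    "\<And>y. y \<in> sphere c (R / 2) \<Longrightarrow> V ye - w ye \<le> V y - w y"
    using continuous_attains_inf[OF compact_sphere, of c "R / 2" "\<lambda>y. V y - w y"] by blast
  define eta where "eta = V ye - w ye"
  have eta: "0 < eta" using less[of ye] ye R by (simp add: eta_def)
  \<comment> \<open>\<open>eta\<close> keeps G nonnegative on the inner sphere, where E <= 1; the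
    other two bounds bring the perturbation sizes into the interval [0, 1] of the ellipticity
    estimate.\<close>
  define m where "m = min eta (min (1 / (a1 + 1)) (1 / b1))"
  have m: "0 < m" "m \<le> eta" "m * a1 \<le> 1" "m * b1 \<le> 1"
  proof -
    show "0 < m" using eta a1 b1 by (simp add: m_def)
    show "m \<le> eta" by (simp add: m_def)
    have "m * a1 \<le> 1 / (a1 + 1) * a1" using a1 by (intro mult_right_mono) (auto simp: m_def)
    also have "\<dots> \<le> 1" using a1 by simp
    finally show "m * a1 \<le> 1" .
    have "m * b1 \<le> 1 / b1 * b1" using b1 by (intro mult_right_mono) (auto simp: m_def)
    then show "m * b1 \<le> 1" using b1 by simp
  qed
  define E where "E y = exp (- N * ((y - c) \<bullet> (y - c)))" for y
  \<comment> \<open>The value of the Gaussian on the outer sphere, so that the barrier vanishes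
    there.\<close>
  define e where "e = exp (- N * R\<^sup>2)"
  define G where "G y = (V y - w y) - (m * E y - m * e)" for y
  have E: "0 < E y" "E y \<le> 1" for y using N by (auto simp: E_def)
  have e: "0 < e" by (simp add: e_def)
  have EeR: "E y = e" if "dist c y = R" for y
    using that by (simp add: E_def e_def dist_norm norm_minus_commute dot_square_norm)
  have jG: "jet_on S G (\<lambda>y. (q y - p y) - (m *\<^sub>R ((- N * E y) *\<^sub>R (2 *\<^sub>R (y - c))) - 0))
     (\<lambda>y. (Y y - X y) - (m *\<^sub>R ((- N * E y) *\<^sub>R (2 *\<^sub>R mat 1) + (N\<^sup>2 * E y) *\<^sub>R outer (2 *\<^sub>R (y - c))) - 0))"
    unfolding G_def E_def
    by (intro jet_on_diff[OF jet_on_diff[OF jv jw]] jet_on_subset[OF _ cw(1) subset_UNIV]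
      jet_on_diff[OF jet_on_scale[OF jet_on_gaussian] jet_on_const])
  have Gpos: "0 \<le> G y" if "y \<in> A" for y
  proof (rule ccontr)
    assume "\<not> 0 \<le> G y"
    obtain y1 where y1: "y1 \<in> A" "\<And>y. y \<in> A \<Longrightarrow> G y1 \<le> G y"
      using continuous_attains_inf[OF A(1) _ cA[OF jet_onD(6)[OF jG]]] y0A by blast
    have G1: "G y1 < 0" using y1(2)[OF that] \<open>\<not> 0 \<le> G y\<close> by simp
    have dR: "dist c y1 \<le> R" "R / 2 \<le> dist c y1" using y1(1) by (auto simp: A_def)
    have "dist c y1 \<noteq> R"
      using G1 EeR[of y1] le[of y1] by (auto simp: G_def)
    moreover have "dist c y1 \<noteq> R / 2"
    proof
      assume "dist c y1 = R / 2"
      then have "m \<le> V y1 - w y1" using ye(2)[of y1] m(2) by (simp add: eta_def)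
      moreover have "m * E y1 \<le> m * 1" using E m by (intro mult_left_mono) auto
      ultimately show False using G1 mult_pos_pos[OF m(1) e] unfolding G_def by linarith
    qed
    ultimately have y1U: "y1 \<in> ball c R - cball c (R / 2)" using dR by auto
    have "\<forall>\<^sub>F z in nhds y1. G y1 \<le> G z"
      using eventually_nhds_in_open[OF _ y1U]
      by (rule eventually_mono) (use y1(2) in \<open>auto simp: A_def open_Diff\<close>)
    moreover have "y1 \<in> S" using y1(1) A(2) by auto
    ultimately have g0: "(q y1 - p y1) - (m *\<^sub>R ((- N * E y1) *\<^sub>R (2 *\<^sub>R (y1 - c))) - 0) = 0"
      and h0: "\<And>v. 0 \<le> v \<bullet> (((Y y1 - X y1) - (m *\<^sub>R ((- N * E y1) *\<^sub>R (2 *\<^sub>R mat 1)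
        + (N\<^sup>2 * E y1) *\<^sub>R outer (2 *\<^sub>R (y1 - c))) - 0)) *v v)"
      using jet_on_local_min[OF jG] by blast+
    define v where "v = (1 / norm (y1 - c)) *\<^sub>R (y1 - c)"
    have nz: "norm (y1 - c) \<noteq> 0" using dR R by (auto simp: dist_norm)
    have v: "norm v = 1" "y1 - c = norm (y1 - c) *\<^sub>R v" using nz by (auto simp: v_def)
    let ?a = "m * E y1 * a1" and ?b = "m * E y1 * b1"
    let ?B = "amat (V y1) (q y1) (Y y1)" and ?W = "amat (w y1) (p y1) (X y1)"
    let ?D = "?B - ?b *\<^sub>R outer v + ?a *\<^sub>R mat 1"
    have W1: "?W \<in> mat_cone k" "sigma_mat k ?W = 1" "sigma_mat k ?B = 1" "?B \<in> mat_cone k"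
      using W V \<open>y1 \<in> S\<close> by (auto simp: solution_on_def)
    have dom: "x \<bullet> (?W *v x) \<le> x \<bullet> (?D *v x)" for x
      unfolding a1_def b1_def
    proof (rule amat_barrier_psd[where z = "y1 - c" and R = R])
      show "q y1 - p y1 = m *\<^sub>R ((- N * E y1) *\<^sub>R (2 *\<^sub>R (y1 - c)))"
        using g0 by (simp only: diff_zero right_minus_eq)
      show "m * (x \<bullet> (((- N * E y1) *\<^sub>R (2 *\<^sub>R mat 1) + (N\<^sup>2 * E y1) *\<^sub>R outer (2 *\<^sub>R (y1 - c))) *v x))
          \<le> x \<bullet> (Y y1 *v x) - x \<bullet> (X y1 *v x)"
        using h0[of x] by (simp only: diff_zero matrix_vector_mult_diff_rdistrib scaleR_matrix_vector_assoc[symmetric]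
          inner_diff_right inner_scaleR_right)
      show "R / 2 \<le> norm (y1 - c)" "norm (y1 - c) \<le> R" using dR by (auto simp: dist_norm norm_minus_commute)
      show "y1 - c = norm (y1 - c) *\<^sub>R v" by (rule v)
      show "w0 \<le> w y1" "w y1 \<le> w1" using ym yM y1(1) by (auto simp: w0_def w1_def)
      have "0 \<le> m * e" using m e by simp
      then show "V y1 - w y1 \<le> m * E y1" using G1 by (simp add: G_def)
      show "w y1 \<le> V y1" using le dR by auto
      show "\<bar>x \<bullet> (Y y1 *v x)\<bar> \<le> M1 * (x \<bullet> x)" using M1(2) y1(1) by blast
      show "norm (p y1 + q y1) \<le> M2" using yq(2) y1(1) by (simp add: M2_def)
    qed (use m N E R w0 in auto)
    have WD: "?W + (?D - ?W) = ?D" by (rule trans[OF add.commute diff_add_cancel])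
    have "sigma_mat k ?W \<le> sigma_mat k (?W + (?D - ?W))"
    proof (rule mat_cone_add_psd(2)[OF W1(1) _ _ k])
      show "transpose (?D - ?W) = ?D - ?W"
        using W1(1,4) by (simp add: mat_cone_def transpose_diff transpose_add transpose_scaleR)
      show "0 \<le> x \<bullet> ((?D - ?W) *v x)" for x
        using dom[of x] by (simp only: matrix_vector_mult_diff_rdistrib inner_diff_right)
    qed
    then have "1 \<le> sigma_mat k ?D" unfolding WD W1(2) .
    also have "\<dots> \<le> sigma_mat k ?B - ?b * l + ?a * C"
    proof (rule l(3))
      show "?B \<in> K" using y1(1) by (simp add: K_def)
      have "E y1 * (m * a1) \<le> 1 * 1" "E y1 * (m * b1) \<le> 1 * 1"
        using m E a1 b1 by (intro mult_mono; simp add: less_imp_le)+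
      then show "?a \<le> 1" "?b \<le> 1" by (simp_all add: mult_ac)
      show "0 \<le> ?a" "0 \<le> ?b" using m E a1 b1 by (auto simp: less_imp_le)
    qed (rule v)
    also have "\<dots> = 1 + (m * E y1) * (a1 * C - b1 * l)" using W1 by (simp add: algebra_simps)
    also have "\<dots> < 1" using key m E by (simp add: mult_pos_neg)
    finally show False by simp
  qed
  define r where "r = ((q y0 - p y0) - m *\<^sub>R ((- N * E y0) *\<^sub>R (2 *\<^sub>R (y0 - c)))) \<bullet> (c - y0)"
  have G0: "G y0 = 0" using y0 EeR[of y0] by (simp add: G_def)
  have d: "((\<lambda>t. G (y0 + t *\<^sub>R (c - y0))) has_real_derivative r) (at 0)"
    using DERIV_line[of G _ y0 0 "c - y0"] jet_onD(2)[OF jG, of y0] y0A A(2) by (auto simp: r_def)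
  have "0 \<le> r"
  proof (rule ccontr)
    assume "\<not> 0 \<le> r"
    then obtain s where s: "0 < s" "\<And>h. 0 < h \<Longrightarrow> h < s \<Longrightarrow> G (y0 + h *\<^sub>R (c - y0)) < 0"
      using DERIV_neg_dec_right[OF d] G0 by auto
    \<comment> \<open>Up to half the way to the centre the segment from \<open>y0\<close> stays in
      the annulus.\<close>
    define h where "h = min (s / 2) (1 / 2)"
    have h: "0 < h" "h < s" "h \<le> 1 / 2" using s by (auto simp: h_def)
    have "c - (y0 + h *\<^sub>R (c - y0)) = (1 - h) *\<^sub>R (c - y0)" by (simp add: algebra_simps)
    then have "dist c (y0 + h *\<^sub>R (c - y0)) = (1 - h) * R"
      using h y0 by (simp add: dist_norm)
    moreover have "(1 - h) * R \<le> 1 * R" "1 / 2 * R \<le> (1 - h) * R"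
      using h R by (auto intro!: mult_right_mono simp del: mult_le_cancel_right)
    ultimately have "y0 + h *\<^sub>R (c - y0) \<in> A" by (auto simp: A_def)
    then show False using Gpos s(2)[OF h(1,2)] by fastforce
  qed
  moreover have "r = (q y0 - p y0) \<bullet> (c - y0) - 2 * m * N * E y0 * R\<^sup>2"
  proof -
    have z: "(y0 - c) \<bullet> (c - y0) = - R\<^sup>2"
      using y0(1) by (metis dist_norm dot_square_norm inner_minus_left minus_diff_eq)
    show ?thesis unfolding r_def inner_diff_left[of "q y0 - p y0"] inner_scaleR_left z by simp
  qed
  moreover have "0 < 2 * m * N * E y0 * R\<^sup>2" using m N E R by simp
  ultimately show ?thesis by linarith
qed

text \<open>Openness of the contact set: the largest open ball about a nearby noncontact point
  \<open>c\<close> that contains no contact point touches the set at \<open>y1\<close>. Hopf's lemma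
  gives a positive derivative there, whereas \<open>y1\<close> is a minimum of V - w with vanishing
  gradient.\<close>

lemma strong_maximum_principle:
  fixes w V :: "real^'n \<Rightarrow> real"
  assumes k: "1 \<le> k" and W: "solution_on k S w p X" and V: "solution_on k S V q Y"
    and S: "connected S" and le: "\<And>y. y \<in> S \<Longrightarrow> w y \<le> V y"
    and y: "y \<in> S" "w y = V y" and x: "x \<in> S"
  shows "w x = V x"
proof -
  have jw: "jet_on S w p X" and jv: "jet_on S V q Y" using W V by (auto simp: solution_on_def)
  note oS = jet_onD(1)[OF jw]
  define Z where "Z = {y \<in> S. V y - w y = 0}"
  have cont: "continuous_on S (\<lambda>y. V y - w y)"
    by (intro continuous_intros jet_onD(6)[OF jw] jet_onD(6)[OF jv])
  have "open Z"
    unfolding open_contains_ball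
  proof
    fix y0 assume y0: "y0 \<in> Z"
    then obtain d where d: "0 < d" "cball y0 d \<subseteq> S"
      using oS by (auto simp: Z_def open_contains_cball)
    have "ball y0 (d / 2) \<subseteq> Z"
    proof (rule ccontr)
      assume "\<not> ?thesis"
      then obtain c where "c \<in> ball y0 (d / 2)" "c \<notin> Z" by blast
      then have c: "dist y0 c < d / 2" "c \<notin> Z" by auto
      have "closed {y \<in> cball y0 d. V y - w y = 0}"
        by (rule continuous_closed_preimage_constant[OF continuous_on_subset[OF cont d(2)] closed_cball])
      moreover have "y0 \<in> {y \<in> cball y0 d. V y - w y = 0}" using y0 d by (auto simp: Z_def)
      ultimately obtain y1 where y1: "y1 \<in> {y \<in> cball y0 d. V y - w y = 0}"
        "\<And>y. y \<in> {y \<in> cball y0 d. V y - w y = 0} \<Longrightarrow> dist c y1 \<le> dist c y"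
        using distance_attains_inf[of "{y \<in> cball y0 d. V y - w y = 0}" c] by blast
      define R where "R = dist c y1"
      have "R \<le> dist c y0" unfolding R_def using y1(2)[of y0] y0 d by (auto simp: Z_def)
      then have Rd: "R < d / 2" using c(1) by (simp add: dist_commute)
      have y1S: "y1 \<in> S" "w y1 = V y1" using y1(1) d(2) by auto
      then have "c \<noteq> y1" using c(2) by (auto simp: Z_def)
      then have R0: "0 < R" by (simp add: R_def)
      have sub: "cball c R \<subseteq> cball y0 d"
      proof
        fix y assume "y \<in> cball c R"
        then show "y \<in> cball y0 d" using dist_triangle[of y0 y c] c(1) Rd by simp
      qed
      have "0 < (q y1 - p y1) \<bullet> (c - y1)"
      proof (rule hopf_boundary_derivative[OF k W V R0])
        show "cball c R \<subseteq> S" using sub d(2) by blast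
        show "w y \<le> V y" if "y \<in> cball c R" for y using that sub d(2) le by blast
        show "w y < V y" if "y \<in> ball c R" for y
        proof -
          have "y \<in> cball y0 d" using that sub ball_subset_cball by blast
          moreover have "\<not> dist c y1 \<le> dist c y" using that by (simp add: R_def)
          ultimately have "V y - w y \<noteq> 0" using y1(2) by auto
          then show ?thesis using le[of y] \<open>y \<in> cball y0 d\<close> d(2) by force
        qed
      qed (use y1S R_def in auto)
      moreover have "\<forall>\<^sub>F z in nhds y1. V y1 - w y1 \<le> V z - w z"
        using eventually_nhds_in_open[OF oS y1S(1)] by (rule eventually_mono) (use le y1S in auto)
      then have "q y1 - p y1 = 0" by (rule jet_on_local_min(1)[OF jet_on_diff[OF jv jw] y1S(1)])
      ultimately show False by simp
    qed
    then show "\<exists>e>0. ball y0 e \<subseteq> Z" using d(1) by (intro exI[of _ "d / 2"]) auto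
  qed
  then have "openin (top_of_set S) Z" by (auto simp: Z_def intro: open_subset)
  moreover have "closedin (top_of_set S) Z"
    unfolding Z_def by (rule continuous_closedin_preimage_constant[OF cont])
  moreover have "y \<in> Z" using y by (simp add: Z_def)
  ultimately have "Z = S" using S unfolding connected_clopen by blast
  then have "x \<in> Z" using x by simp
  then show ?thesis by (simp add: Z_def)
qed

section \<open>Superharmonicity at an isolated singularity\<close>

lemma trace_outer: "trace (outer v) = v \<bullet> v"
  by (simp add: trace_def outer_def inner_vec_def)

lemma trace_scaleR: "trace (c *\<^sub>R A) = c * trace (A :: real^'n^'n)"
  by (simp add: trace_def sum_distrib_left)

lemma trace_amat:
  "trace (amat w p X) = w * trace X - real CARD('n) / 2 * (p \<bullet> p)" for p :: "real^'n"
  by (simp add: amat_def trace_sub trace_scaleR trace_I)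

lemma trace_nonneg_of_psd:
  assumes "\<And>v. 0 \<le> v \<bullet> (A *v v)"
  shows "0 \<le> trace (A :: real^'n^'n)"
proof -
  have "A $ i $ i = axis i 1 \<bullet> (A *v axis i 1)" for i
    by (simp add: matrix_vector_mult_basis column_def inner_axis')
  then show ?thesis unfolding trace_def using assms by (simp add: sum_nonneg)
qed

text \<open>For this \<open>r\<close> the power w^r is u, and r - 1 = -n/2 matches the coefficient
  of |p|^2 in \<open>trace_amat\<close>. As r < 0, sigma_1 > 0 says that u is superharmonic.\<close>

lemma trace_hess_powr:
  fixes p :: "real^'n" and f :: real
  assumes "0 < f" and r: "r = - ((real CARD('n) - 2) / 2)"
  shows "trace ((r * f powr (r - 1)) *\<^sub>R X + (r * ((r - 1) * f powr (r - 2))) *\<^sub>R outer p)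
    = r * f powr (r - 2) * trace (amat f p X)"
proof -
  have t: "trace ((r * f powr (r - 1)) *\<^sub>R X + (r * ((r - 1) * f powr (r - 2))) *\<^sub>R outer p)
      = r * f powr (r - 1) * trace X + r * ((r - 1) * f powr (r - 2)) * (p \<bullet> p)"
    by (simp only: trace_add trace_scaleR trace_outer)
  have e1: "f powr (r - 1) = f powr (r - 2) * f"
    using assms(1) powr_mult_base[of f "r - 2"] by (simp add: mult.commute)
  have e2: "r - 1 = - (real CARD('n) / 2)" by (simp add: r field_simps)
  show ?thesis unfolding t unfolding e1 trace_amat unfolding e2 by (simp add: algebra_simps)
qed

context
  fixes r :: real
  assumes card: "3 \<le> CARD('n::finite)" and r_def: "r = - ((real CARD('n) - 2) / 2)"
begin

lemma exponent_neg: "r < 0" using card by (simp add: r_def)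

lemma solution_trace_neg:
  fixes w :: "real^'n \<Rightarrow> real"
  assumes W: "solution_on k S w p X" and k: "1 \<le> k" and y: "y \<in> S"
  shows "trace ((r * w y powr (r - 1)) *\<^sub>R X y + (r * ((r - 1) * w y powr (r - 2))) *\<^sub>R outer (p y)) < 0"
proof -
  have w: "0 < w y" using W y by (auto simp: solution_on_def)
  have "0 < trace (amat (w y) (p y) (X y))"
    using W y k by (auto simp: solution_on_def mat_cone_def simp flip: sigma_mat_1)
  then show ?thesis
    unfolding trace_hess_powr[OF w r_def] using exponent_neg w by (simp add: mult_neg_pos)
qed

text \<open>The function is |y|^(2 - n). Its harmonicity is the same trace identity with w = |y|^2,
  for which the two parts of \<open>amat\<close> cancel.\<close>

lemma jet_on_fundamental_solution:
  obtains q Y where "jet_on (- {0 :: real^'n}) (\<lambda>y. (y \<bullet> y) powr r) q Y"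
    "\<And>y. y \<noteq> 0 \<Longrightarrow> trace (Y y) = 0"
proof -
  have j: "jet_on (- {0 :: real^'n}) (\<lambda>y. y \<bullet> y) (\<lambda>y. 2 *\<^sub>R y) (\<lambda>y. 2 *\<^sub>R mat 1)"
    using jet_on_subset[OF jet_on_inner_square[of 0], of "- {0}"] by auto
  have pos: "\<And>y. y \<in> - {0 :: real^'n} \<Longrightarrow> 0 < y \<bullet> y" by auto
  show thesis
  proof (rule that[OF jet_on_powr[OF j pos, of r]])
    fix y :: "real^'n" assume "y \<noteq> 0"
    then have y: "0 < y \<bullet> y" by simp
    have "trace (amat (y \<bullet> y) (2 *\<^sub>R y) (2 *\<^sub>R mat 1)) = 0"
      by (simp add: trace_amat trace_scaleR trace_I)
    then show "trace ((r * (y \<bullet> y) powr (r - 1)) *\<^sub>R (2 *\<^sub>R mat 1)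
        + (r * ((r - 1) * (y \<bullet> y) powr (r - 2))) *\<^sub>R outer (2 *\<^sub>R y)) = 0"
      unfolding trace_hess_powr[OF y r_def] by simp
  qed
qed

text \<open>A small multiple of the fundamental solution blows up at 0 and so outweighs the lower
  bound -B there. A negative minimum is then attained on a compact annulus, where the strict trace
  condition excludes it.\<close>

lemma punctured_minimum_principle:
  fixes f :: "real^'n \<Rightarrow> real"
  assumes f: "jet_on (- {0}) f p X" and R: "0 < R"
    and tr: "\<And>y. y \<in> ball 0 R - {0} \<Longrightarrow> trace (X y) < 0"
    and bd: "\<And>y. y \<in> sphere 0 R \<Longrightarrow> 0 \<le> f y"
    and B: "\<And>y. y \<in> cball 0 R - {0} \<Longrightarrow> - B \<le> f y"
    and z: "z \<in> cball 0 R - {0}"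
  shows "0 \<le> f z"
proof (rule ccontr)
  assume "\<not> 0 \<le> f z"
  then have fz: "f z < 0" by simp
  obtain q Y where Y: "jet_on (- {0 :: real^'n}) (\<lambda>y. (y \<bullet> y) powr r) q Y"
    "\<And>y. y \<noteq> 0 \<Longrightarrow> trace (Y y) = 0" using jet_on_fundamental_solution by blast
  have zz: "0 < z \<bullet> z" using z by simp
  \<comment> \<open>Half of what would bring \<open>f z\<close> up to 0, so that F z = f z / 2
    remains negative.\<close>
  define e where "e = - f z / (2 * (z \<bullet> z) powr r)"
  have e: "0 < e" using fz zz by (simp add: e_def divide_neg_pos)
  define F where "F y = f y + e * (y \<bullet> y) powr r" for y
  have Fz: "F z < 0" using fz zz by (simp add: F_def e_def)
  \<comment> \<open>Squared radius at which the added term equals |B| + 1; that term is larger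
    nearer the origin because r < 0.\<close>
  define t where "t = ((\<bar>B\<bar> + 1) / e) powr (1 / r)"
  have t: "0 < t" using e by (simp add: t_def add_nonneg_pos)
  have tr': "e * t powr r = \<bar>B\<bar> + 1" using e exponent_neg by (simp add: t_def powr_powr)
  have Fpos: "0 < F y" if "y \<in> cball 0 R - {0}" "y \<bullet> y \<le> t" for y
  proof -
    have "t powr r \<le> (y \<bullet> y) powr r" using that exponent_neg by (intro powr_mono2') auto
    then have "\<bar>B\<bar> + 1 \<le> e * (y \<bullet> y) powr r" using e tr' by (metis mult_left_mono less_imp_le)
    then show ?thesis using B[OF that(1)] by (simp add: F_def)
  qed
  define s where "s = sqrt t"
  have s: "0 < s" "s\<^sup>2 = t" using t by (auto simp: s_def)
  have ss: "y \<bullet> y \<le> t \<longleftrightarrow> norm y \<le> s" for y :: "real^'n"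
    unfolding s(2)[symmetric] power2_norm_eq_inner[symmetric] using s(1)
    by (simp add: abs_le_square_iff[symmetric])
  define C where "C = cball (0 :: real^'n) R - ball 0 s"
  have C: "compact C" "C \<subseteq> - {0}" using s by (auto simp: C_def compact_diff)
  have jF: "jet_on (- {0}) F (\<lambda>y. p y + e *\<^sub>R q y) (\<lambda>y. X y + e *\<^sub>R Y y)"
    unfolding F_def by (rule jet_on_add[OF f jet_on_scale[OF Y(1)]])
  have "z \<in> C" using z Fpos[of z] Fz ss[of z] by (auto simp: C_def)
  then obtain y1 where y1: "y1 \<in> C" "\<And>y. y \<in> C \<Longrightarrow> F y1 \<le> F y"
    using continuous_attains_inf[OF C(1) _ continuous_on_subset[OF jet_onD(6)[OF jF] C(2)]] by blast
  have F1: "F y1 < 0" using y1(2)[OF \<open>z \<in> C\<close>] Fz by simp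
  have y1': "y1 \<in> cball 0 R - {0}" using y1(1) C(2) by (auto simp: C_def)
  have "norm y1 \<noteq> R"
  proof
    assume "norm y1 = R"
    then have "0 \<le> f y1" using bd by simp
    then show False using F1 e by (simp add: F_def) (smt (verit) mult_nonneg_nonneg powr_ge_zero)
  qed
  moreover have "s < norm y1" using Fpos[OF y1'] F1 ss[of y1] by auto
  ultimately have y1U: "y1 \<in> ball 0 R - cball 0 s" using y1' by auto
  have "\<forall>\<^sub>F z in nhds y1. F y1 \<le> F z"
    using eventually_nhds_in_open[OF _ y1U]
    by (rule eventually_mono) (use y1(2) in \<open>auto simp: C_def open_Diff\<close>)
  then have "0 \<le> trace (X y1 + e *\<^sub>R Y y1)"
    using jet_on_local_min(2)[OF jF] y1' by (intro trace_nonneg_of_psd) auto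
  moreover have "trace (X y1 + e *\<^sub>R Y y1) < 0"
    using tr[of y1] Y(2)[of y1] y1' y1U by (simp add: trace_add trace_scaleR)
  ultimately show False by simp
qed

section \<open>Behaviour of solutions at infinity\<close>

lemma inversion_inversion:
  assumes "y \<noteq> x" "L \<noteq> 0"
  shows "inversion x L (inversion x L y) = y"
proof -
  define z where "z = y - x"
  have z: "z \<bullet> z \<noteq> 0" "y = x + z" using assms by (auto simp: z_def)
  show ?thesis using z assms(2) by (simp add: inversion_def power2_eq_square)
qed

text \<open>The inverted u is superharmonic and positive on the punctured ball, hence at least its
  minimum over the unit sphere. For the inverted \<open>w\<close>, a negative power of it, this is
  an upper bound near the origin.\<close>

lemma solution_growth:
  fixes w :: "real^'n \<Rightarrow> real"
  assumes W: "solution_on k UNIV w p X" and k: "1 \<le> k"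
  obtains C where "0 < C" "\<And>y. 1 \<le> norm y \<Longrightarrow> w y \<le> C * (y \<bullet> y)"
proof -
  let ?W = "kelvin w 0 1" and ?P = "kelvin_grad w p 0 1" and ?X = "kelvin_hess w p X 0 1"
  have sW: "solution_on k (- {0}) ?W ?P ?X" using W by (rule solution_on_kelvin) simp
  have jW: "jet_on (- {0}) ?W ?P ?X" and pW: "\<And>y. y \<in> - {0} \<Longrightarrow> 0 < ?W y"
    using sW by (auto simp: solution_on_def)
  note jU = jet_on_powr[OF jW pW, of r]
  have "continuous_on (sphere 0 1) (\<lambda>y. ?W y powr r)"
    by (rule continuous_on_subset[OF jet_onD(6)[OF jU]]) auto
  moreover have "sphere (0 :: real^'n) 1 \<noteq> {}" by simp
  ultimately obtain y1 where y1: "y1 \<in> sphere 0 1" "\<And>y. y \<in> sphere 0 1 \<Longrightarrow> ?W y1 powr r \<le> ?W y powr r"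
    using continuous_attains_inf[OF compact_sphere, of 0 1 "\<lambda>y. ?W y powr r"] by blast
  define c where "c = ?W y1 powr r"
  have "y1 \<noteq> 0" using y1(1) by auto
  then have c: "0 < c" using pW[of y1] by (auto simp: c_def)
  have jf: "jet_on (- {0}) (\<lambda>y. ?W y powr r - c) (\<lambda>y. (r * ?W y powr (r - 1)) *\<^sub>R ?P y - 0)
    (\<lambda>y. (r * ?W y powr (r - 1)) *\<^sub>R ?X y + (r * ((r - 1) * ?W y powr (r - 2))) *\<^sub>R outer (?P y) - 0)"
    by (intro jet_on_diff[OF jU] jet_on_subset[OF jet_on_const]) auto
  have "c \<le> ?W z powr r" if "z \<in> cball 0 1 - {0}" for z
  proof -
    have "0 \<le> ?W z powr r - c"
    proof (rule punctured_minimum_principle[OF jf, of 1 c])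
      show "trace ((r * ?W y powr (r - 1)) *\<^sub>R ?X y + (r * ((r - 1) * ?W y powr (r - 2))) *\<^sub>R outer (?P y) - 0) < 0"
        if "y \<in> ball 0 1 - {0}" for y
        using solution_trace_neg[OF sW k, of y] that by simp
    qed (use y1 that in \<open>auto simp: c_def\<close>)
    then show ?thesis by simp
  qed
  then have bound: "?W z \<le> c powr (1 / r)" if "z \<in> cball 0 1 - {0}" for z
  proof -
    have "(?W z powr r) powr (1 / r) \<le> c powr (1 / r)"
      using \<open>\<And>z. z \<in> cball 0 1 - {0} \<Longrightarrow> c \<le> ?W z powr r\<close>[OF that] c exponent_neg by (intro powr_mono2') auto
    then show ?thesis using pW[of z] that exponent_neg by (simp add: powr_powr)
  qed
  show thesis
  proof (rule that)
    show "0 < c powr (1 / r)" using c by simp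
    fix y :: "real^'n" assume y: "1 \<le> norm y"
    then have y0: "y \<noteq> 0" by auto
    define z where "z = inversion 0 1 y"
    have zy: "z = (1 / (y \<bullet> y)) *\<^sub>R y" by (simp add: z_def inversion_def)
    have nz: "norm z = 1 / norm y" using y0 by (simp add: zy dot_square_norm power2_eq_square)
    then have "z \<in> cball 0 1 - {0}" using y y0 by (auto simp: zy)
    then have "?W z \<le> c powr (1 / r)" by (rule bound)
    moreover have "?W z = (z \<bullet> z) * w y"
      using inversion_inversion[OF y0, of 1] by (simp add: kelvin_def z_def)
    moreover have "z \<bullet> z = 1 / (y \<bullet> y)" using y0 by (simp add: zy)
    ultimately show "w y \<le> c powr (1 / r) * (y \<bullet> y)" using y0 by (simp add: field_simps)
  qed
qed

text \<open>Two functions touching \<open>W\<close> from above at an isolated singularity, at the level of its upper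
  limit, have the same gradient there: otherwise the maximum of their \<open>r\<close>-th powers lies, on a
  small sphere, above a harmonic function whose value at the centre is too large.\<close>
lemma touching_gradients_eq:
  fixes W :: "real^'n \<Rightarrow> real"
  assumes W: "solution_on k (- {0}) W P X" and k: "1 \<le> k" and a: "0 < a"
    and v1: "(v1 has_derivative (\<lambda>h. g1 \<bullet> h)) (at 0)" "v1 0 = a"
    and v2: "(v2 has_derivative (\<lambda>h. g2 \<bullet> h)) (at 0)" "v2 0 = a"
    and rho: "0 < rho" "\<And>z. 0 < norm z \<Longrightarrow> norm z < rho \<Longrightarrow> W z \<le> v1 z \<and> W z \<le> v2 z"
    and limsup: "\<And>e d. 0 < e \<Longrightarrow> 0 < d \<Longrightarrow> \<exists>z. 0 < norm z \<and> norm z < d \<and> a - e < W z"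
  shows "g1 = g2"
proof (rule ccontr)
  assume "g1 \<noteq> g2"
  have jW: "jet_on (- {0}) W P X" and pW: "\<And>y. y \<in> - {0} \<Longrightarrow> 0 < W y"
    using W by (auto simp: solution_on_def)
  define b where "b = a powr r"
  define c where "c = r * a powr (r - 1)"
  have c: "c \<noteq> 0" using a exponent_neg by (simp add: c_def)
  define G1 where "G1 = c *\<^sub>R g1"
  define G2 where "G2 = c *\<^sub>R g2"
  have G: "G1 \<noteq> G2" using \<open>g1 \<noteq> g2\<close> c by (simp add: G1_def G2_def)
  \<comment> \<open>At first order the larger of the two r-th powers is b + M . z + d |e . z|:
    \<open>M\<close> is the mean of their gradients and 2 d e the difference.\<close>
  define d where "d = norm (G1 - G2) / 2"
  define e where "e = (1 / norm (G1 - G2)) *\<^sub>R (G1 - G2)"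
  define M where "M = (1 / 2) *\<^sub>R (G1 + G2)"
  have d: "0 < d" using G by (simp add: d_def)
  have ee: "e \<bullet> e = 1" using G by (simp add: e_def dot_square_norm power2_eq_square)
  have de: "d *\<^sub>R e = (1 / 2) *\<^sub>R (G1 - G2)" using G by (simp add: d_def e_def)
  have G12: "G1 = M + d *\<^sub>R e" "G2 = M - d *\<^sub>R e"
    unfolding de M_def by (simp_all add: vec_eq_iff field_simps)
  define n where "n = real CARD('n)"
  have n: "3 \<le> n" using card by (simp add: n_def)
  \<comment> \<open>Chosen so that k0 - b = d R / n - eta R = d R / (2 n) is positive.\<close>
  define eta where "eta = d / (2 * n)"
  have eta: "0 < eta" using d n by (simp add: eta_def)
  have expand: "\<exists>s>0. \<forall>z. norm z < s \<longrightarrow> b + (c *\<^sub>R g) \<bullet> z - eta * norm z \<le> v z powr r"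
    if v: "(v has_derivative (\<lambda>h. g \<bullet> h)) (at 0)" "v 0 = a" for v :: "real^'n \<Rightarrow> real" and g
  proof -
    have "((\<lambda>t. t powr r) has_derivative (\<lambda>h. c * h)) (at (v 0))"
      using has_real_derivative_powr[OF a, of r] v(2) by (simp add: has_field_derivative_def c_def)
    from has_derivative_compose[OF v(1) this]
    have "((\<lambda>z. v z powr r) has_derivative (\<lambda>h. c * (g \<bullet> h))) (at 0)" .
    then obtain s where "0 < s" "\<And>z. norm z < s \<Longrightarrow> norm (v z powr r - v 0 powr r - c * (g \<bullet> z)) \<le> eta * norm z"
      unfolding has_derivative_at_alt using eta by force
    then show ?thesis using v(2) by (intro exI[of _ s]) (force simp: b_def)
  qed
  obtain s1 where s1: "0 < s1" "\<And>z. norm z < s1 \<Longrightarrow> b + G1 \<bullet> z - eta * norm z \<le> v1 z powr r"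
    using expand[OF v1] unfolding G1_def by blast
  obtain s2 where s2: "0 < s2" "\<And>z. norm z < s2 \<Longrightarrow> b + G2 \<bullet> z - eta * norm z \<le> v2 z powr r"
    using expand[OF v2] unfolding G2_def by blast
  define R where "R = min (min s1 s2) rho / 2"
  have R: "0 < R" "R < s1" "R < s2" "R < rho" using s1 s2 rho by (auto simp: R_def)
  define k0 where "k0 = b + d * R / n - eta * R"
  \<comment> \<open>The quadratic part is trace free because \<open>e\<close> is a unit vector. On
    the sphere of radius \<open>R\<close> its first term is at most d |e . z|, and the second
    cancels d R / n in \<open>k0\<close>.\<close>
  define h where "h z = k0 + M \<bullet> z + (d / R) * ((e \<bullet> z)\<^sup>2 - 1 / n * (z \<bullet> z))" for z
  have jh: "jet_on UNIV h (\<lambda>z. 0 + M + (d / R) *\<^sub>R ((2 * (e \<bullet> z)) *\<^sub>R e - (1 / n) *\<^sub>R (2 *\<^sub>R z)))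
     (\<lambda>z. 0 + 0 + (d / R) *\<^sub>R (2 *\<^sub>R outer e - (1 / n) *\<^sub>R (2 *\<^sub>R mat 1)))"
    unfolding h_def
    by (intro jet_on_add jet_on_const jet_on_linear jet_on_scale jet_on_diff jet_on_linear_square
      jet_on_inner_square[of 0, simplified])
  have trh: "trace (0 + 0 + (d / R) *\<^sub>R (2 *\<^sub>R outer e - (1 / n) *\<^sub>R (2 *\<^sub>R mat 1 :: real^'n^'n))) = 0"
    using n by (simp add: trace_scaleR trace_sub trace_outer ee trace_I n_def[symmetric])
  note jU = jet_on_powr[OF jW pW, of r]
  have jf: "jet_on (- {0}) (\<lambda>z. W z powr r - h z)
     (\<lambda>z. (r * W z powr (r - 1)) *\<^sub>R P z - (0 + M + (d / R) *\<^sub>R ((2 * (e \<bullet> z)) *\<^sub>R e - (1 / n) *\<^sub>R (2 *\<^sub>R z))))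
     (\<lambda>z. ((r * W z powr (r - 1)) *\<^sub>R X z + (r * ((r - 1) * W z powr (r - 2))) *\<^sub>R outer (P z))
        - (0 + 0 + (d / R) *\<^sub>R (2 *\<^sub>R outer e - (1 / n) *\<^sub>R (2 *\<^sub>R mat 1))))"
    by (rule jet_on_diff[OF jU jet_on_subset[OF jh]]) auto
  have ch: "continuous_on UNIV h" by (rule jet_onD(6)[OF jh])
  then have "bounded (h ` cball 0 R)"
    by (intro compact_imp_bounded compact_continuous_image continuous_on_subset[OF ch]) auto
  then have "\<exists>B. \<forall>z\<in>cball 0 R. \<bar>h z\<bar> \<le> B" by (auto simp: bounded_iff)
  then obtain B where B: "\<And>z. z \<in> cball 0 R \<Longrightarrow> \<bar>h z\<bar> \<le> B" by blast
  have Uh: "h z \<le> W z powr r" if z: "z \<in> cball 0 R - {0}" for z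
  proof -
    have "0 \<le> W z powr r - h z"
    proof (rule punctured_minimum_principle[OF jf R(1) _ _ _ z])
      show "trace (((r * W z powr (r - 1)) *\<^sub>R X z + (r * ((r - 1) * W z powr (r - 2))) *\<^sub>R outer (P z))
        - (0 + 0 + (d / R) *\<^sub>R (2 *\<^sub>R outer e - (1 / n) *\<^sub>R (2 *\<^sub>R mat 1)))) < 0"
        if "z \<in> ball 0 R - {0}" for z
        unfolding trace_sub[of "_ + _"] trh using solution_trace_neg[OF W k, of z] that by simp
      show "- B \<le> W y powr r - h y" if "y \<in> cball 0 R - {0}" for y
      proof -
        have "\<bar>h y\<bar> \<le> B" using B[of y] that by simp
        then show ?thesis using powr_ge_zero[of "W y" r] by linarith
      qed
      show "0 \<le> W y powr r - h y" if y: "y \<in> sphere 0 R" for y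
      proof -
        have ny: "norm y = R" "y \<in> - {0}" using y R by auto
        have "v1 y powr r \<le> W y powr r" "v2 y powr r \<le> W y powr r"
          using rho(2)[of y] ny R pW[of y] exponent_neg by (auto intro!: powr_mono2')
        then have 1: "b + M \<bullet> y + d * (e \<bullet> y) - eta * R \<le> W y powr r"
          "b + M \<bullet> y - d * (e \<bullet> y) - eta * R \<le> W y powr r"
          using s1(2)[of y] s2(2)[of y] ny R unfolding G12 by (auto simp: inner_add_left inner_diff_left)
        have "\<bar>e \<bullet> y\<bar> \<le> R" using Cauchy_Schwarz_ineq2[of e y] ee ny(1) by (simp add: norm_eq_1[symmetric])
        then have "\<bar>e \<bullet> y\<bar> * \<bar>e \<bullet> y\<bar> \<le> R * \<bar>e \<bullet> y\<bar>" by (intro mult_right_mono) auto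
        then have "(e \<bullet> y)\<^sup>2 \<le> R * \<bar>e \<bullet> y\<bar>" by (simp add: power2_eq_square)
        then have "(d / R) * (e \<bullet> y)\<^sup>2 \<le> (d / R) * (R * \<bar>e \<bullet> y\<bar>)" using d R by (intro mult_left_mono) auto
        then have 2: "(d / R) * (e \<bullet> y)\<^sup>2 \<le> d * \<bar>e \<bullet> y\<bar>" using R by simp
        have "y \<bullet> y = R * R" using ny by (simp add: dot_square_norm power2_eq_square)
        then have "h y = b + M \<bullet> y + (d / R) * (e \<bullet> y)\<^sup>2 - eta * R"
          using R n by (simp add: h_def k0_def field_simps)
        with 1 2 show ?thesis by (cases "0 \<le> e \<bullet> y") auto
      qed
    qed
    then show ?thesis by simp
  qed
  have h0: "b < h 0" using d R n by (simp add: h_def k0_def eta_def field_simps)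
  \<comment> \<open>Near 0 the r-th power of \<open>W\<close> would be at least b' > b; as r < 0
    this bounds \<open>W\<close> by a constant below \<open>a\<close>, against its upper
    limit.\<close>
  define b' where "b' = (b + h 0) / 2"
  have b': "b < b'" "b' < h 0" using h0 by (auto simp: b'_def)
  have b0: "0 < b" using a by (simp add: b_def)
  have "isCont h 0" using ch by (simp add: continuous_on_eq_continuous_at)
  then obtain s where s: "0 < s" "\<And>z. dist z 0 < s \<Longrightarrow> dist (h z) (h 0) < h 0 - b'"
    unfolding continuous_at_eps_delta using b' by (metis diff_gt_0_iff_gt)
  have "b' powr (1 / r) < b powr (1 / r)" using b' b0 exponent_neg by (intro powr_less_mono2_neg) auto
  also have "\<dots> = a" using a exponent_neg by (simp add: b_def powr_powr)
  finally have "0 < a - b' powr (1 / r)" by simp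
  from limsup[OF this, of "min s R"] obtain z where z: "0 < norm z" "norm z < s" "norm z < R"
    "b' powr (1 / r) < W z" using s R by auto
  have "b' \<le> h z" using s(2)[of z] z by (simp add: dist_real_def)
  also have "\<dots> \<le> W z powr r" using z by (intro Uh) auto
  finally have "(W z powr r) powr (1 / r) \<le> b' powr (1 / r)"
    using b' b0 exponent_neg by (intro powr_mono2') auto
  then show False using z pW[of z] exponent_neg by (simp add: powr_powr)
qed

end

section \<open>Moving spheres\<close>

lemma kelvin_eq: "kelvin w x L (x + z) = (z \<bullet> z) / L\<^sup>2 * w (x + (L\<^sup>2 / (z \<bullet> z)) *\<^sub>R z)"
  by (simp add: kelvin_def inversion_def)

definition dominated :: "(real^'n \<Rightarrow> real) \<Rightarrow> real^'n \<Rightarrow> real \<Rightarrow> bool" where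
  "dominated w x L \<longleftrightarrow> (\<forall>z. L \<le> norm z \<longrightarrow> w (x + z) \<le> kelvin w x L (x + z))"

definition quadratic_bound :: "(real^'n \<Rightarrow> real) \<Rightarrow> real^'n \<Rightarrow> real \<Rightarrow> bool" where
  "quadratic_bound w x c \<longleftrightarrow> (\<exists>R. \<forall>z. R \<le> norm z \<longrightarrow> w (x + z) \<le> c * (z \<bullet> z))"

context
  fixes w :: "real^'n \<Rightarrow> real" and p :: "real^'n \<Rightarrow> real^'n" and X :: "real^'n \<Rightarrow> real^'n^'n" and k :: nat
  assumes W: "solution_on k UNIV w p X" and k: "1 \<le> k" and card: "3 \<le> CARD('n)"
begin

lemma solution_jet: "jet_on UNIV w p X" and solution_pos: "0 < w y"
  using W by (auto simp: solution_on_def)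

lemma solution_continuous: "continuous_on A w" and solution_grad_continuous: "continuous_on A p"
  using jet_onD(6,7)[OF solution_jet] continuous_on_subset by blast+

lemma quadratic_bound_pos:
  assumes "quadratic_bound w x c"
  shows "0 < c"
proof -
  obtain R where R: "\<And>z. R \<le> norm z \<Longrightarrow> w (x + z) \<le> c * (z \<bullet> z)"
    using assms unfolding quadratic_bound_def by blast
  obtain z :: "real^'n" where z: "norm z = \<bar>R\<bar> + 1"
    using vector_choose_size[of "\<bar>R\<bar> + 1"] by auto
  have "w (x + z) \<le> c * (z \<bullet> z)" using R[of z] z by simp
  then have "0 < c * (z \<bullet> z)" using solution_pos[of "x + z"] by linarith
  then show ?thesis using inner_ge_zero[of z] by (auto simp: zero_less_mult_iff)
qed

text \<open>The slack between \<open>c\<close> and \<open>c'\<close> absorbs the change of centre: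
  |z| + d <= q |z| as soon as |z| >= d / (q - 1), where q^2 = c' / c. Thus the growth rate does not
  depend on the centre.\<close>

lemma quadratic_bound_translate:
  assumes b: "quadratic_bound w x c" and cc: "c < c'"
  shows "quadratic_bound w x' c'"
proof -
  obtain R where R: "\<And>z. R \<le> norm z \<Longrightarrow> w (x + z) \<le> c * (z \<bullet> z)"
    using b unfolding quadratic_bound_def by blast
  have c: "0 < c" using quadratic_bound_pos[OF b] .
  define d where "d = norm (x' - x)"
  define q where "q = sqrt (c' / c)"
  have q: "1 < q" "q\<^sup>2 = c' / c" using c cc by (auto simp: q_def)
  have "w (x' + z) \<le> c' * (z \<bullet> z)" if z: "\<bar>R\<bar> + d + d / (q - 1) \<le> norm z" for z
  proof -
    have d0: "0 \<le> d" by (simp add: d_def)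
    have "0 \<le> d / (q - 1)" using d0 q by simp
    then have z1: "\<bar>R\<bar> + d \<le> norm z" and z2: "d / (q - 1) \<le> norm z" using z d0 by auto
    have "d \<le> (q - 1) * norm z" using z2 q by (simp add: field_simps)
    then have n1: "norm z + d \<le> q * norm z" by (simp add: algebra_simps)
    have n2: "norm (z + (x' - x)) \<le> norm z + d" unfolding d_def by (rule norm_triangle_ineq)
    have "norm z \<le> norm (z + (x' - x)) + d"
      using norm_triangle_ineq4[of "z + (x' - x)" "x' - x"] by (simp add: d_def)
    then have "R \<le> norm (z + (x' - x))" using z1 by simp
    from R[OF this] have "w (x' + z) \<le> c * (norm (z + (x' - x)))\<^sup>2"
      by (simp add: dot_square_norm add_ac)
    also have "\<dots> \<le> c * (q * norm z)\<^sup>2"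
      using n1 n2 c by (intro mult_left_mono power_mono) auto
    also have "\<dots> = c' * (z \<bullet> z)" using c q by (simp add: power_mult_distrib dot_square_norm)
    finally show ?thesis .
  qed
  then show ?thesis unfolding quadratic_bound_def by blast
qed

text \<open>The upper limit of \<open>w y / |y|\<^sup>2\<close> at infinity; \<open>growth_rate_bounds\<close> below shows that the set is
  nonempty and bounded below.\<close>
definition growth_rate :: real where
  "growth_rate = Inf {c. quadratic_bound w 0 c}"

lemma growth_rate_bounds:
  shows "0 \<le> growth_rate" and "growth_rate < c \<Longrightarrow> quadratic_bound w x c"
    and "quadratic_bound w x c \<Longrightarrow> growth_rate \<le> c"
proof -
  obtain C where "0 < C" "\<And>y. 1 \<le> norm y \<Longrightarrow> w y \<le> C * (y \<bullet> y)"
    using solution_growth[OF card refl W k] by blast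
  then have ne: "{c. quadratic_bound w 0 c} \<noteq> {}"
    unfolding quadratic_bound_def by (auto intro: exI[of _ C])
  have bdd: "bdd_below {c. quadratic_bound w 0 c}"
    by (rule bdd_belowI[of _ 0]) (auto dest: quadratic_bound_pos)
  show "0 \<le> growth_rate"
    unfolding growth_rate_def using ne by (rule cInf_greatest) (auto dest: quadratic_bound_pos)
  show "growth_rate \<le> c" if "quadratic_bound w x c"
  proof (rule field_le_epsilon)
    fix e :: real assume "0 < e"
    then have "quadratic_bound w 0 (c + e)" using quadratic_bound_translate[OF that] by simp
    then show "growth_rate \<le> c + e" unfolding growth_rate_def using bdd by (intro cInf_lower) auto
  qed
  show "quadratic_bound w x c" if "growth_rate < c"
    using that cInf_lessD[OF ne] quadratic_bound_translate unfolding growth_rate_def by blast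
qed

text \<open>Inversion moves x + z to within L^2 / |z| of \<open>x\<close>, so continuity of
  \<open>w\<close> at \<open>x\<close> suffices, uniformly for all radii up to \<open>M\<close>. The
  uniformity is used when the radius varies.\<close>

lemma kelvin_lower_asymptotics:
  assumes e: "0 < e"
  shows "\<exists>R>0. \<forall>z L. R \<le> norm z \<and> 0 < L \<and> L \<le> M \<longrightarrow> (z \<bullet> z) / L\<^sup>2 * (w x - e) \<le> kelvin w x L (x + z)
     \<and> kelvin w x L (x + z) \<le> (z \<bullet> z) / L\<^sup>2 * (w x + e)"
proof -
  have "isCont w x" using solution_continuous[of UNIV] by (simp add: continuous_on_eq_continuous_at)
  then obtain s where s: "0 < s" "\<And>y. dist y x < s \<Longrightarrow> dist (w y) (w x) < e"
    unfolding continuous_at_eps_delta using e by blast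
  show ?thesis
  proof (intro exI[of _ "M\<^sup>2 / s + 1"] conjI allI impI)
    show "0 < M\<^sup>2 / s + 1" using s by (simp add: add_nonneg_pos)
    fix z :: "real^'n" and L assume a: "M\<^sup>2 / s + 1 \<le> norm z \<and> 0 < L \<and> L \<le> M"
    have nz: "0 < norm z" using a s by (meson add_nonneg_pos divide_nonneg_pos less_le_trans zero_le_power2 zero_less_one)
    have "L\<^sup>2 \<le> M\<^sup>2" using a by (intro power_mono) auto
    also have "M\<^sup>2 < s * norm z" using a s by (simp add: field_simps)
    finally have "L\<^sup>2 / norm z < s" using nz by (simp add: field_simps)
    moreover have "norm ((L\<^sup>2 / (z \<bullet> z)) *\<^sub>R z) = L\<^sup>2 / norm z"
      using nz by (simp add: dot_square_norm power2_eq_square)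
    ultimately have "dist (w (x + (L\<^sup>2 / (z \<bullet> z)) *\<^sub>R z)) (w x) < e" by (intro s) (simp add: dist_norm)
    then have "w x - e \<le> w (x + (L\<^sup>2 / (z \<bullet> z)) *\<^sub>R z)" "w (x + (L\<^sup>2 / (z \<bullet> z)) *\<^sub>R z) \<le> w x + e"
      by (auto simp: dist_real_def)
    then show "(z \<bullet> z) / L\<^sup>2 * (w x - e) \<le> kelvin w x L (x + z)"
      "kelvin w x L (x + z) \<le> (z \<bullet> z) / L\<^sup>2 * (w x + e)"
      unfolding kelvin_eq by (intro mult_left_mono; simp)+
  qed
qed

text \<open>Coefficients of |z|^2 at infinity are compared: that of the Kelvin transform is w(x) /
  L^2.\<close>

lemma dominated_growth_rate:
  assumes d: "dominated w x L" and L: "0 < L"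
  shows "growth_rate * L\<^sup>2 \<le> w x"
proof -
  have "growth_rate \<le> w x / L\<^sup>2"
  proof (rule field_le_epsilon)
    fix e :: real assume e: "0 < e"
    then have "0 < e * L\<^sup>2" using L by simp
    from kelvin_lower_asymptotics[OF this] obtain R where R: "0 < R"
      "\<And>z. R \<le> norm z \<Longrightarrow> kelvin w x L (x + z) \<le> (z \<bullet> z) / L\<^sup>2 * (w x + e * L\<^sup>2)"
      using L by blast
    have "w (x + z) \<le> (w x / L\<^sup>2 + e) * (z \<bullet> z)" if "max R L \<le> norm z" for z
    proof -
      have "w (x + z) \<le> kelvin w x L (x + z)" using d that by (simp add: dominated_def)
      also have "\<dots> \<le> (z \<bullet> z) / L\<^sup>2 * (w x + e * L\<^sup>2)" using R that by simp
      finally show ?thesis using L by (simp add: field_simps)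
    qed
    then have "quadratic_bound w x (w x / L\<^sup>2 + e)" unfolding quadratic_bound_def by blast
    then show "growth_rate \<le> w x / L\<^sup>2 + e" by (rule growth_rate_bounds)
  qed
  then show ?thesis using L by (simp add: field_simps)
qed

text \<open>On the ray through \<open>z\<close> the comparison says that \<open>t \<mapsto> w (x + t z) / t\<close> is not larger at
  \<open>t = 1\<close> than at the reflected parameter \<open>L\<^sup>2 / |z|\<^sup>2\<close>.\<close>
lemma kelvin_ge_of_radial:
  assumes L: "0 < L" "L \<le> norm z"
    and rad: "\<And>t. L\<^sup>2 / (z \<bullet> z) \<le> t \<Longrightarrow> t \<le> 1 \<Longrightarrow> p (x + t *\<^sub>R z) \<bullet> (t *\<^sub>R z) \<le> w (x + t *\<^sub>R z)"
  shows "w (x + z) \<le> kelvin w x L (x + z)"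
proof -
  define s where "s = L\<^sup>2 / (z \<bullet> z)"
  have zz: "0 < z \<bullet> z" using L by auto
  have "L\<^sup>2 \<le> (norm z)\<^sup>2" using L by (intro power_mono) auto
  then have s: "0 < s" "s \<le> 1" using L zz by (auto simp: s_def dot_square_norm)
  have "w (x + 1 *\<^sub>R z) / 1 \<le> w (x + s *\<^sub>R z) / s"
  proof (rule DERIV_nonpos_imp_nonincreasing[of s 1 "\<lambda>t. w (x + t *\<^sub>R z) / t"])
    fix t assume t: "s \<le> t" "t \<le> 1"
    then have t0: "0 < t" using s by simp
    have d: "((\<lambda>t. w (x + t *\<^sub>R z)) has_real_derivative p (x + t *\<^sub>R z) \<bullet> z) (at t)"
      by (rule DERIV_line) (use jet_onD(2)[OF solution_jet] in simp)
    have "((\<lambda>t. w (x + t *\<^sub>R z) / t) has_real_derivative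
        ((p (x + t *\<^sub>R z) \<bullet> z) * t - w (x + t *\<^sub>R z) * 1) / (t * t)) (at t)"
      using t0 by (intro DERIV_divide d DERIV_ident) auto
    moreover have "((p (x + t *\<^sub>R z) \<bullet> z) * t - w (x + t *\<^sub>R z) * 1) / (t * t) \<le> 0"
      using rad[of t] t t0 by (intro divide_nonpos_pos) (auto simp: s_def mult.commute)
    ultimately show "\<exists>y. ((\<lambda>t. w (x + t *\<^sub>R z) / t) has_real_derivative y) (at t) \<and> y \<le> 0" by blast
  qed (rule s)
  then show ?thesis unfolding kelvin_eq s_def by (simp add: mult.commute)
qed

text \<open>Close to \<open>x\<close> positivity of w - D w . z makes w(x + t z) / t nonincreasing
  in t. Farther out \<open>w\<close> is at most C' |z|^2, while its Kelvin transform is at least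
  |z|^2 / L^2 times the minimum of \<open>w\<close> near \<open>x\<close>, which wins for small
  L.\<close>

lemma dominated_small:
  obtains L0 where "0 < L0" "\<And>L. 0 < L \<Longrightarrow> L \<le> L0 \<Longrightarrow> dominated w x L"
proof -
  have "continuous_on UNIV (\<lambda>z. w (x + z) - p (x + z) \<bullet> z)"
    by (intro continuous_intros continuous_on_compose2[OF solution_continuous] continuous_on_compose2[OF solution_grad_continuous]) auto
  then have "isCont (\<lambda>z. w (x + z) - p (x + z) \<bullet> z) 0" by (simp add: continuous_on_eq_continuous_at)
  then obtain r where r: "0 < r" "\<And>z. dist z 0 < r \<Longrightarrow> dist (w (x + z) - p (x + z) \<bullet> z) (w (x + 0) - p (x + 0) \<bullet> 0) < w x"
    unfolding continuous_at_eps_delta using solution_pos by blast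
  have rad: "p (x + z) \<bullet> z \<le> w (x + z)" if "norm z < r" for z
    using r(2)[of z] that by (simp add: dist_real_def)
  have "cball x r \<noteq> {}" using r by simp
  then obtain xm where xm: "xm \<in> cball x r" "\<And>y. y \<in> cball x r \<Longrightarrow> w xm \<le> w y"
    using continuous_attains_inf[OF compact_cball _ solution_continuous] by blast
  have "cball (0 :: real^'n) 1 \<noteq> {}" by simp
  then obtain xM where xM: "\<And>y. y \<in> cball 0 1 \<Longrightarrow> w y \<le> w xM"
    using continuous_attains_sup[OF compact_cball _ solution_continuous, of 0 1] by blast
  obtain C where C: "0 < C" "\<And>y. 1 \<le> norm y \<Longrightarrow> w y \<le> C * (y \<bullet> y)"
    using solution_growth[OF card refl W k] by blast
  \<comment> \<open>First term for |x + z| >= 1 via the growth bound, second for |x + z| < 1 via the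
    maximum over the unit ball.\<close>
  define C' where "C' = C * (norm x / r + 1)\<^sup>2 + w xM / r\<^sup>2"
  have "0 < norm x / r + 1" using r by (simp add: add_nonneg_pos)
  then have C': "0 < C'" unfolding C'_def using C r solution_pos[of xM]
    by (intro add_pos_pos mult_pos_pos) auto
  have far: "w (x + z) \<le> C' * (z \<bullet> z)" if z: "r \<le> norm z" for z
  proof (cases "1 \<le> norm (x + z)")
    case True
    have "norm x \<le> norm x / r * norm z" 
      using r mult_left_mono[OF z, of "norm x"] by (simp add: field_simps)
    then have "norm (x + z) \<le> (norm x / r + 1) * norm z"
      using norm_triangle_ineq[of x z] by (simp add: algebra_simps)
    then have "(norm (x + z))\<^sup>2 \<le> ((norm x / r + 1) * norm z)\<^sup>2" by (intro power_mono) auto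
    then have "C * (norm (x + z))\<^sup>2 \<le> C * ((norm x / r + 1) * norm z)\<^sup>2"
      using C(1) by (intro mult_left_mono) auto
    also have "\<dots> = C * (norm x / r + 1)\<^sup>2 * (norm z)\<^sup>2"
      by (simp only: power_mult_distrib mult.assoc)
    finally have "w (x + z) \<le> C * (norm x / r + 1)\<^sup>2 * (norm z)\<^sup>2"
      using C(2)[OF True] by (simp add: dot_square_norm)
    moreover have "0 \<le> w xM / r\<^sup>2 * (norm z)\<^sup>2" using solution_pos[of xM] by simp
    ultimately show ?thesis unfolding C'_def dot_square_norm distrib_right by linarith
  next
    case False
    have "r\<^sup>2 \<le> (norm z)\<^sup>2" using z r by (intro power_mono) auto
    then have "w xM * 1 \<le> w xM * ((norm z)\<^sup>2 / r\<^sup>2)" using solution_pos[of xM] r by (intro mult_left_mono) auto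
    moreover have "0 \<le> C * (norm x / r + 1)\<^sup>2 * (norm z)\<^sup>2" using C by simp
    ultimately show ?thesis using xM[of "x + z"] False
      unfolding C'_def by (simp add: dot_square_norm distrib_right)
  qed
  \<comment> \<open>L0 <= r sends the region |z| >= r into the ball where \<open>xm\<close>
    minimises, and L0^2 C' <= w xm is the comparison of coefficients.\<close>
  define L0 where "L0 = min r (sqrt (w xm / C'))"
  have L0: "0 < L0" "L0 \<le> r" using r C' solution_pos[of xm] by (auto simp: L0_def)
  have L02: "L0\<^sup>2 * C' \<le> w xm"
  proof -
    have "L0\<^sup>2 \<le> (sqrt (w xm / C'))\<^sup>2" using L0 by (intro power_mono) (auto simp: L0_def)
    also have "\<dots> = w xm / C'" using solution_pos[of xm] C' by (simp add: less_imp_le)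
    finally show ?thesis using C' by (simp add: field_simps)
  qed
  show thesis
  proof (rule that[OF L0(1)])
    fix L assume L: "0 < L" "L \<le> L0"
    show "dominated w x L"
      unfolding dominated_def
    proof (intro allI impI)
      fix z :: "real^'n" assume Lz: "L \<le> norm z"
      show "w (x + z) \<le> kelvin w x L (x + z)"
      proof (cases "norm z < r")
        case True
        show ?thesis
        proof (rule kelvin_ge_of_radial[OF L(1) Lz])
          fix t assume t: "L\<^sup>2 / (z \<bullet> z) \<le> t" "t \<le> 1"
          have "0 \<le> t" using t(1) by (rule order_trans[rotated]) simp
          then have "norm (t *\<^sub>R z) \<le> 1 * norm z"
            using t unfolding norm_scaleR by (intro mult_right_mono) auto
          then show "p (x + t *\<^sub>R z) \<bullet> (t *\<^sub>R z) \<le> w (x + t *\<^sub>R z)" using True by (intro rad) auto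
        qed
      next
        case False
        then have zr: "r \<le> norm z" by simp
        have nz: "0 < norm z" using zr r by linarith
        have "L * L \<le> r * norm z" using L L0 zr Lz by (intro mult_mono) auto
        then have "L\<^sup>2 / norm z \<le> r" using nz by (simp add: power2_eq_square field_simps)
        moreover have "norm ((L\<^sup>2 / (z \<bullet> z)) *\<^sub>R z) = L\<^sup>2 / norm z"
          using nz by (simp add: dot_square_norm power2_eq_square)
        ultimately have "w xm \<le> w (x + (L\<^sup>2 / (z \<bullet> z)) *\<^sub>R z)" by (intro xm) (simp add: dist_norm)
        moreover have "L\<^sup>2 * C' \<le> w xm"
        proof -
          have "L\<^sup>2 * C' \<le> L0\<^sup>2 * C'" using L C' by (intro mult_right_mono power_mono) auto
          then show ?thesis using L02 by simp
        qed
        ultimately have "(z \<bullet> z) / L\<^sup>2 * (L\<^sup>2 * C') \<le> (z \<bullet> z) / L\<^sup>2 * w (x + (L\<^sup>2 / (z \<bullet> z)) *\<^sub>R z)"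
          by (intro mult_left_mono) auto
        then show ?thesis using far[OF zr] L unfolding kelvin_eq by (simp add: mult.commute)
      qed
    qed
  qed
qed

text \<open>Given \<open>y\<close> and \<open>z\<close>, spheres about y - z of radius slightly
  below |z| yield D w(y) . z <= w(y). Scaling \<open>z\<close> forces D w = 0 everywhere, so the
  matrix vanishes, contradicting sigma_k = 1.\<close>

lemma not_always_dominated:
  assumes "\<And>x L. 0 < L \<Longrightarrow> dominated w x L"
  shows False
proof -
  have le: "p y \<bullet> z \<le> w y" if z: "z \<noteq> 0" for y z
  proof (rule ccontr)
    assume n: "\<not> p y \<bullet> z \<le> w y"
    define x where "x = y - z"
    have y: "y = x + 1 *\<^sub>R z" by (simp add: x_def)
    have d: "((\<lambda>t. w (x + t *\<^sub>R z) - t * w y) has_real_derivative p y \<bullet> z - w y) (at 1)"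
      using DERIV_diff[OF DERIV_line[of w "p y" x 1 z] DERIV_cmult_right[OF DERIV_ident, of "w y"]]
        jet_onD(2)[OF solution_jet, of y] y by simp
    have "0 < p y \<bullet> z - w y" using n by simp
    from DERIV_pos_inc_left[OF d this] obtain e where e: "0 < e"
      "\<And>h. 0 < h \<Longrightarrow> h < e \<Longrightarrow> w (x + (1 - h) *\<^sub>R z) - (1 - h) * w y < 0"
      using y by auto
    define h where "h = min (e / 2) (1 / 2)"
    have h: "0 < h" "h < e" "h < 1" using e by (auto simp: h_def)
    \<comment> \<open>This radius reflects the parameter t = 1 to t = 1 - h.\<close>
    define L where "L = sqrt (1 - h) * norm z"
    have L: "0 < L" "L \<le> norm z" using h z by (auto simp: L_def intro!: mult_left_le_one_le)
    have "L\<^sup>2 = (1 - h) * (z \<bullet> z)" using h by (simp add: L_def power_mult_distrib dot_square_norm)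
    then have s: "L\<^sup>2 / (z \<bullet> z) = 1 - h" "(z \<bullet> z) / L\<^sup>2 = 1 / (1 - h)" using z h by auto
    have "w (x + z) \<le> kelvin w x L (x + z)" using assms[OF L(1), of x] L by (simp add: dominated_def)
    also have "\<dots> = w (x + (1 - h) *\<^sub>R z) / (1 - h)" unfolding kelvin_eq s by simp
    finally have "(1 - h) * w y \<le> w (x + (1 - h) *\<^sub>R z)" using h y by (simp add: field_simps)
    then show False using e(2)[OF h(1,2)] by simp
  qed
  have p0: "p y = 0" for y
  proof (rule ccontr)
    assume "p y \<noteq> 0"
    define t where "t = (w y + 1) / (p y \<bullet> p y)"
    have "t *\<^sub>R p y \<noteq> 0" using \<open>p y \<noteq> 0\<close> solution_pos[of y] by (auto simp: t_def)
    from le[OF this, of y] have "w y + 1 \<le> w y" using \<open>p y \<noteq> 0\<close> by (simp add: t_def)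
    then show False by simp
  qed
  have "(p has_derivative (\<lambda>h. X 0 *v h)) (at 0)" using jet_onD(3)[OF solution_jet] by simp
  moreover have "(p has_derivative (\<lambda>h. 0)) (at 0)"
  proof -
    have "p = (\<lambda>_. 0)" using p0 by auto
    then show ?thesis by simp
  qed
  ultimately have "(\<lambda>h. X 0 *v h) = (\<lambda>h. 0)" by (rule has_derivative_unique)
  then have "X 0 = 0" by (simp add: matrix_eq fun_eq_iff)
  then have "amat (w 0) (p 0) (X 0) = (0 :: real) *\<^sub>R mat 1" by (simp add: amat_def p0)
  then have "sigma_mat k (amat (w 0) (p 0) (X 0)) = 0"
    using k by (simp only: sigma_mat_scaleR_one) simp
  then show False using W by (simp add: solution_on_def)
qed

lemma dominated_closed:
  assumes L: "0 < L" and d: "\<And>m. 0 < m \<Longrightarrow> m < L \<Longrightarrow> dominated w x m"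
  shows "dominated w x L"
  unfolding dominated_def
proof (intro allI impI)
  fix z :: "real^'n" assume z: "L \<le> norm z"
  have "continuous_on {0<..} (\<lambda>m. kelvin w x m (x + z))"
    unfolding kelvin_eq using z L by (intro continuous_intros continuous_on_compose2[OF solution_continuous]) auto
  then have "isCont (\<lambda>m. kelvin w x m (x + z)) L"
    using L by (simp add: continuous_on_eq_continuous_at)
  then have "((\<lambda>m. kelvin w x m (x + z)) \<longlongrightarrow> kelvin w x L (x + z)) (at_left L)"
    by (simp add: isCont_def filterlim_at_split)
  moreover have "\<forall>\<^sub>F m in at_left L. w (x + z) \<le> kelvin w x m (x + z)"
    unfolding eventually_at_left_field
    using d z L by (intro exI[of _ 0]) (auto simp: dominated_def)
  ultimately show "w (x + z) \<le> kelvin w x L (x + z)"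
    by (rule tendsto_lowerbound) simp
qed

text \<open>Hopf's lemma is applied at x + z from outside the sphere, in the ball about x + 2 z. On
  the sphere \<open>w\<close> equals its Kelvin transform, whose derivative along \<open>z\<close>
  is 2 w - D w . z, so that of the difference is 2 (w - D w . z).\<close>

lemma radial_derivative_on_sphere:
  assumes L: "0 < L" and d: "dominated w x L"
    and strict: "\<And>z. L < norm z \<Longrightarrow> w (x + z) < kelvin w x L (x + z)"
    and z: "norm z = L"
  shows "p (x + z) \<bullet> z < w (x + z)"
proof -
  have sV: "solution_on k (- {x}) (kelvin w x L) (kelvin_grad w p x L) (kelvin_hess w p X x L)"
    using W L by (intro solution_on_kelvin) auto
  have sW: "solution_on k (- {x}) w p X"
    using W jet_on_subset[OF solution_jet, of "- {x}"] by (auto simp: solution_on_def)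
  have zz: "z \<bullet> z = L\<^sup>2" using z by (simp add: dot_square_norm)
  have inv: "inversion x L (x + z) = x + z" using L zz by (simp add: inversion_def)
  have far: "2 * L - dist (x + 2 *\<^sub>R z) y \<le> norm (y - x)" for y
    using norm_triangle_ineq[of "x + 2 *\<^sub>R z - y" "y - x"] z by (simp add: dist_norm)
  have "0 < (kelvin_grad w p x L (x + z) - p (x + z)) \<bullet> ((x + 2 *\<^sub>R z) - (x + z))"
  proof (rule hopf_boundary_derivative[OF k sW sV L])
    show "cball (x + 2 *\<^sub>R z) L \<subseteq> - {x}" using far[of x] L by auto
    show "w y \<le> kelvin w x L y" if "y \<in> cball (x + 2 *\<^sub>R z) L" for y
      using d[unfolded dominated_def, rule_format, of "y - x"] far[of y] that by simp
    show "w y < kelvin w x L y" if "y \<in> ball (x + 2 *\<^sub>R z) L" for y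
      using strict[of "y - x"] far[of y] that by simp
    show "dist (x + 2 *\<^sub>R z) (x + z) = L" using z by (simp add: dist_norm scaleR_2)
    show "w (x + z) = kelvin w x L (x + z)" using inv zz L by (simp add: kelvin_def)
  qed
  moreover have "(x + 2 *\<^sub>R z) - (x + z) = z" by (simp add: scaleR_2)
  moreover have "kelvin_grad w p x L (x + z) \<bullet> z = 2 * w (x + z) - p (x + z) \<bullet> z"
  proof -
    have "(reflection z *v p (x + z)) \<bullet> z = - (p (x + z) \<bullet> z)"
      using zz L by (simp add: reflection_mult_vec inner_diff_left inner_diff_right inner_commute)
    then show ?thesis using zz L by (simp add: kelvin_grad_def inv inner_add_left)
  qed
  ultimately show ?thesis by (simp add: inner_diff_left)
qed

lemma dense_growth_rate:
  assumes "0 < L" and "growth_rate * L\<^sup>2 < w x"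
  shows "\<exists>c > growth_rate. c * L\<^sup>2 < w x"
proof -
  have "growth_rate < w x / L\<^sup>2" using assms by (simp add: field_simps)
  then obtain c where "growth_rate < c" "c < w x / L\<^sup>2" using dense by blast
  then show ?thesis using assms(1) by (auto simp: field_simps)
qed

text \<open>Three regions: near the sphere the radial inequality persists by continuity and
  compactness, near infinity the strict growth inequality persists, and on the compact shell between
  them the strict comparison persists by uniform continuity in the radius.\<close>

lemma critical_extension:
  assumes L: "0 < L" and d: "dominated w x L"
    and strict: "\<And>z. L < norm z \<Longrightarrow> w (x + z) < kelvin w x L (x + z)"
    and gr: "growth_rate * L\<^sup>2 < w x"
  obtains e where "0 < e" "\<And>m. L < m \<Longrightarrow> m < L + e \<Longrightarrow> dominated w x m"
proof -
  define F where "F z = w (x + z) - p (x + z) \<bullet> z" for z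
  have cF: "continuous_on UNIV F" unfolding F_def
    by (intro continuous_intros continuous_on_compose2[OF solution_continuous] continuous_on_compose2[OF solution_grad_continuous]) auto
  have "open {z. 0 < F z}" using cF by (intro open_Collect_less continuous_intros)
  moreover have "sphere 0 L \<subseteq> {z. 0 < F z}"
    using radial_derivative_on_sphere[OF L d strict] by (auto simp: F_def)
  moreover have "compact (sphere (0 :: real^'n) L)" by simp
  ultimately obtain e1 where e1: "0 < e1" "(\<Union>z\<in>sphere 0 L. ball z e1) \<subseteq> {z. 0 < F z}"
    using compact_subset_open_imp_ball_epsilon_subset by metis
  have near: "0 < F z" if z: "\<bar>norm z - L\<bar> < e1" "z \<noteq> 0" for z
  proof -
    let ?y = "(L / norm z) *\<^sub>R z"
    have "?y \<in> sphere 0 L" using L z by simp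
    moreover have "dist ?y z = \<bar>norm z - L\<bar>"
    proof -
      have "?y - z = ((L - norm z) / norm z) *\<^sub>R z" using z by (simp add: diff_divide_distrib scaleR_diff_left)
      then show ?thesis using z by (simp add: dist_norm)
    qed
    ultimately have "z \<in> (\<Union>z\<in>sphere 0 L. ball z e1)" using z(1) by (intro UN_I[of ?y]) auto
    then show ?thesis using e1(2) by blast
  qed
  have reg1: "w (x + z) \<le> kelvin w x m (x + z)" if m: "L < m" "m \<le> norm z" "norm z < L + e1" for m z
  proof (rule kelvin_ge_of_radial)
    show "0 < m" "m \<le> norm z" using m L by auto
    have nz: "0 < norm z" using m L by linarith
    fix t assume t: "m\<^sup>2 / (z \<bullet> z) \<le> t" "t \<le> 1"
    have zz: "z \<bullet> z = norm z * norm z" by (simp add: dot_square_norm power2_eq_square)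
    have "0 < m\<^sup>2 / (z \<bullet> z)" using nz m L by simp
    then have t0: "0 < t" using t by simp
    \<comment> \<open>All points t z between z and its reflection satisfy |t z| |z| >= m^2 > L^2;
      with |z| < L + e1 this keeps |t z| above L - e1, inside the region where F > 0.\<close>
    have "L * L < m * m" using m L by (intro mult_strict_mono) auto
    also have "m * m \<le> t * (norm z * norm z)" using t(1) nz by (simp add: zz power2_eq_square field_simps)
    finally have a: "L * L < norm (t *\<^sub>R z) * norm z" using t0 by simp
    have "L - e1 < norm (t *\<^sub>R z)"
    proof (rule ccontr)
      assume "\<not> ?thesis"
      then have n: "norm (t *\<^sub>R z) \<le> L - e1" by simp
      then have "0 \<le> L - e1" using norm_ge_zero order_trans by blast
      then have "norm (t *\<^sub>R z) * norm z \<le> (L - e1) * (L + e1)"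
        using n m(3) by (intro mult_mono) auto
      also have "\<dots> \<le> L * L" by (simp add: algebra_simps)
      finally show False using a by simp
    qed
    moreover have "norm (t *\<^sub>R z) \<le> 1 * norm z" using t t0 unfolding norm_scaleR by (intro mult_right_mono) auto
    ultimately have "\<bar>norm (t *\<^sub>R z) - L\<bar> < e1" using m(3) by linarith
    then have "0 < F (t *\<^sub>R z)" using t0 nz by (intro near) auto
    then show "p (x + t *\<^sub>R z) \<bullet> (t *\<^sub>R z) \<le> w (x + t *\<^sub>R z)" by (simp add: F_def)
  qed
  obtain c where c: "growth_rate < c" "c * L\<^sup>2 < w x" using dense_growth_rate[OF L gr] by blast
  \<comment> \<open>Half of the gap: one half covers the change of c m^2, the other the error in the
    asymptotics.\<close>
  define h where "h = (w x - c * L\<^sup>2) / 2"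
  have h: "0 < h" using c by (simp add: h_def)
  have "isCont (\<lambda>m. c * m\<^sup>2) L" by (intro continuous_intros)
  then obtain e2 where e2: "0 < e2" "\<And>m. dist m L < e2 \<Longrightarrow> dist (c * m\<^sup>2) (c * L\<^sup>2) < h"
    unfolding continuous_at_eps_delta using h by blast
  obtain R1 where R1: "\<And>z. R1 \<le> norm z \<Longrightarrow> w (x + z) \<le> c * (z \<bullet> z)"
    using growth_rate_bounds(2)[OF c(1)] unfolding quadratic_bound_def by blast
  obtain R2 where R2: "\<And>z m. R2 \<le> norm z \<Longrightarrow> 0 < m \<Longrightarrow> m \<le> L + e2 \<Longrightarrow> (z \<bullet> z) / m\<^sup>2 * (w x - h) \<le> kelvin w x m (x + z)"
    using kelvin_lower_asymptotics[OF h, of "L + e2" x] by blast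
  have reg3: "w (x + z) \<le> kelvin w x m (x + z)" if m: "L < m" "m < L + e2" "max R1 R2 \<le> norm z" for m z
  proof -
    have "dist (c * m\<^sup>2) (c * L\<^sup>2) < h" using m by (intro e2) (simp add: dist_real_def)
    then have "c * m\<^sup>2 < c * L\<^sup>2 + h" unfolding dist_real_def by linarith
    moreover have "c * L\<^sup>2 + h = w x - h" by (simp add: h_def field_simps)
    ultimately have "c * m\<^sup>2 \<le> w x - h" by linarith
    then have "c \<le> (w x - h) / m\<^sup>2" using m L by (simp add: field_simps)
    then have "c * (z \<bullet> z) \<le> (w x - h) / m\<^sup>2 * (z \<bullet> z)" by (intro mult_right_mono) auto
    also have "\<dots> = (z \<bullet> z) / m\<^sup>2 * (w x - h)" by simp
    also have "\<dots> \<le> kelvin w x m (x + z)" using R2[of z m] m L by simp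
    finally show ?thesis using R1[of z] m by simp
  qed
  define A where "A = cball (0 :: real^'n) (max R1 R2) - ball 0 (L + e1)"
  have A: "compact A" by (simp add: A_def compact_diff)
  define H where "H = (\<lambda>(m, z). kelvin w x m (x + z) - w (x + z))"
  have cH: "continuous_on ({L..L+1} \<times> A) H"
    unfolding H_def kelvin_eq case_prod_beta
    by (intro continuous_intros continuous_on_compose2[OF solution_continuous]) (use L e1 in \<open>auto simp: A_def\<close>)
  have reg2: "\<exists>e>0. \<forall>m z. L < m \<and> m < L + e \<and> z \<in> A \<longrightarrow> w (x + z) \<le> kelvin w x m (x + z)"
  proof (cases "A = {}")
    case True
    then show ?thesis by (intro exI[of _ 1]) auto
  next
    case False
    have "compact ({L..L+1} \<times> A)" using A by (intro compact_Times) auto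
    then have uc: "uniformly_continuous_on ({L..L+1} \<times> A) H"
      using cH by (intro compact_uniformly_continuous)
    have "continuous_on A (\<lambda>z. H (L, z))"
      by (rule continuous_on_compose2[OF cH]) (auto intro!: continuous_intros)
    then obtain zm where zm: "zm \<in> A" "\<And>z. z \<in> A \<Longrightarrow> H (L, zm) \<le> H (L, z)"
      using continuous_attains_inf[OF A False] by blast
    have "0 < H (L, zm)" using strict[of zm] zm(1) e1(1) by (auto simp: H_def A_def)
    then have "\<exists>s>0. \<forall>a\<in>{L..L+1} \<times> A. \<forall>b\<in>{L..L+1} \<times> A. dist b a < s \<longrightarrow> dist (H b) (H a) < H (L, zm)"
      using uc[unfolded uniformly_continuous_on_def, rule_format] by simp
    then obtain s where s: "0 < s"
      "\<forall>a\<in>{L..L+1} \<times> A. \<forall>b\<in>{L..L+1} \<times> A. dist b a < s \<longrightarrow> dist (H b) (H a) < H (L, zm)"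
      by blast
    show ?thesis
    proof (intro exI[of _ "min s 1"] conjI allI impI)
      fix m z assume a: "L < m \<and> m < L + min s 1 \<and> z \<in> A"
      have "dist (H (m, z)) (H (L, z)) < H (L, zm)"
        using a by (intro s(2)[rule_format]) (auto simp: dist_Pair_Pair dist_real_def)
      moreover have "H (L, zm) \<le> H (L, z)" using zm a by blast
      ultimately have "0 < H (m, z)" by (simp add: dist_real_def)
      then show "w (x + z) \<le> kelvin w x m (x + z)" by (simp add: H_def)
    qed (use s in auto)
  qed
  then obtain e3 where e3: "0 < e3" "\<And>m z. L < m \<Longrightarrow> m < L + e3 \<Longrightarrow> z \<in> A \<Longrightarrow> w (x + z) \<le> kelvin w x m (x + z)"
    by blast
  show thesis
  proof (rule that[of "min e2 e3"])
    show "0 < min e2 e3" using e2 e3 by simp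
    fix m assume m: "L < m" "m < L + min e2 e3"
    show "dominated w x m"
      unfolding dominated_def
    proof (intro allI impI)
      fix z :: "real^'n" assume z: "m \<le> norm z"
      consider "norm z < L + e1" | "max R1 R2 \<le> norm z" | "L + e1 \<le> norm z" "norm z \<le> max R1 R2"
        by linarith
      then show "w (x + z) \<le> kelvin w x m (x + z)"
      proof cases
        case 3
        then have "z \<in> A" by (simp add: A_def)
        then show ?thesis using e3(2) m by auto
      qed (use reg1 reg3 m z in auto)
    qed
  qed
qed

text \<open>By the strong maximum principle in the connected exterior, contact at one point would
  give identity everywhere, which the gap between the growth rate and w(x) / L^2 excludes at
  infinity.\<close>

lemma dominated_critical:
  assumes L: "0 < L" and d: "dominated w x L" and gr: "growth_rate * L\<^sup>2 < w x"
  obtains e where "0 < e" "\<And>m. L < m \<Longrightarrow> m < L + e \<Longrightarrow> dominated w x m"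
proof -
  let ?V = "kelvin w x L"
  define S where "S = - cball x L"
  have S: "open S" "S \<subseteq> - {x}" using L by (auto simp: S_def)
  \<comment> \<open>Connectedness of the exterior of a ball requires dimension at least 2.\<close>
  have "2 \<le> DIM(real^'n)" using card by simp
  then have conS: "connected S" unfolding S_def
    by (intro connected_complement_bounded_convex) auto
  have sV: "solution_on k S ?V (kelvin_grad w p x L) (kelvin_hess w p X x L)"
    using solution_on_kelvin[OF W, of L x] L S jet_on_subset[OF _ S] by (auto simp: solution_on_def)
  have sW: "solution_on k S w p X"
    using W jet_on_subset[OF solution_jet S(1)] by (auto simp: solution_on_def)
  have le: "w y \<le> ?V y" if "y \<in> S" for y
  proof -
    have "L \<le> norm (y - x)" using that by (simp add: S_def dist_norm norm_minus_commute)
    then show ?thesis using d unfolding dominated_def by (metis add.commute diff_add_cancel)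
  qed
  have "w y < ?V y" if y: "y \<in> S" for y
  proof (rule ccontr)
    assume "\<not> w y < ?V y"
    then have e: "w y = ?V y" using le[OF y] by simp
    have eq: "w y = ?V y" if "y \<in> S" for y
      by (rule strong_maximum_principle[OF k sW sV conS le y e that])
    obtain c where c: "growth_rate < c" "c * L\<^sup>2 < w x" using dense_growth_rate[OF L gr] by blast
    define h where "h = (w x - c * L\<^sup>2) / 2"
    have h: "0 < h" using c by (simp add: h_def)
    obtain R1 where R1: "\<And>z. R1 \<le> norm z \<Longrightarrow> w (x + z) \<le> c * (z \<bullet> z)"
      using growth_rate_bounds(2)[OF c(1)] unfolding quadratic_bound_def by blast
    obtain R2 where R2: "\<And>z. R2 \<le> norm z \<Longrightarrow> (z \<bullet> z) / L\<^sup>2 * (w x - h) \<le> ?V (x + z)"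
      using kelvin_lower_asymptotics[OF h, of L x] L by blast
    have "0 \<le> max (max R1 R2) L + 1" using L by linarith
    then obtain z :: "real^'n" where z: "norm z = max (max R1 R2) L + 1"
      using vector_choose_size by blast
    have zR: "R1 \<le> norm z" "R2 \<le> norm z" using z by linarith+
    have "x + z \<in> S" using z by (simp add: S_def dist_norm)
    then have "(z \<bullet> z) / L\<^sup>2 * (w x - h) \<le> c * (z \<bullet> z)"
      using eq[of "x + z"] R1[OF zR(1)] R2[OF zR(2)] by linarith
    moreover have zz: "0 < z \<bullet> z" using z L by auto
    ultimately have "(w x - h) / L\<^sup>2 * (z \<bullet> z) \<le> c * (z \<bullet> z)" by (simp add: mult.commute)
    then have "(w x - h) / L\<^sup>2 \<le> c" using zz by (simp only: mult_le_cancel_right_pos)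
    then have "w x - h \<le> c * L\<^sup>2" using L by (simp add: field_simps)
    then show False using h by (simp add: h_def field_simps)
  qed
  then have "w (x + z) < ?V (x + z)" if "L < norm z" for z
    using that by (simp add: S_def dist_norm)
  from critical_extension[OF L d this gr] that show thesis by blast
qed

text \<open>A finite supremum of the radii up to which all spheres are admissible is critical, since
  otherwise it could be passed. If the growth rate were 0, criticality would give w x = 0, so no
  supremum would be finite. Once the growth rate is positive, it bounds the radii.\<close>

lemma sphere_radius:
  obtains L where "0 < growth_rate" "0 < L" "dominated w x L" "w x = growth_rate * L\<^sup>2"
proof -
  define T where "T x = {L. 0 < L \<and> (\<forall>m. 0 < m \<and> m \<le> L \<longrightarrow> dominated w x m)}" for x
  have T0: "T x \<noteq> {}" for x
  proof -
    obtain L0 where "0 < L0" "\<And>L. 0 < L \<Longrightarrow> L \<le> L0 \<Longrightarrow> dominated w x L"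
      using dominated_small[of x] by blast
    then have "L0 \<in> T x" by (simp add: T_def)
    then show ?thesis by blast
  qed
  have Tcrit: "\<exists>L>0. dominated w x L \<and> w x = growth_rate * L\<^sup>2" if bdd: "bdd_above (T x)" for x
  proof -
    define L where "L = Sup (T x)"
    obtain L0 where L0: "L0 \<in> T x" using T0 by blast
    have "L0 \<le> L" unfolding L_def using L0 bdd by (rule cSup_upper)
    then have L: "0 < L" using L0 by (auto simp: T_def)
    have below: "dominated w x m" if "0 < m" "m < L" for m
    proof -
      obtain L' where "L' \<in> T x" "m < L'" using less_cSupD[OF T0] \<open>m < L\<close> unfolding L_def by blast
      then show ?thesis using that by (auto simp: T_def)
    qed
    have dL: "dominated w x L" by (rule dominated_closed[OF L below])
    have "w x = growth_rate * L\<^sup>2"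
    proof (rule ccontr)
      assume "w x \<noteq> growth_rate * L\<^sup>2"
      then have "growth_rate * L\<^sup>2 < w x" using dominated_growth_rate[OF dL L] by simp
      then obtain e where e: "0 < e" "\<And>m. L < m \<Longrightarrow> m < L + e \<Longrightarrow> dominated w x m"
        using dominated_critical[OF L dL] by blast
      have "dominated w x m" if "0 < m" "m \<le> L + e / 2" for m
      proof -
        consider "m < L" | "m = L" | "L < m" by linarith
        then show ?thesis using below dL e that by cases auto
      qed
      then have "L + e / 2 \<in> T x" using L e by (auto simp: T_def)
      then have "L + e / 2 \<le> L" unfolding L_def using bdd by (rule cSup_upper)
      then show False using e by simp
    qed
    then show ?thesis using L dL by blast
  qed
  have pos: "0 < growth_rate"
  proof (rule ccontr)
    assume "\<not> 0 < growth_rate"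
    then have g0: "growth_rate = 0" using growth_rate_bounds(1) by simp
    have "\<not> bdd_above (T x)" for x
      using Tcrit[of x] solution_pos[of x] g0 by auto
    then have "dominated w x L" if "0 < L" for x L
      using that unfolding bdd_above_def T_def by (metis (mono_tags, lifting) linorder_le_cases mem_Collect_eq)
    then show False by (rule not_always_dominated)
  qed
  have "bdd_above (T x)"
  proof (rule bdd_aboveI)
    fix L assume "L \<in> T x"
    then have L: "0 < L" "dominated w x L" by (auto simp: T_def)
    then have "growth_rate * L\<^sup>2 \<le> w x" by (intro dominated_growth_rate)
    then have "L\<^sup>2 \<le> w x / growth_rate" using pos by (simp add: field_simps)
    then show "L \<le> sqrt (w x / growth_rate)" by (simp add: real_le_rsqrt)
  qed
  from Tcrit[OF this] pos that show thesis by blast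
qed

end

section \<open>Classification\<close>

context
  fixes w :: "real^'n \<Rightarrow> real" and p :: "real^'n \<Rightarrow> real^'n" and X :: "real^'n \<Rightarrow> real^'n^'n" and k :: nat
  assumes W: "solution_on k UNIV w p X" and k: "1 \<le> k" and card: "3 \<le> CARD('n)"
begin

text \<open>The comparison function \<open>kelvin w x L\<close> seen from infinity: after the inversion in the unit
  sphere it extends smoothly across the origin.\<close>
lemma inverted_comparison:
  assumes L: "0 < L" and d: "dominated w x L"
  obtains v where "(v has_derivative (\<lambda>h. (p x - (2 * (w x / L\<^sup>2)) *\<^sub>R x) \<bullet> h)) (at 0)" "v 0 = w x / L\<^sup>2"
    "\<And>z. 0 < norm z \<Longrightarrow> norm z < 1 / (L + norm x) \<Longrightarrow> kelvin w 0 1 z \<le> v z"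
proof
  \<comment> \<open>With y = z / |z|^2 - x one has |y|^2 = Q z / |z|^2, and \<open>T z\<close> is
    the inversion of x + y in the sphere of radius \<open>L\<close> about \<open>x\<close>. The
    factor |z|^2 of the unit inversion thus cancels the singularity, and \<open>v\<close> is
    differentiable at 0.\<close>
  define Q where "Q z = 1 - 2 * (x \<bullet> z) + (x \<bullet> x) * (z \<bullet> z)" for z
  define T where "T z = x + (L\<^sup>2 / Q z) *\<^sub>R (z - (z \<bullet> z) *\<^sub>R x)" for z
  define v where "v z = Q z / L\<^sup>2 * w (T z)" for z
  have Q0: "Q 0 = 1" by (simp add: Q_def)
  have T0: "T 0 = x" by (simp add: T_def)
  show "v 0 = w x / L\<^sup>2" by (simp add: v_def Q0 T0)
  have dzz: "((\<lambda>z :: real^'n. z \<bullet> z) has_derivative (\<lambda>h. 0)) (at 0)"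
    by (rule has_derivative_eq_rhs[OF has_derivative_inner[OF has_derivative_ident has_derivative_ident]]) simp
  have dQ: "(Q has_derivative (\<lambda>h. - 2 * (x \<bullet> h))) (at 0)"
    unfolding Q_def
    by (rule has_derivative_eq_rhs[OF has_derivative_add[OF has_derivative_diff[OF has_derivative_const
        has_derivative_mult_right[OF has_derivative_inner_right[OF has_derivative_ident]]]
        has_derivative_mult_right[OF dzz]]]) (simp add: fun_eq_iff)
  have dT: "(T has_derivative (\<lambda>h. L\<^sup>2 *\<^sub>R h)) (at 0)"
    unfolding T_def
    by (rule has_derivative_eq_rhs[OF has_derivative_add[OF has_derivative_const
        has_derivative_scaleR[OF has_derivative_divide'[OF has_derivative_const dQ]
          has_derivative_diff[OF has_derivative_ident has_derivative_scaleR_left[OF dzz]]]]])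
      (auto simp: Q0 fun_eq_iff)
  have dw: "(w has_derivative (\<lambda>h. p x \<bullet> h)) (at (T 0))"
    unfolding T0 using W by (auto simp: solution_on_def intro: jet_onD(2))
  have "((\<lambda>z. w (T z)) has_derivative (\<lambda>h. p x \<bullet> (L\<^sup>2 *\<^sub>R h))) (at 0)"
    by (rule has_derivative_compose[OF dT dw])
  from has_derivative_mult[OF bounded_linear.has_derivative[OF bounded_linear_divide dQ, of "L\<^sup>2"] this]
  show "(v has_derivative (\<lambda>h. (p x - (2 * (w x / L\<^sup>2)) *\<^sub>R x) \<bullet> h)) (at 0)"
    unfolding v_def
    by (rule has_derivative_eq_rhs) (use L in \<open>auto simp: fun_eq_iff Q0 T0 inner_diff_left\<close>)
  show "kelvin w 0 1 z \<le> v z" if z: "0 < norm z" "norm z < 1 / (L + norm x)" for z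
  proof -
    have zz: "0 < z \<bullet> z" using z by simp
    define y where "y = (1 / (z \<bullet> z)) *\<^sub>R z - x"
    have y: "y = (1 / (z \<bullet> z)) *\<^sub>R (z - (z \<bullet> z) *\<^sub>R x)"
      using zz by (simp add: y_def algebra_simps)
    have "(z - (z \<bullet> z) *\<^sub>R x) \<bullet> (z - (z \<bullet> z) *\<^sub>R x) = (z \<bullet> z) * Q z"
      by (simp add: Q_def inner_diff_left inner_diff_right inner_commute algebra_simps)
    then have yy: "y \<bullet> y = Q z / (z \<bullet> z)" using zz by (simp add: y)
    have "norm ((1 / (z \<bullet> z)) *\<^sub>R z) = 1 / norm z" using z by (simp add: dot_square_norm power2_eq_square)
    \<comment> \<open>The bound on |z| places the unit inversion of \<open>z\<close> outside the
      sphere of radius \<open>L\<close> about \<open>x\<close>.\<close>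
    moreover have "L + norm x < 1 / norm z"
      using z L by (simp add: field_simps add_pos_nonneg)
    ultimately have "L \<le> norm y"
      using norm_triangle_ineq2[of "(1 / (z \<bullet> z)) *\<^sub>R z" x] by (simp add: y_def)
    then have "w (x + y) \<le> kelvin w x L (x + y)" using d by (simp add: dominated_def)
    also have "\<dots> = (y \<bullet> y) / L\<^sup>2 * w (x + (L\<^sup>2 / (y \<bullet> y)) *\<^sub>R y)" by (rule kelvin_eq)
    also have "(L\<^sup>2 / (y \<bullet> y)) *\<^sub>R y = (L\<^sup>2 / Q z) *\<^sub>R (z - (z \<bullet> z) *\<^sub>R x)"
      unfolding yy unfolding y using zz by simp
    finally have "w (x + y) \<le> (y \<bullet> y) / L\<^sup>2 * w (T z)" by (simp add: T_def)
    then have "(z \<bullet> z) * w (x + y) \<le> (z \<bullet> z) * ((y \<bullet> y) / L\<^sup>2 * w (T z))"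
      using zz by (intro mult_left_mono) auto
    also have "\<dots> = v z" using zz by (simp add: yy v_def)
    also have "(z \<bullet> z) * w (x + y) = kelvin w 0 1 z"
      by (simp add: kelvin_def inversion_def y_def)
    finally show ?thesis .
  qed
qed

lemma gradient_difference_eq:
  "p x - (2 * growth_rate w) *\<^sub>R x = p y - (2 * growth_rate w) *\<^sub>R y"
proof -
  let ?a = "growth_rate w"
  obtain Lx where Lx: "0 < ?a" "0 < Lx" "dominated w x Lx" "w x = ?a * Lx\<^sup>2"
    using sphere_radius[OF W k card, of x] by blast
  obtain Ly where Ly: "0 < Ly" "dominated w y Ly" "w y = ?a * Ly\<^sup>2"
    using sphere_radius[OF W k card, of y] by blast
  obtain vx where vx: "(vx has_derivative (\<lambda>h. (p x - (2 * (w x / Lx\<^sup>2)) *\<^sub>R x) \<bullet> h)) (at 0)" "vx 0 = w x / Lx\<^sup>2"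
    "\<And>z. 0 < norm z \<Longrightarrow> norm z < 1 / (Lx + norm x) \<Longrightarrow> kelvin w 0 1 z \<le> vx z"
    using inverted_comparison[OF Lx(2,3)] by blast
  obtain vy where vy: "(vy has_derivative (\<lambda>h. (p y - (2 * (w y / Ly\<^sup>2)) *\<^sub>R y) \<bullet> h)) (at 0)" "vy 0 = w y / Ly\<^sup>2"
    "\<And>z. 0 < norm z \<Longrightarrow> norm z < 1 / (Ly + norm y) \<Longrightarrow> kelvin w 0 1 z \<le> vy z"
    using inverted_comparison[OF Ly(1,2)] by blast
  \<comment> \<open>Criticality gives both comparison functions the same value at the origin, the
    growth rate.\<close>
  have ax: "w x / Lx\<^sup>2 = ?a" and ay: "w y / Ly\<^sup>2 = ?a" using Lx Ly by auto
  have sK: "solution_on k (- {0}) (kelvin w 0 1) (kelvin_grad w p 0 1) (kelvin_hess w p X 0 1)"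
    using W by (rule solution_on_kelvin) simp
  show ?thesis
  proof (rule touching_gradients_eq[OF card refl sK k Lx(1) vx(1)[unfolded ax] vx(2)[unfolded ax]
        vy(1)[unfolded ay] vy(2)[unfolded ay]])
    show "0 < min (1 / (Lx + norm x)) (1 / (Ly + norm y))" using Lx Ly by (simp add: add_pos_nonneg)
    show "kelvin w 0 1 z \<le> vx z \<and> kelvin w 0 1 z \<le> vy z"
      if "0 < norm z" "norm z < min (1 / (Lx + norm x)) (1 / (Ly + norm y))" for z
      using that vx(3) vy(3) by simp
    fix e d :: real assume e: "0 < e" and d: "0 < d"
    \<comment> \<open>By minimality of the growth rate, arbitrarily distant points exceed the
      smaller coefficient; inverted, they realise the upper limit.\<close>
    have "\<not> quadratic_bound w 0 (?a - e)"
      using growth_rate_bounds(3)[OF W k card, of 0 "?a - e"] e by auto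
    then obtain y where y: "1 / d + 1 \<le> norm y" "(?a - e) * (y \<bullet> y) < w y"
      unfolding quadratic_bound_def by (metis add_0 not_le)
    have "0 < 1 / d" using d by simp
    then have ny: "0 < norm y" "1 / d < norm y" using y(1) by linarith+
    define z where "z = inversion 0 1 y"
    have z: "z = (1 / (y \<bullet> y)) *\<^sub>R y" by (simp add: z_def inversion_def)
    have nz: "norm z = 1 / norm y" using ny by (simp add: z dot_square_norm power2_eq_square)
    have "y \<noteq> 0" using ny by auto
    then have "kelvin w 0 1 z = (z \<bullet> z) * w y"
      using inversion_inversion[OF card refl, of y 0 1] by (simp add: kelvin_def z_def)
    also have "z \<bullet> z = 1 / (y \<bullet> y)" using ny by (simp add: z)
    finally have "kelvin w 0 1 z = w y / (y \<bullet> y)" by simp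
    moreover have "0 < y \<bullet> y" using \<open>y \<noteq> 0\<close> by simp
    then have "?a - e < w y / (y \<bullet> y)" using y(2) by (simp only: pos_less_divide_eq)
    ultimately have "?a - e < kelvin w 0 1 z" by simp
    moreover have "norm z < d" using ny d by (simp add: nz field_simps)
    moreover have "0 < norm z" using ny by (simp add: nz)
    ultimately show "\<exists>z. 0 < norm z \<and> norm z < d \<and> ?a - e < kelvin w 0 1 z" by blast
  qed
qed

lemma solution_is_quadratic:
  obtains a d xb where "0 < a" "0 < d" "\<And>x. w x = a * ((x - xb) \<bullet> (x - xb)) + d"
    "real (CARD('n) choose k) * (2 * a * d) ^ k = 1"
proof -
  define a where "a = growth_rate w"
  have a: "0 < a" using sphere_radius[OF W k card, of 0] by (auto simp: a_def)
  \<comment> \<open>The zero of the gradient, which is p 0 + 2 a x.\<close>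
  define xb where "xb = - (1 / (2 * a)) *\<^sub>R p 0"
  have p: "p x = (2 * a) *\<^sub>R (x - xb)" for x
  proof -
    have "p x - (2 * a) *\<^sub>R x = p 0"
      using gradient_difference_eq[of x 0] by (simp add: a_def)
    moreover have "(2 * a) *\<^sub>R xb = - p 0" using a by (simp add: xb_def)
    ultimately show ?thesis by (simp add: scaleR_diff_right algebra_simps)
  qed
  have jw: "jet_on UNIV w p X" and wpos: "\<And>x. 0 < w x" using W by (auto simp: solution_on_def)
  have jd: "jet_on UNIV (\<lambda>x. w x - a * ((x - xb) \<bullet> (x - xb)))
      (\<lambda>x. p x - a *\<^sub>R (2 *\<^sub>R (x - xb))) (\<lambda>x. X x - a *\<^sub>R (2 *\<^sub>R mat 1))"
    by (intro jet_on_diff[OF jw] jet_on_scale jet_on_inner_square)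
  have "((\<lambda>x. w x - a * ((x - xb) \<bullet> (x - xb))) has_derivative (\<lambda>h. 0)) (at x)" for x
    using jet_onD(2)[OF jd, of x] by (simp add: p mult.commute)
  then obtain d where d: "\<And>x. w x - a * ((x - xb) \<bullet> (x - xb)) = d"
    using has_derivative_zero_constant[of UNIV "\<lambda>x. w x - a * ((x - xb) \<bullet> (x - xb))"] by auto
  have w: "w x = a * ((x - xb) \<bullet> (x - xb)) + d" for x using d[of x] by simp
  have d0: "0 < d" using w[of xb] wpos[of xb] by simp
  \<comment> \<open>At \<open>xb\<close> the gradient vanishes, so the matrix there is 2 a d times
    the identity and the equation fixes the product a d.\<close>
  have "(p has_derivative (\<lambda>h. (2 * a) *\<^sub>R h)) (at xb)"
    unfolding p by (auto intro!: derivative_eq_intros)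
  from has_derivative_unique[OF this jet_onD(3)[OF jw]]
  have "X xb = (2 * a) *\<^sub>R mat 1"
    by (simp add: matrix_eq fun_eq_iff scaleR_matrix_vector_assoc[symmetric])
  then have "amat (w xb) (p xb) (X xb) = (2 * a * d) *\<^sub>R mat 1" by (simp add: amat_def p w mult_ac)
  moreover have "sigma_mat k (amat (w xb) (p xb) (X xb)) = 1"
    using W by (simp add: solution_on_def)
  ultimately have "sigma_mat k ((2 * a * d) *\<^sub>R (mat 1 :: real^'n^'n)) = 1" by metis
  then have "real (CARD('n) choose k) * (2 * a * d) ^ k = 1" by (simp only: sigma_mat_scaleR_one)
  with a d0 w show thesis by (rule that)
qed

end

text \<open>With b = -2 / (n - 2) one has 2 b - 1 = -(n + 2) / (n - 2), 2 b - 2 = -2 n / (n - 2), b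
  (b - 1) = 2 n / (n - 2)^2 and b^2 / 2 = 2 / (n - 2)^2: the exponents and coefficients of the
  conformal Hessian.\<close>

lemma conf_hess_eq_amat:
  fixes u :: "real^'n \<Rightarrow> real"
  assumes card: "3 \<le> CARD('n)" and u: "0 < u x" and b: "b = - 2 / (real CARD('n) - 2)"
  shows "conf_hess u x = amat (u x powr b) ((b * u x powr (b - 1)) *\<^sub>R grad u x)
    ((b * u x powr (b - 1)) *\<^sub>R hess u x + (b * ((b - 1) * u x powr (b - 2))) *\<^sub>R outer (grad u x))"
proof -
  define n where "n = real CARD('n)"
  have n: "2 < n" using card by (simp add: n_def)
  have bn: "b = - 2 / (n - 2)" by (simp add: b n_def)
  have "b + (b - 1) = - (n + 2) / (n - 2)" using n by (simp add: bn divide_simps) (simp add: algebra_simps)?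
  then have e1: "u x powr b * u x powr (b - 1) = u x powr (- (n + 2) / (n - 2))"
    by (simp only: powr_add[symmetric])
  have "b + (b - 2) = - (2 * n) / (n - 2)" using n by (simp add: bn divide_simps) (simp add: algebra_simps)?
  then have e2: "u x powr b * u x powr (b - 2) = u x powr (- (2 * n) / (n - 2))"
    by (simp only: powr_add[symmetric])
  have "(b - 1) + (b - 1) = - (2 * n) / (n - 2)" using n by (simp add: bn divide_simps) (simp add: algebra_simps)?
  then have e3: "u x powr (b - 1) * u x powr (b - 1) = u x powr (- (2 * n) / (n - 2))"
    by (simp only: powr_add[symmetric])
  have b1: "b * (b - 1) = 2 * n / (n - 2)\<^sup>2" and b2: "b * b = 4 / (n - 2)\<^sup>2"
    using n by (simp_all add: bn field_simps power2_eq_square)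
  have "amat (u x powr b) ((b * u x powr (b - 1)) *\<^sub>R grad u x)
      ((b * u x powr (b - 1)) *\<^sub>R hess u x + (b * ((b - 1) * u x powr (b - 2))) *\<^sub>R outer (grad u x))
    = (b * (u x powr b * u x powr (b - 1))) *\<^sub>R hess u x
      + ((b * (b - 1)) * (u x powr b * u x powr (b - 2))) *\<^sub>R outer (grad u x)
      - ((b * b) * (u x powr (b - 1) * u x powr (b - 1)) * (grad u x \<bullet> grad u x) / 2) *\<^sub>R mat 1"
    by (simp add: amat_def scaleR_add_right mult_ac)
  also have "\<dots> = conf_hess u x"
    unfolding e1 e2 e3 b1 b2
    unfolding conf_hess_def Let_def n_def[symmetric] bn outer_def dot_square_norm by simp
  finally show ?thesis ..
qed

theorem theorem2:
  fixes u :: "real^'n \<Rightarrow> real" and k :: nat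
  assumes "3 \<le> CARD('n)" and "1 \<le> k" and "k \<le> CARD('n)"
    and "C2_on UNIV u" and "\<And>x. 0 < u x"
    and "\<And>x. elem_sym k (eigenvalues (conf_hess u x)) = 1"
    and "\<And>x. eigenvalues (conf_hess u x) \<in> garding_cone k"
  shows "\<exists>a > 0. \<exists>xbar :: real^'n. \<forall>x.
    u x = 2 powr ((real CARD('n) - 2) / 4)
          * real (CARD('n) choose k) powr ((real CARD('n) - 2) / (4 * real k))
          * (a / (1 + a\<^sup>2 * (norm (x - xbar))\<^sup>2)) powr ((real CARD('n) - 2) / 2)"
proof -
  define n where "n = real CARD('n)"
  define b where "b = - 2 / (n - 2)"
  have n: "2 < n" using assms(1) by (simp add: n_def)
  have jw: "jet_on UNIV (\<lambda>x. u x powr b) (\<lambda>x. (b * u x powr (b - 1)) *\<^sub>R grad u x)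
     (\<lambda>x. (b * u x powr (b - 1)) *\<^sub>R hess u x + (b * ((b - 1) * u x powr (b - 2))) *\<^sub>R outer (grad u x))"
    using assms(5) by (intro jet_on_powr jet_on_C2 assms(4))
  note A = conf_hess_eq_amat[OF assms(1,5) b_def[unfolded n_def]]
  have sym: "transpose (conf_hess u x) = conf_hess u x" for x
    unfolding A amat_def
    using jet_onD(5)[OF jw, of x] by (simp add: transpose_diff transpose_scaleR)
  have sol: "solution_on k UNIV (\<lambda>x. u x powr b) (\<lambda>x. (b * u x powr (b - 1)) *\<^sub>R grad u x)
     (\<lambda>x. (b * u x powr (b - 1)) *\<^sub>R hess u x + (b * ((b - 1) * u x powr (b - 2))) *\<^sub>R outer (grad u x))"
    unfolding solution_on_def
  proof (intro conjI ballI jw)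
    fix y
    show "0 < u y powr b" using assms(5)[of y] by simp
    show "amat (u y powr b) ((b * u y powr (b - 1)) *\<^sub>R grad u y)
        ((b * u y powr (b - 1)) *\<^sub>R hess u y + (b * ((b - 1) * u y powr (b - 2))) *\<^sub>R outer (grad u y))
        \<in> mat_cone k"
      using mat_cone_of_garding(1)[OF sym assms(3,7)] unfolding A .
    show "sigma_mat k (amat (u y powr b) ((b * u y powr (b - 1)) *\<^sub>R grad u y)
        ((b * u y powr (b - 1)) *\<^sub>R hess u y + (b * ((b - 1) * u y powr (b - 2))) *\<^sub>R outer (grad u y))) = 1"
      using mat_cone_of_garding(2)[OF sym assms(3,7)] assms(6) unfolding A by simp
  qed
  obtain c d xb where cd: "0 < c" "0 < d" and w: "\<And>x. u x powr b = c * ((x - xb) \<bullet> (x - xb)) + d"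
    and eq: "real (CARD('n) choose k) * (2 * c * d) ^ k = 1"
    using solution_is_quadratic[OF sol assms(2,1)] by blast
  define C where "C = real (CARD('n) choose k)"
  have C: "0 < C" using assms(3) by (simp add: C_def)
  have cd2: "c * d = (1 / 2) * C powr (- 1 / k)"
  proof -
    have "(2 * c * d) ^ k = 1 / C" using eq C by (simp add: C_def[symmetric] field_simps)
    then have "(2 * c * d) powr k = 1 / C" using cd by (simp add: powr_realpow)
    then have "((2 * c * d) powr k) powr (1 / k) = (1 / C) powr (1 / k)" by simp
    then have "2 * c * d = (1 / C) powr (1 / k)" using cd assms(2) by (simp add: powr_powr)
    then show ?thesis using C by (simp add: powr_divide powr_minus_divide)
  qed
  \<comment> \<open>Since w = d (1 + a^2 |x - xb|^2), the bracket in the statement is a d / w, and a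
    d = sqrt (c d) is the constant fixed by the equation; c / d stays free.\<close>
  define a where "a = sqrt (c / d)"
  have a: "0 < a" "a\<^sup>2 = c / d" using cd by (auto simp: a_def)
  show ?thesis
  proof (intro exI[of _ a] conjI exI[of _ xb] allI)
    show "0 < a" by (rule a)
    fix x
    let ?s = "(n - 2) / 2"
    define q where "q = u x powr b"
    have q: "0 < q" using assms(5)[of x] by (simp add: q_def)
    have "1 + a\<^sup>2 * (norm (x - xb))\<^sup>2 = q / d"
      using cd by (simp add: q_def w a dot_square_norm field_simps)
    moreover have "a * d = sqrt (c * d)"
    proof -
      have "a * d = sqrt (c / d) * sqrt (d * d)" using cd by (simp add: a_def)
      also have "\<dots> = sqrt (c / d * (d * d))" by (rule real_sqrt_mult[symmetric])
      also have "c / d * (d * d) = c * d" using cd by simp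
      finally show ?thesis .
    qed
    ultimately have f: "a / (1 + a\<^sup>2 * (norm (x - xb))\<^sup>2) = sqrt (c * d) * q powr (- 1)"
      using cd q by (simp add: powr_minus_divide)
    have "(a / (1 + a\<^sup>2 * (norm (x - xb))\<^sup>2)) powr ?s = (c * d) powr ((n - 2) / 4) * q powr (- ?s)"
    proof -
      have "sqrt (c * d) = (c * d) powr (1 / 2)" using cd by (simp only: powr_half_sqrt mult_pos_pos less_imp_le)
      then have "sqrt (c * d) powr ?s = (c * d) powr (1 / 2 * ?s)" by (simp only: powr_powr)
      moreover have "(q powr (- 1)) powr ?s = q powr (- ?s)" by (simp only: powr_powr mult_minus1)
      ultimately show ?thesis unfolding f using cd q by (subst powr_mult) auto
    qed
    moreover have "q powr (- ?s) = u x"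
    proof -
      have "b * - ?s = 1" using n by (simp add: b_def divide_simps)
      then show ?thesis using assms(5)[of x] by (simp only: q_def powr_powr powr_one less_imp_le)
    qed
    \<comment> \<open>The constant c(n, k) is the reciprocal of (c d)^((n - 2) / 4), since c d =
      C^(-1/k) / 2.\<close>
    moreover have "2 powr ((n - 2) / 4) * C powr ((n - 2) / (4 * k)) * (c * d) powr ((n - 2) / 4) = 1"
    proof -
      have "(c * d) powr ((n - 2) / 4) = (1 / 2) powr ((n - 2) / 4) * C powr (- ((n - 2) / (4 * k)))"
      proof -
        have "(- 1 / real k) * ((n - 2) / 4) = - ((n - 2) / (4 * k))" by simp
        then have "(C powr (- 1 / k)) powr ((n - 2) / 4) = C powr (- ((n - 2) / (4 * k)))"
          by (simp only: powr_powr)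
        then show ?thesis unfolding cd2 using C by (subst powr_mult) auto
      qed
      then show ?thesis using C by (simp add: powr_divide powr_minus field_simps)
    qed
    ultimately show "u x = 2 powr ((real CARD('n) - 2) / 4)
          * real (CARD('n) choose k) powr ((real CARD('n) - 2) / (4 * real k))
          * (a / (1 + a\<^sup>2 * (norm (x - xb))\<^sup>2)) powr ((real CARD('n) - 2) / 2)"
      unfolding n_def[symmetric] C_def[symmetric] by (simp add: mult.assoc[symmetric])
  qed
qed

end
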